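(* Let $0<a<b$, $\lambda\ge0$, and let $\Omega_\lambda$ be a minimizer of $J_\lambda$ over $\mathscr{C}_{a,b}$. Then the boundary of $\Omega_\lambda$ can be decomposed into a union of arcs of $\partial D_a$ and $\partial D_b$ and segments $L_i$ belonging to $\mathscr{L}^a_b\cup\mathscr{L}^a\cup\mathscr{L}_b$.
   Context: $D_r$ is the closed disc in $\mathbb{R}^2$ of radius $r$ centered at the origin $O$. $|\Omega|$ is the area and $P(\Omega)$ the perimeter; $J_\lambda(\Omega)=\lambda|\Omega|-P(\Omega)$. $\mathscr{C}_{a,b}$ is the class of compact convex $K\subseteq\mathbb{R}^2$ with $D_a\subseteq K\subseteq D_b$. Let $\xi_0\in(0,\pi/2)$ be defined by $\cos\xi_0=a/b$. A chord of $D_b$ is a segment with both endpoints on $\partial D_b$. For $\Omega\in\mathscr{C}_{a,b}$, the following classes of segments contained in $\partial\Omega$ are considered (counted with multiplicity): - $\mathscr{L}^a$: tangent sides to $D_a$ which are not chords of $D_b$, counted via their portions as follows: two segments $P_iP_j$, $P_jP_k$ tangent to $D_a$ with tangency points $P_i,P_k\in\partial D_a$ and common vertex $P_j\notin\partial D_b$ are identified and count as one element; each has length $a\tan\theta$, where $\theta\in(0,\xi_0)$ is the angle it subtends at $O$. - $\mathscr{L}_b$: chords of $D_b$ not tangent to $D_a$; the two halves of such a chord (cut at its midpoint) are identified and count as one element; each half has length $b\sin\eta$, where $\eta\in(0,\xi_0)$ is the angle it subtends at $O$. - $\mathscr{L}^a_b$: segments $P_iP_j$ tangent to $D_a$ at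 $P_j\in\partial D_a$ with $P_i\in\partial D_b$ (halves of chords of $D_b$ tangent to $D_a$); each has length $\sqrt{b^2-a^2}$ and subtends the angle $\xi_0$ at $O$; they are counted in couples (two such segments count as one element). *)

theory Defs
  imports "HOL-Analysis.Analysis"
begin

text \<open>The Euclidean plane is rendered as \<open>complex\<close>; its inner product, norm and Lebesgue measure are
  those of $\mathbb{R}^2$.\<close>

definition convex_ring_class :: "real \<Rightarrow> real \<Rightarrow> complex set set" where
  "convex_ring_class a b = {K. compact K \<and> convex K \<and> cball 0 a \<subseteq> K \<and> K \<subseteq> cball 0 b}"

definition curve_length :: "(real \<Rightarrow> 'a::metric_space) \<Rightarrow> real \<Rightarrow> real \<Rightarrow> real" where
  "curve_length g s t = Sup {(\<Sum>i<n. dist (g (x i)) (g (x (Suc i)))) | (n::nat) x.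
     x 0 = s \<and> x n = t \<and> (\<forall>i<n. x i \<le> x (Suc i))}"

text \<open>For a convex body having 0 in its interior, the boundary is the closed curve
  \<open>boundary_point K\<close> on \<open>[0, 2 * pi]\<close> (see \<open>frontier_eq_boundary_points\<close>), and this parametrization
  is injective up to the common endpoint. The perimeter is its length; the supremum defining the
  length is over a bounded set because \<open>K\<close> is bounded and convex.\<close>

definition radial :: "complex set \<Rightarrow> real \<Rightarrow> real" where
  "radial K t = Sup {r. of_real r * cis t \<in> K}"

definition boundary_point :: "complex set \<Rightarrow> real \<Rightarrow> complex" where
  "boundary_point K t = of_real (radial K t) * cis t"

definition perimeter :: "complex set \<Rightarrow> real" where
  "perimeter K = curve_length (boundary_point K) 0 (2 * pi)"

definition area :: "complex set \<Rightarrow> real" where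
  "area K = measure lebesgue K"

definition J :: "real \<Rightarrow> complex set \<Rightarrow> real" where
  "J l K = l * area K - perimeter K"

lemma boundary_point_in_frontier:
  assumes "0 < a" "compact K" "cball 0 a \<subseteq> K"
  shows "boundary_point K t \<in> frontier K" and "0 < radial K t"
    and "\<And>r. of_real r * cis t \<in> K \<Longrightarrow> r \<le> radial K t"
proof -
  let ?R = "{r. of_real r * cis t \<in> K}"
  have "bounded K" using assms(2) compact_imp_bounded by blast
  then obtain B where B: "\<And>z. z \<in> K \<Longrightarrow> norm z \<le> B" by (auto simp: bounded_iff)
  have bdd: "bdd_above ?R"
  proof (rule bdd_aboveI)
    fix r assume "r \<in> ?R"
    then have "norm (of_real r * cis t) \<le> B" using B by blast
    then show "r \<le> B" by (simp add: norm_mult)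
  qed
  have "of_real a * cis t \<in> cball 0 a" using assms(1) by (simp add: norm_mult)
  then have aR: "a \<in> ?R" using assms(3) by blast
  show le: "\<And>r. of_real r * cis t \<in> K \<Longrightarrow> r \<le> radial K t"
    unfolding radial_def by (intro cSup_upper bdd) auto
  then show "0 < radial K t" using aR assms(1) by fastforce
  have "closed ?R"
  proof -
    have "closed ((\<lambda>r::real. of_real r * cis t) -` K)"
      by (rule closed_vimage) (auto intro!: continuous_intros simp: assms(2) compact_imp_closed)
    then show ?thesis by (simp add: vimage_def)
  qed
  then have "radial K t \<in> ?R" unfolding radial_def
    by (intro closed_contains_Sup bdd) (use aR in auto)
  then have bK: "boundary_point K t \<in> K" by (simp add: boundary_point_def)
  moreover have "boundary_point K t \<notin> interior K"
  proof
    assume "boundary_point K t \<in> interior K"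
    then obtain e where e: "e > 0" "cball (boundary_point K t) e \<subseteq> K"
      by (meson mem_interior_cball)
    have "of_real (radial K t + e) * cis t \<in> cball (boundary_point K t) e"
      using e(1) by (simp add: boundary_point_def dist_norm algebra_simps norm_mult)
    then show False using e le by fastforce
  qed
  ultimately show "boundary_point K t \<in> frontier K"
    by (simp add: frontier_def closure_def)
qed

lemma frontier_eq_boundary_points:
  assumes "0 < a" "compact K" "convex K" "cball 0 a \<subseteq> K"
  shows "frontier K = boundary_point K ` {0..2 * pi}"
proof (intro equalityI subsetI)
  fix z assume z: "z \<in> frontier K"
  have zK: "z \<in> K" using z assms(2) by (simp add: compact_imp_closed frontier_def)
  have "ball 0 a \<subseteq> interior K"
    using assms(4) by (intro interior_maximal) auto
  then have int0: "0 \<in> interior K" using assms(1) by auto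
  obtain t where t: "0 \<le> t" "t < 2 * pi" "z = of_real (norm z) * cis t"
  proof (cases "Arg z \<ge> 0")
    case True
    then show ?thesis
      using that[of "Arg z"] Arg_le_pi[of z] pi_gt_zero rcis_cmod_Arg[of z]
      by (simp add: rcis_def)
  next
    case False
    then show ?thesis
      using that[of "Arg z + 2 * pi"] mpi_less_Arg[of z] pi_gt_zero rcis_cmod_Arg[of z]
      by (simp add: rcis_def flip: cis_mult)
  qed
  note b = boundary_point_in_frontier[OF assms(1,2,4), where t = t]
  have "of_real (norm z) * cis t \<in> K" using zK by (subst t(3)[symmetric])
  then have "norm z \<le> radial K t" by (rule b(3))
  moreover have "\<not> norm z < radial K t"
  proof
    assume lt: "norm z < radial K t"
    let ?y = "boundary_point K t" and ?u = "1 - norm z / radial K t"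
    have y: "?y \<in> closure K" using b(1) by (simp add: frontier_def)
    have u: "0 < ?u" "?u \<le> 1" using lt b(2) by (auto simp: field_simps)
    have "?y - ?u *\<^sub>R (?y - 0) \<in> interior K"
      by (rule mem_interior_closure_convex_shrink[OF assms(3) int0 y u])
    moreover have "?y - ?u *\<^sub>R (?y - 0) = z"
    proof -
      have "?y - ?u *\<^sub>R (?y - 0) = of_real (norm z / radial K t * radial K t) * cis t"
        by (simp add: boundary_point_def scaleR_conv_of_real algebra_simps)
      also have "\<dots> = z" using b(2) t(3) by (simp del: of_real_mult of_real_divide)
      finally show ?thesis .
    qed
    ultimately show False using z by (simp add: frontier_def)
  qed
  ultimately show "z \<in> boundary_point K ` {0..2 * pi}"
    using t by (intro image_eqI[of _ _ t]) (auto simp: boundary_point_def)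
next
  fix z assume "z \<in> boundary_point K ` {0..2 * pi}"
  then show "z \<in> frontier K" using boundary_point_in_frontier(1)[OF assms(1,2,4)] by auto
qed

text \<open>\<open>tangent_at a T S\<close>: the segment \<open>S\<close> lies on the tangent line of the circle of radius \<open>a\<close>
  at \<open>T\<close>, and \<open>T\<close> belongs to \<open>S\<close> (possibly as an endpoint).\<close>

definition tangent_at :: "real \<Rightarrow> complex \<Rightarrow> complex set \<Rightarrow> bool" where
  "tangent_at a T S \<longleftrightarrow> norm T = a \<and> T \<in> S \<and> (\<forall>x\<in>S. inner T (x - T) = 0)"

text \<open>The three classes are sets of individual segments contained in the boundary. Counting two
  segments as one element concerns cardinalities only; what membership retains of it is that a
  segment of the first class must come with its mate \<open>[V, Q]\<close> (which is then also a member), and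
  that the two halves of a chord are members together.\<close>

definition tangent_portions :: "real \<Rightarrow> real \<Rightarrow> complex set \<Rightarrow> complex set set" where
  "tangent_portions a b \<Omega> = {closed_segment P V | P V. V \<notin> sphere 0 b \<and>
     tangent_at a P (closed_segment P V) \<and> closed_segment P V \<subseteq> frontier \<Omega> \<and>
     (\<exists>Q. Q \<noteq> P \<and> tangent_at a Q (closed_segment V Q) \<and> closed_segment V Q \<subseteq> frontier \<Omega>)}"

definition chord_halves :: "real \<Rightarrow> real \<Rightarrow> complex set \<Rightarrow> complex set set" where
  "chord_halves a b \<Omega> = {closed_segment P (midpoint P Q) | P Q.
     P \<in> sphere 0 b \<and> Q \<in> sphere 0 b \<and> P \<noteq> Q \<and> closed_segment P Q \<subseteq> frontier \<Omega> \<and>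
     \<not> (\<exists>T. tangent_at a T (closed_segment P Q))}"

definition tangent_chord_halves :: "real \<Rightarrow> real \<Rightarrow> complex set \<Rightarrow> complex set set" where
  "tangent_chord_halves a b \<Omega> = {closed_segment P T | P T. P \<in> sphere 0 b \<and>
     tangent_at a T (closed_segment P T) \<and> closed_segment P T \<subseteq> frontier \<Omega>}"

text \<open>Closed arcs, from a single point up to the whole circle. Single points cannot be excluded: for
  \<open>l = 2 / a\<close> every body of the class that is circumscribed about the disc of radius \<open>a\<close> minimizes
  \<open>J l\<close>, and its set of contact points with the circle may be a Cantor set.\<close>

definition circular_arc :: "real \<Rightarrow> complex set \<Rightarrow> bool" where
  "circular_arc r X \<longleftrightarrow> (\<exists>s t. s \<le> t \<and> t \<le> s + 2 * pi \<and> X = (\<lambda>u. of_real r * cis u) ` {s..t})"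

text \<open>The members of a decomposition do not overlap. The last clause prevents the use of single
  points as arcs except at points where nondegenerate (that is, infinite) members accumulate.\<close>

definition decomposes :: "complex set set \<Rightarrow> complex set \<Rightarrow> bool" where
  "decomposes \<P> C \<longleftrightarrow> C = \<Union>\<P> \<and> pairwise (\<lambda>X Y. finite (X \<inter> Y)) \<P> \<and>
     C \<subseteq> closure (\<Union>{X \<in> \<P>. infinite X})"

end

theory Submission
  imports Defs
begin

text \<open>Minimizing \<open>J l\<close> means maximizing perimeter minus \<open>l\<close> times area, and the reason for the theorem is that
this functional is convex along the natural deformations of a polygonal chain: if a vertex moves along
a line, the enclosed area is affine in the position of the vertex and the length is convex, strictly
so as soon as one of the two edges ending at the vertex does not lie on that line. A convex functional
prefers extreme configurations, so a maximizer has as few edges as the constraints allow.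

\<^item> Combinatorial core (\<open>convex_chain_two_edges\<close>): a convex chain can be replaced by one of at most
  two edges with the same endpoints, without loss of value and with a strict gain if the chain has edges
  in three different directions.

\<^item> Short arcs (\<open>three_arcs\<close>): near a boundary point \<open>x\<close> in the open ring, replacing an arc by a
  two-edge chain inside its support triangle respects both discs (\<open>two_edge_comparison\<close>). Inscribed
  polygons and compactness bound the value of each arc by that of a two-edge chain. Cut a short arc into
  three consecutive arcs, and bound each of them in this way. If there were turning on both sides of the
  middle arc, the resulting chain of six edges would have three directions and could be improved
  strictly. Hence one of the outer arcs is straight, and shrinking the arcs shows that \<open>x\<close> is the end of
  a boundary segment on either side (\<open>adjacent_segments\<close>).

\<^item> Faces (\<open>free_vertex_touches\<close>): suppose that a maximal boundary segment ends at a vertex \<open>y\<close> in the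
  open ring and stays away from the inner disc. Then \<open>y\<close> can be moved both ways along the line of the
  other segment at \<open>y\<close>, and strict convexity makes one of the two moves an improvement. So a maximal
  boundary segment that does not touch the inner disc is a chord of the outer disc, and in a tangent
  segment each end that lies in the open ring is a vertex whose other segment is tangent as well.

\<^item> Decomposition: the three classes of segments therefore cover the part of the boundary in the open
  ring. The rest of the boundary lies on the two circles and is cut into the connected components
  of the two contact sets (\<open>frontier_decomposes\<close>).\<close>

section \<open>Planar vectors and polygonal chains\<close>

text \<open>Positive if and only if \<open>w\<close> points to the left of \<open>z\<close>; twice the signed area of the triangle
  \<open>0, z, w\<close>.\<close>

definition cross :: "complex \<Rightarrow> complex \<Rightarrow> real" where
  "cross z w = Re z * Im w - Im z * Re w"

lemma cross_add_right: "cross z (v + w) = cross z v + cross z w"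
  and cross_add_left: "cross (v + w) z = cross v z + cross w z"
  and cross_diff_right: "cross z (v - w) = cross z v - cross z w"
  and cross_diff_left: "cross (v - w) z = cross v z - cross w z"
  and cross_scaleR_right [simp]: "cross z (c *\<^sub>R w) = c * cross z w"
  and cross_scaleR_left [simp]: "cross (c *\<^sub>R z) w = c * cross z w"
  and cross_self [simp]: "cross z z = 0"
  and cross_zero_left [simp]: "cross 0 z = 0"
  and cross_zero_right [simp]: "cross z 0 = 0"
  by (simp_all add: cross_def algebra_simps)

lemmas cross_bilinear = cross_add_right cross_add_left cross_diff_right cross_diff_left

lemma cross_commute: "cross w z = - cross z w"
  by (simp add: cross_def)

lemma cross_eq_inner: "cross z w = inner (\<i> * z) w"
  by (simp add: cross_def inner_complex_def)

text \<open>Three vectors of the plane are linearly dependent; this is the dependency. Every statement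
  below about the order of directions is an instance of it.\<close>

lemma cross_cyclic: "cross e g *\<^sub>R f = cross e f *\<^sub>R g + cross f g *\<^sub>R e"
  by (simp add: cross_def complex_eq_iff algebra_simps)

lemma orthogonal_decomposition: "inner z z *\<^sub>R e = inner z e *\<^sub>R z + cross z e *\<^sub>R (\<i> * z)"
  by (simp add: complex_eq_iff inner_complex_def cross_def algebra_simps)

lemma cross_cyclic_value: "cross e g * cross x f = cross e f * cross x g + cross f g * cross x e"
  by (simp add: cross_def algebra_simps)

text \<open>``To the left of'' is not transitive in general, but it is among the vectors of an open
  half-plane. The half-plane consists of the vectors to the left of \<open>x\<close>.\<close>

lemma cross_trans_strict:
  assumes "0 < cross x e" "0 < cross x f" "0 < cross x g"
    and "0 \<le> cross e f" "0 \<le> cross f g" "0 < cross e f \<or> 0 < cross f g"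
  shows "0 < cross e g"
proof -
  have "0 < cross e f * cross x g + cross f g * cross x e"
    using assms by (auto intro: add_pos_nonneg add_nonneg_pos)
  then show ?thesis
    using assms(2) by (simp flip: cross_cyclic_value add: zero_less_mult_iff)
qed

lemma cross_trans:
  assumes "0 < cross x e" "0 < cross x f" "0 < cross x g" "0 \<le> cross e f" "0 \<le> cross f g"
  shows "0 \<le> cross e g"
proof -
  have "0 \<le> cross e f * cross x g + cross f g * cross x e"
    using assms by auto
  then show ?thesis
    using assms(2) by (simp flip: cross_cyclic_value add: zero_le_mult_iff)
qed

lemma parallel_imp_multiple:
  assumes "0 < cross x e" "0 < cross x f" "cross e f = 0"
  obtains k where "k > 0" "f = k *\<^sub>R e"
proof
  show "cross x f / cross x e > 0" using assms by simp
  have "cross x f *\<^sub>R e = cross x e *\<^sub>R f"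
    using cross_cyclic[of x f e] assms(3) by simp
  then have "(1 / cross x e) *\<^sub>R (cross x f *\<^sub>R e) = (1 / cross x e) *\<^sub>R (cross x e *\<^sub>R f)"
    by (rule arg_cong)
  then show "f = (cross x f / cross x e) *\<^sub>R e" using assms by simp
qed

lemma norm_convex_strict:
  fixes v w :: complex
  assumes "cross v w \<noteq> 0" "0 < c" "0 < d"
  shows "norm (c *\<^sub>R v + d *\<^sub>R w) < c * norm v + d * norm w"
proof -
  have "norm (c *\<^sub>R v + d *\<^sub>R w) \<noteq> norm (c *\<^sub>R v) + norm (d *\<^sub>R w)"
  proof
    assume "norm (c *\<^sub>R v + d *\<^sub>R w) = norm (c *\<^sub>R v) + norm (d *\<^sub>R w)"
    then have "norm (c *\<^sub>R v) *\<^sub>R (d *\<^sub>R w) = norm (d *\<^sub>R w) *\<^sub>R (c *\<^sub>R v)"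
      by (simp only: norm_triangle_eq)
    then have "cross v (norm (c *\<^sub>R v) *\<^sub>R (d *\<^sub>R w)) = cross v (norm (d *\<^sub>R w) *\<^sub>R (c *\<^sub>R v))"
      by (rule arg_cong)
    then have "c * norm v * d * cross v w = 0" using assms by simp
    then show False using assms by auto
  qed
  then show ?thesis using norm_triangle_ineq[of "c *\<^sub>R v" "d *\<^sub>R w"] assms by simp
qed

text \<open>The chain starts at \<open>p\<close> and has the edges \<open>es\<close>. Its value is its length minus \<open>l\<close> times the signed
  area that the segment from \<open>0\<close> to a point running along the chain sweeps out.\<close>

fun chain_value :: "real \<Rightarrow> complex \<Rightarrow> complex list \<Rightarrow> real" where
  "chain_value l p [] = 0"
| "chain_value l p (e # es) = norm e - l / 2 * cross p e + chain_value l (p + e) es"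

lemma chain_value_append:
  "chain_value l p (es @ fs) = chain_value l p es + chain_value l (p + sum_list es) fs"
  by (induction es arbitrary: p) (auto simp: add.assoc)

lemma chain_value_filter_nonzero:
  "chain_value l p (filter (\<lambda>e. e \<noteq> 0) es) = chain_value l p es"
  by (induction es arbitrary: p) auto

lemma sum_list_filter_nonzero:
  "sum_list (filter (\<lambda>e. e \<noteq> 0) es) = (sum_list es :: 'a::comm_monoid_add)"
  by (induction es) auto

lemma chain_value_merge:
  assumes "k \<ge> 0"
  shows "chain_value l p (e # k *\<^sub>R e # es) = chain_value l p ((e + k *\<^sub>R e) # es)"
proof -
  have "e + k *\<^sub>R e = (1 + k) *\<^sub>R e" by (simp add: scaleR_add_left)
  then have "norm (e + k *\<^sub>R e) = (1 + k) * norm e" using assms by simp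
  then show ?thesis using assms by (simp add: cross_bilinear algebra_simps)
qed

text \<open>The vertex between the first two edges moves along the line of the first edge, from
  the start of the chain to the point where that line meets the line of the last edge. At both
  ends of this range one edge has disappeared. In between the area is affine and the length is strictly
  convex in the position, so one of the ends is strictly better than the given chain.\<close>

lemma chain_three_edges:
  assumes "0 < cross x e" "0 < cross x u" "0 < cross x w" "0 < cross e u" "0 < cross u w"
  obtains \<alpha> \<beta> where "0 < \<alpha>" "0 < \<beta>" "u = \<alpha> *\<^sub>R e + \<beta> *\<^sub>R w"
    "chain_value l p [e, u, w] < chain_value l p [e + u, w] \<or>
     chain_value l p [e, u, w] < chain_value l p [(1 + \<alpha>) *\<^sub>R e, (1 + \<beta>) *\<^sub>R w]"
proof -
  define \<alpha> \<beta> where "\<alpha> = cross u w / cross e w" and "\<beta> = cross e u / cross e w"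
  have ew: "0 < cross e w" using cross_trans_strict[of x e u w] assms by auto
  have pos: "\<alpha> > 0" "\<beta> > 0" using assms ew by (auto simp: \<alpha>_def \<beta>_def)
  have "cross e w *\<^sub>R u = cross e w *\<^sub>R (\<alpha> *\<^sub>R e + \<beta> *\<^sub>R w)"
    using ew cross_cyclic[of e w u] by (simp add: \<alpha>_def \<beta>_def scaleR_add_right)
  then have u: "u = \<alpha> *\<^sub>R e + \<beta> *\<^sub>R w" using ew by simp
  define f where "f s = (1 + s) * norm e + norm (u - s *\<^sub>R e) + norm w - l / 2 *
    (cross p e + cross p u + cross (p + e + u) w + (1 + s) * cross e u)" for s
  have f0: "chain_value l p [e, u, w] = f 0"
    by (simp add: f_def cross_bilinear algebra_simps)
  have f1: "chain_value l p [e + u, w] = f (-1)"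
    by (simp add: f_def cross_bilinear algebra_simps)
  have n: "norm ((1 + \<beta>) *\<^sub>R w) = \<beta> * norm w + norm w" "norm ((1 + \<alpha>) *\<^sub>R e) = (1 + \<alpha>) * norm e"
    using pos by (auto simp: distrib_right)
  have n': "norm (u - \<alpha> *\<^sub>R e) = \<beta> * norm w" using pos(2) by (subst u) simp
  have c: "cross p u = \<alpha> * cross p e + \<beta> * cross p w" "cross e u = \<beta> * cross e w"
    "cross u w = \<alpha> * cross e w" by (simp_all add: u cross_bilinear)
  have f2: "chain_value l p [(1 + \<alpha>) *\<^sub>R e, (1 + \<beta>) *\<^sub>R w] = f \<alpha>"
    by (simp add: f_def n n' c cross_bilinear del: norm_scaleR) (simp add: algebra_simps)
  let ?c = "\<alpha> / (1 + \<alpha>)" and ?d = "1 / (1 + \<alpha>)"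
  have cd: "?c > 0" "?d > 0" "?c + ?d = 1" using pos by (auto simp: field_simps)
  have "cross (u + e) (u - \<alpha> *\<^sub>R e) = (1 + \<alpha>) * cross e u"
    by (simp add: cross_bilinear algebra_simps cross_commute[of u e])
  then have "cross (u + e) (u - \<alpha> *\<^sub>R e) \<noteq> 0" using pos assms by simp
  from norm_convex_strict[OF this cd(1,2)]
  have "norm (?c *\<^sub>R (u + e) + ?d *\<^sub>R (u - \<alpha> *\<^sub>R e)) < ?c * norm (u + e) + ?d * norm (u - \<alpha> *\<^sub>R e)" .
  moreover have "?c *\<^sub>R (u + e) + ?d *\<^sub>R (u - \<alpha> *\<^sub>R e) = u"
  proof -
    have "?c *\<^sub>R (u + e) + ?d *\<^sub>R (u - \<alpha> *\<^sub>R e) = (?c + ?d) *\<^sub>R u + (?c - ?d * \<alpha>) *\<^sub>R e"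
      by (simp add: scaleR_add_left scaleR_add_right scaleR_diff_left scaleR_diff_right)
    then show ?thesis using cd by simp
  qed
  ultimately have lt: "norm u < ?c * norm (u + e) + ?d * norm (u - \<alpha> *\<^sub>R e)" by simp
  have "f 0 < ?c * f (-1) + ?d * f \<alpha>"
  proof -
    define h where "h s = (1 + s) * norm e + norm w - l / 2 *
      (cross p e + cross p u + cross (p + e + u) w + (1 + s) * cross e u)" for s
    have add_eq: "c * (h0 - D) + d * (h0 + \<alpha> * D) = (c + d) * h0 + (d * \<alpha> - c) * D" for c d h0 D :: real
      by (simp add: algebra_simps)
    define D where "D = norm e - l / 2 * cross e u"
    have h: "h s = h 0 + s * D" for s by (simp add: h_def D_def algebra_simps)
    have "h (-1) = h 0 - D" "h \<alpha> = h 0 + \<alpha> * D" using h[of "-1"] h[of \<alpha>] by simp_all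
    then have "?c * h (-1) + ?d * h \<alpha> = (?c + ?d) * h 0 + (?d * \<alpha> - ?c) * D"
      by (simp only: add_eq[of ?c _ _ ?d])
    then have "h 0 = ?c * h (-1) + ?d * h \<alpha>" unfolding cd(3) by simp
    moreover have "f s = h s + norm (u - s *\<^sub>R e)" for s by (simp add: f_def h_def)
    ultimately show ?thesis using lt by (simp add: algebra_simps)
  qed
  moreover have "?c * f (-1) + ?d * f \<alpha> \<le> max (f (-1)) (f \<alpha>)"
    using cd by (intro convex_bound_le) auto
  ultimately show thesis by (intro that[OF pos u], unfold f0 f1 f2) linarith
qed

text \<open>Induction from the end of the chain: the tail becomes two edges, and with the edge
  in front of it there are three, two of which are parallel or \<open>chain_three_edges\<close> applies.
  The clause about \<open>n\<close> says, in dual form, that \<open>u\<close> and \<open>w\<close> lie in the convex cone of the edges, so the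
  new chain satisfies all linear constraints that the old edges satisfy. Both new edges
  are nonzero, so that \<open>cross e u = 0\<close> does mean that \<open>e\<close> and \<open>u\<close> are parallel; a straight chain is
  cut into two parallel edges for this purpose.\<close>

lemma convex_chain_two_edges:
  assumes "es \<noteq> []" "sorted_wrt (\<lambda>e f. 0 \<le> cross e f) es" "\<And>e. e \<in> set es \<Longrightarrow> 0 < cross x e"
  shows "\<exists>u w. u + w = sum_list es \<and> 0 \<le> cross u w \<and> 0 < cross x u \<and> 0 < cross x w \<and>
    (\<forall>n. (\<forall>e\<in>set es. 0 \<le> inner n e) \<longrightarrow> 0 \<le> inner n u \<and> 0 \<le> inner n w) \<and>
    (chain_value l p es < chain_value l p [u, w] \<or>
     chain_value l p es = chain_value l p [u, w] \<and>
       (\<forall>e\<in>set es. cross e u = 0 \<or> cross e w = 0))"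
  using assms
proof (induction es arbitrary: p)
  case Nil
  then show ?case by simp
next
  case (Cons e es)
  have xe: "0 < cross x e" using Cons.prems by simp
  show ?case
  proof (cases "es = []")
    case True
    define h where "h = (1 / 2) *\<^sub>R e"
    have e: "e = h + h" by (simp add: h_def flip: scaleR_add_left)
    have "norm (h + h) = 2 * norm h" by (simp add: h_def e[symmetric])
    then have "chain_value l p (e # es) = chain_value l p [h, h]"
      unfolding True by (simp add: e cross_def algebra_simps)
    moreover have "h + h = sum_list (e # es)" using e True by simp
    moreover have "0 < cross x h" "cross e h = 0" using xe by (simp_all add: h_def)
    moreover have "0 \<le> inner n h" if "0 \<le> inner n e" for n using that by (simp add: h_def)
    ultimately show ?thesis using True
      by (intro exI[of _ h] conjI) (simp_all del: chain_value.simps)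
  next
    case False
    from Cons.IH[OF False, of "p + e"] Cons.prems obtain u w where
      sum: "u + w = sum_list es" and uw: "0 \<le> cross u w" and xu: "0 < cross x u" and xw: "0 < cross x w"
      and conic: "\<And>n. (\<forall>e\<in>set es. 0 \<le> inner n e) \<Longrightarrow> 0 \<le> inner n u \<and> 0 \<le> inner n w"
      and val: "chain_value l (p + e) es < chain_value l (p + e) [u, w] \<or>
         chain_value l (p + e) es = chain_value l (p + e) [u, w] \<and> (\<forall>e\<in>set es. cross e u = 0 \<or> cross e w = 0)"
      by auto
    have eu: "0 \<le> cross e u" "0 \<le> cross e w"
      using conic[of "\<i> * e"] Cons.prems by (auto simp flip: cross_eq_inner)
    have le: "chain_value l p (e # es) \<le> chain_value l p [e, u, w]"
      and lt_or: "chain_value l p (e # es) < chain_value l p [e, u, w] \<or>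
        chain_value l p (e # es) = chain_value l p [e, u, w] \<and> (\<forall>e\<in>set es. cross e u = 0 \<or> cross e w = 0)"
      using val by auto
    consider (1) "cross e u = 0" | (2) "cross u w = 0" | (3) "0 < cross e u" "0 < cross u w"
      using eu uw by linarith
    then show ?thesis
    proof cases
      case 1
      obtain k where k: "k > 0" "u = k *\<^sub>R e" using parallel_imp_multiple[OF xe xu 1] .
      have eq: "chain_value l p [e, u, w] = chain_value l p [e + u, w]"
        using chain_value_merge[of k l p e "[w]"] k by simp
      have par: "cross f (e + u) = 0 \<or> cross f w = 0" if "f \<in> set (e # es)" "\<forall>e\<in>set es. cross e u = 0 \<or> cross e w = 0" for f
        using that 1 k by (auto simp: cross_bilinear)
      show ?thesis
      proof (intro exI conjI)
          show "e + u + (w) = sum_list (e # es)" using sum by (simp add: add.assoc)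
          show "0 \<le> cross (e + u) (w)" using eu uw by (simp add: cross_bilinear)
          show "0 < cross x (e + u)" "0 < cross x (w)" using xe xu xw by (simp_all add: cross_bilinear)
          show "\<forall>n. (\<forall>e\<in>set (e # es). 0 \<le> inner n e) \<longrightarrow> 0 \<le> inner n (e + u) \<and> 0 \<le> inner n (w)"
            using conic by (simp add: inner_add_right)
          show "chain_value l p (e # es) < chain_value l p [e + u, w] \<or>
            chain_value l p (e # es) = chain_value l p [e + u, w] \<and>
            (\<forall>f\<in>set (e # es). cross f (e + u) = 0 \<or> cross f (w) = 0)"
            using lt_or unfolding eq using par by blast
      qed
    next
      case 2
      obtain k where k: "k > 0" "w = k *\<^sub>R u" using parallel_imp_multiple[OF xu xw 2] .
      have "chain_value l (p + e) [u, w] = chain_value l (p + e) [u + w]"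
        using chain_value_merge[of k l "p + e" u "[]"] k by simp
      then have eq: "chain_value l p [e, u, w] = chain_value l p [e, u + w]" by simp
      have par: "cross f e = 0 \<or> cross f (u + w) = 0" if "f \<in> set (e # es)" "\<forall>e\<in>set es. cross e u = 0 \<or> cross e w = 0" for f
        using that k by (auto simp: cross_bilinear)
      show ?thesis
      proof (intro exI conjI)
          show "e + (u + w) = sum_list (e # es)" using sum by (simp add: add.assoc)
          show "0 \<le> cross (e) (u + w)" using eu uw by (simp add: cross_bilinear)
          show "0 < cross x (e)" "0 < cross x (u + w)" using xe xu xw by (simp_all add: cross_bilinear)
          show "\<forall>n. (\<forall>e\<in>set (e # es). 0 \<le> inner n e) \<longrightarrow> 0 \<le> inner n (e) \<and> 0 \<le> inner n (u + w)"
            using conic by (simp add: inner_add_right)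
          show "chain_value l p (e # es) < chain_value l p [e, u + w] \<or>
            chain_value l p (e # es) = chain_value l p [e, u + w] \<and>
            (\<forall>f\<in>set (e # es). cross f (e) = 0 \<or> cross f (u + w) = 0)"
            using lt_or unfolding eq using par by blast
      qed
    next
      case 3
      have ew: "0 < cross e w" using cross_trans_strict[of x e u w] 3 xe xu xw by auto
      obtain \<alpha> \<beta> where pos: "0 < \<alpha>" "0 < \<beta>" and u: "u = \<alpha> *\<^sub>R e + \<beta> *\<^sub>R w"
        and "chain_value l p [e, u, w] < chain_value l p [e + u, w] \<or>
          chain_value l p [e, u, w] < chain_value l p [(1 + \<alpha>) *\<^sub>R e, (1 + \<beta>) *\<^sub>R w]"
        using chain_three_edges[OF xe xu xw 3] .
      then consider (a) "chain_value l p [e, u, w] < chain_value l p [e + u, w]"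
        | (b) "chain_value l p [e, u, w] < chain_value l p [(1 + \<alpha>) *\<^sub>R e, (1 + \<beta>) *\<^sub>R w]"
        by blast
      then show ?thesis
      proof cases
        case a
        show ?thesis
      proof (intro exI conjI)
          show "e + u + (w) = sum_list (e # es)" using sum by (simp add: add.assoc)
          show "0 \<le> cross (e + u) (w)" using eu uw by (simp add: cross_bilinear)
          show "0 < cross x (e + u)" "0 < cross x (w)" using xe xu xw by (simp_all add: cross_bilinear)
          show "\<forall>n. (\<forall>e\<in>set (e # es). 0 \<le> inner n e) \<longrightarrow> 0 \<le> inner n (e + u) \<and> 0 \<le> inner n (w)"
            using conic by (simp add: inner_add_right)
          show "chain_value l p (e # es) < chain_value l p [e + u, w] \<or>
            chain_value l p (e # es) = chain_value l p [e + u, w] \<and>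
            (\<forall>f\<in>set (e # es). cross f (e + u) = 0 \<or> cross f (w) = 0)"
            using a le by linarith
      qed
      next
        case b
        have s: "(1 + \<alpha>) *\<^sub>R e + (1 + \<beta>) *\<^sub>R w = e + sum_list es"
          by (simp add: sum[symmetric] u scaleR_add_left)
        have p: "1 + \<alpha> > 0" "1 + \<beta> > 0" using pos by auto
        show ?thesis
        proof (intro exI conjI)
          show "(1 + \<alpha>) *\<^sub>R e + (1 + \<beta>) *\<^sub>R w = sum_list (e # es)" using s by simp
          show "0 \<le> cross ((1 + \<alpha>) *\<^sub>R e) ((1 + \<beta>) *\<^sub>R w)" "0 < cross x ((1 + \<alpha>) *\<^sub>R e)"
            "0 < cross x ((1 + \<beta>) *\<^sub>R w)" using p ew xe xw by simp_all
          show "\<forall>n. (\<forall>e\<in>set (e # es). 0 \<le> inner n e) \<longrightarrow>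
            0 \<le> inner n ((1 + \<alpha>) *\<^sub>R e) \<and> 0 \<le> inner n ((1 + \<beta>) *\<^sub>R w)"
            using conic p by simp
        qed (use b le in linarith)
      qed
    qed
  qed
qed

section \<open>Length\<close>

definition subdivision :: "real \<Rightarrow> real \<Rightarrow> nat \<Rightarrow> (nat \<Rightarrow> real) \<Rightarrow> bool" where
  "subdivision s t n x \<longleftrightarrow> x 0 = s \<and> x n = t \<and> (\<forall>i<n. x i \<le> x (Suc i))"

definition partition_sum :: "(real \<Rightarrow> 'a::metric_space) \<Rightarrow> nat \<Rightarrow> (nat \<Rightarrow> real) \<Rightarrow> real" where
  "partition_sum g n x = (\<Sum>i<n. dist (g (x i)) (g (x (Suc i))))"

lemma curve_length_eq: "curve_length g s t = Sup {partition_sum g n x | n x. subdivision s t n x}"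
  by (simp add: curve_length_def subdivision_def partition_sum_def)

lemma subdivision_mono:
  assumes "subdivision s t n x" "i \<le> j" "j \<le> n"
  shows "x i \<le> x j"
  using assms(2,3)
proof (induction j rule: dec_induct)
  case (step k)
  then have "x k \<le> x (Suc k)" using assms(1) by (simp add: subdivision_def)
  then show ?case using step by simp
qed simp

lemma subdivision_range:
  assumes "subdivision s t n x" "i \<le> n"
  shows "s \<le> x i" "x i \<le> t"
  using subdivision_mono[OF assms(1), of 0 i] subdivision_mono[OF assms(1), of i n] assms
  by (auto simp: subdivision_def)

lemma subdivision_trivial: "s \<le> t \<Longrightarrow> subdivision s t 1 (\<lambda>i. if i = 0 then s else t)"
  by (simp add: subdivision_def)

lemma curve_length_le:
  assumes "s \<le> t" "\<And>n x. subdivision s t n x \<Longrightarrow> partition_sum g n x \<le> M"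
  shows "curve_length g s t \<le> M"
  unfolding curve_length_eq
proof (rule cSup_least)
  show "{partition_sum g n x |n x. subdivision s t n x} \<noteq> {}"
    using subdivision_trivial[OF assms(1)] by blast
qed (use assms(2) in blast)

lemma curve_length_cong:
  assumes "\<And>u. s \<le> u \<Longrightarrow> u \<le> t \<Longrightarrow> g u = h u"
  shows "curve_length g s t = curve_length h s t"
proof -
  have "partition_sum g n x = partition_sum h n x" if "subdivision s t n x" for n x
    unfolding partition_sum_def
  proof (rule sum.cong)
    fix i assume "i \<in> {..<n}"
    then show "dist (g (x i)) (g (x (Suc i))) = dist (h (x i)) (h (x (Suc i)))"
      using subdivision_range[OF that, of i] subdivision_range[OF that, of "Suc i"] assms by simp
  qed simp
  then have "{partition_sum g n x | n x. subdivision s t n x} = {partition_sum h n x | n x. subdivision s t n x}"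
    by (metis (no_types, lifting))
  then show ?thesis by (simp add: curve_length_eq)
qed

lemma curve_length_periodic:
  assumes "\<And>u. g (u + c) = g u"
  shows "curve_length g (s + c) (t + c) = curve_length g s t"
proof -
  have "partition_sum g n x \<in> {partition_sum g n x | n x. subdivision s t n x}"
    if "subdivision (s + c) (t + c) n x" for n x
  proof -
    have "subdivision s t n (\<lambda>i. x i - c)" using that by (auto simp: subdivision_def)
    moreover have "partition_sum g n (\<lambda>i. x i - c) = partition_sum g n x"
      using assms[of "_ - c"] by (simp add: partition_sum_def)
    ultimately show ?thesis by (metis (mono_tags, lifting) mem_Collect_eq)
  qed
  moreover have "partition_sum g n x \<in> {partition_sum g n x | n x. subdivision (s + c) (t + c) n x}"
    if "subdivision s t n x" for n x
  proof -
    have "subdivision (s + c) (t + c) n (\<lambda>i. x i + c)" using that by (auto simp: subdivision_def)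
    moreover have "partition_sum g n (\<lambda>i. x i + c) = partition_sum g n x"
      using assms by (simp add: partition_sum_def)
    ultimately show ?thesis by (metis (mono_tags, lifting) mem_Collect_eq)
  qed
  ultimately have "{partition_sum g n x | n x. subdivision (s + c) (t + c) n x} =
      {partition_sum g n x | n x. subdivision s t n x}" by blast
  then show ?thesis by (simp add: curve_length_eq)
qed

locale lipschitz_curve =
  fixes g :: "real \<Rightarrow> 'a::metric_space" and C :: real
  assumes lipschitz: "dist (g u) (g v) \<le> C * \<bar>u - v\<bar>"
begin

lemma partition_sum_le:
  assumes "subdivision s t n x"
  shows "partition_sum g n x \<le> C * (t - s)"
proof -
  have "partition_sum g n x \<le> (\<Sum>i<n. C * (x (Suc i) - x i))"
    unfolding partition_sum_def
  proof (rule sum_mono)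
    fix i assume "i \<in> {..<n}"
    then have "x i \<le> x (Suc i)" using assms by (simp add: subdivision_def)
    then show "dist (g (x i)) (g (x (Suc i))) \<le> C * (x (Suc i) - x i)"
      using lipschitz[of "x i" "x (Suc i)"] by simp
  qed
  also have "\<dots> = C * (x n - x 0)"
    by (simp add: sum_lessThan_telescope flip: sum_distrib_left)
  finally show ?thesis using assms by (simp add: subdivision_def)
qed

lemma partition_sum_le_curve_length:
  assumes "subdivision s t n x"
  shows "partition_sum g n x \<le> curve_length g s t"
  unfolding curve_length_eq
proof (rule cSup_upper)
  show "bdd_above {partition_sum g n x |n x. subdivision s t n x}"
    by (rule bdd_aboveI[of _ "C * (t - s)"]) (use partition_sum_le in blast)
qed (use assms in blast)

lemma curve_length_add:
  assumes "s \<le> u" "u \<le> t"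
  shows "curve_length g s t = curve_length g s u + curve_length g u t"
proof (rule antisym)
  show "curve_length g s t \<le> curve_length g s u + curve_length g u t"
  proof (rule curve_length_le)
    fix n x assume p: "subdivision s t n x"
    \<comment> \<open>Clamping the given subdivision at \<open>u\<close> from both sides avoids locating \<open>u\<close> in it.\<close>
    define y z where "y = (\<lambda>i. min (x i) u)" and "z = (\<lambda>i. max (x i) u)"
    have py: "subdivision s u n y" and pz: "subdivision u t n z"
      using p assms by (auto simp: subdivision_def y_def z_def min_le_iff_disj le_max_iff_disj)
    have "partition_sum g n x \<le> (\<Sum>i<n. dist (g (y i)) (g (y (Suc i))) + dist (g (z i)) (g (z (Suc i))))"
      unfolding partition_sum_def
    proof (rule sum_mono)
      fix i assume "i \<in> {..<n}"
      then have "x i \<le> x (Suc i)" using p by (simp add: subdivision_def)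
      then consider "x (Suc i) \<le> u" "x i \<le> u" | "u \<le> x i" "u \<le> x (Suc i)" | "x i \<le> u" "u \<le> x (Suc i)" by linarith
      then show "dist (g (x i)) (g (x (Suc i))) \<le>
          dist (g (y i)) (g (y (Suc i))) + dist (g (z i)) (g (z (Suc i)))"
      proof cases
        case 3
        then show ?thesis using dist_triangle[of "g (x i)" "g (x (Suc i))" "g u"]
          by (simp add: y_def z_def)
      qed (auto simp: y_def z_def)
    qed
    also have "\<dots> = partition_sum g n y + partition_sum g n z"
      by (simp add: partition_sum_def sum.distrib)
    also have "\<dots> \<le> curve_length g s u + curve_length g u t"
      using partition_sum_le_curve_length[OF py] partition_sum_le_curve_length[OF pz] by simp
    finally show "partition_sum g n x \<le> curve_length g s u + curve_length g u t" .
  qed (use assms in simp)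
next
  have concat: "partition_sum g n x + partition_sum g m y \<le> curve_length g s t"
    if x: "subdivision s u n x" and y: "subdivision u t m y" for n x m y
  proof -
    define z where "z i = (if i \<le> n then x i else y (i - n))" for i
    have zx: "i \<le> n \<Longrightarrow> z i = x i" for i by (simp add: z_def)
    have zy: "z (n + i) = y i" for i using x y by (auto simp: z_def subdivision_def)
    have "subdivision s t (n + m) z"
      unfolding subdivision_def
    proof (intro conjI allI impI)
      show "z 0 = s" "z (n + m) = t" using zx[of 0] zy[of m] x y by (auto simp: subdivision_def)
      fix i assume i: "i < n + m"
      show "z i \<le> z (Suc i)"
      proof (cases "i < n")
        case True
        then show ?thesis using x zx[of i] zx[of "Suc i"] by (simp add: subdivision_def)
      next
        case False
        then obtain j where "i = n + j" "j < m" using i by (metis add_less_cancel_left le_Suc_ex linorder_not_less)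
        then show ?thesis using y zy[of j] zy[of "Suc j"] by (simp add: subdivision_def)
      qed
    qed
    then have "partition_sum g (n + m) z \<le> curve_length g s t" by (rule partition_sum_le_curve_length)
    moreover have "partition_sum g (n + m) z = partition_sum g n x + partition_sum g m y"
    proof -
      have "(\<Sum>i<n+m. h i) = (\<Sum>i<n. h i) + (\<Sum>i<m. h (n + i))" for h :: "nat \<Rightarrow> real"
        by (induction m) auto
      then show ?thesis by (simp add: partition_sum_def zx zy zy[of "Suc _", simplified])
    qed
    ultimately show ?thesis by simp
  qed
  have "curve_length g u t \<le> curve_length g s t - partition_sum g n x" if "subdivision s u n x" for n x
    using concat[OF that] assms by (intro curve_length_le) (auto simp: algebra_simps)
  then have "curve_length g s u \<le> curve_length g s t - curve_length g u t"
    using assms by (intro curve_length_le) (auto simp: algebra_simps)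
  then show "curve_length g s u + curve_length g u t \<le> curve_length g s t" by simp
qed

lemma curve_length_period:
  assumes "\<And>u. g (u + c) = g u" "0 \<le> s" "s \<le> c"
  shows "curve_length g s (s + c) = curve_length g 0 c"
proof -
  have "curve_length g s (s + c) = curve_length g s c + curve_length g c (s + c)"
    using assms by (intro curve_length_add) auto
  also have "curve_length g c (s + c) = curve_length g 0 s"
    using curve_length_periodic[of g c 0 s] assms(1) by simp
  also have "curve_length g s c + \<dots> = curve_length g 0 c"
    using curve_length_add[of 0 s c] assms by simp
  finally show ?thesis .
qed

end

lemma curve_length_segment:
  fixes p v :: "'a::real_normed_vector"
  assumes "s \<le> t" "\<And>u. s \<le> u \<Longrightarrow> u \<le> t \<Longrightarrow> g u = p + \<phi> u *\<^sub>R v"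
    and mono: "\<And>u w. s \<le> u \<Longrightarrow> u \<le> w \<Longrightarrow> w \<le> t \<Longrightarrow> \<phi> u \<le> \<phi> w"
  shows "curve_length g s t = (\<phi> t - \<phi> s) * norm v"
proof -
  have "partition_sum g n x = (\<phi> t - \<phi> s) * norm v" if p: "subdivision s t n x" for n x
  proof -
    have "partition_sum g n x = (\<Sum>i<n. (\<phi> (x (Suc i)) - \<phi> (x i)) * norm v)"
      unfolding partition_sum_def
    proof (rule sum.cong)
      fix i assume i: "i \<in> {..<n}"
      have r: "s \<le> x i" "x i \<le> x (Suc i)" "x (Suc i) \<le> t"
        using subdivision_range[OF p] i p by (auto simp: subdivision_def)
      then have "g (x i) - g (x (Suc i)) = (\<phi> (x i) - \<phi> (x (Suc i))) *\<^sub>R v"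
        using assms(2) by (simp add: scaleR_diff_left)
      then show "dist (g (x i)) (g (x (Suc i))) = (\<phi> (x (Suc i)) - \<phi> (x i)) * norm v"
        using mono[OF r] by (simp add: dist_norm)
    qed simp
    also have "\<dots> = (\<phi> (x n) - \<phi> (x 0)) * norm v"
      by (simp only: sum_lessThan_telescope[of "\<lambda>i. \<phi> (x i)"] flip: sum_distrib_right)
    finally show ?thesis using p by (simp add: subdivision_def)
  qed
  moreover from this obtain n x where "subdivision s t n x" using subdivision_trivial[OF assms(1)] by blast
  ultimately have "{partition_sum g n x | n x. subdivision s t n x} = {(\<phi> t - \<phi> s) * norm v}"
    by force
  then show ?thesis by (simp add: curve_length_eq)
qed

section \<open>Area\<close>

text \<open>The known area formula for triangles is about \<open>real^2\<close>; this transports it to the complex plane.\<close>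

lemma lborel_complex: "(lborel :: complex measure) = distr (lborel :: (real^2) measure) borel (\<lambda>v. Complex (v $ 1) (v $ 2))"
proof (rule lborel_eqI)
  let ?f = "\<lambda>v::real^2. Complex (v $ 1) (v $ 2)"
  have cont: "continuous_on UNIV ?f"
    unfolding Complex_eq by (intro continuous_intros)
  then have [measurable]: "?f \<in> borel_measurable borel" by (rule borel_measurable_continuous_onI)
  fix l u :: complex assume le: "\<And>b. b \<in> Basis \<Longrightarrow> inner l b \<le> inner u b"
  define l' u' :: "real^2" where "l' = vector [Re l, Im l]" and "u' = vector [Re u, Im u]"
  have U: "(UNIV :: 2 set) = {1, 2}" using exhaust_2 by auto
  have B: "(Basis :: (real^2) set) = {axis 1 1, axis 2 1}"
    by (auto simp: Basis_vec_def U)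
  have ne: "axis 1 1 \<noteq> (axis 2 1 :: real^2)" by (simp add: axis_eq_axis)
  have "?f -` box l u = box l' u'"
    by (auto simp: mem_box_cart forall_2 l'_def u'_def in_box_complex_iff)
  then have "emeasure (distr lborel borel ?f) (box l u) = emeasure lborel (box l' u')"
    by (simp add: emeasure_distr)
  also have "\<dots> = (\<Prod>b\<in>Basis. inner (u' - l') b)"
    using le[of 1] le[of \<i>] by (intro emeasure_lborel_box) (auto simp: B inner_axis l'_def u'_def)
  also have "\<dots> = (\<Prod>b\<in>Basis. inner (u - l) b)"
    using ne by (simp add: B inner_axis l'_def u'_def Basis_complex_def)
  finally show "emeasure (distr lborel borel ?f) (box l u) = (\<Prod>b\<in>Basis. inner (u - l) b)" .
qed simp

lemma area_triangle: "measure lebesgue (convex hull {0, y, z}) = \<bar>cross y z\<bar> / 2"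
proof -
  let ?f = "\<lambda>v::real^2. Complex (v $ 1) (v $ 2)"
  have lin: "linear ?f"
    by (rule linearI) (auto simp: complex_eq_iff)
  have cont: "continuous_on UNIV ?f"
    unfolding Complex_eq by (intro continuous_intros)
  then have [measurable]: "?f \<in> borel_measurable borel" by (rule borel_measurable_continuous_onI)
  define y' z' :: "real^2" where "y' = vector [Re y, Im y]" and "z' = vector [Re z, Im z]"
  have "?f 0 = 0" "?f y' = y" "?f z' = z" by (simp_all add: y'_def z'_def complex_eq_iff)
  then have im: "?f ` {0, y', z'} = {0, y, z}" by simp
  have inj: "inj ?f" by (rule injI) (auto simp: vec_eq_iff forall_2)
  have "compact (convex hull {0, y, z})" by (intro finite_imp_compact_convex_hull) auto
  then have b: "convex hull {0, y, z} \<in> sets borel" by (simp add: borel_compact)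
  have "measure lebesgue (convex hull {0, y, z}) = measure lborel (convex hull {0, y, z})"
    using b by (simp add: measure_completion)
  also have "\<dots> = measure lborel (?f -` (convex hull {0, y, z}))"
    using b by (subst lborel_complex) (simp add: measure_distr)
  also have "?f -` (convex hull {0, y, z}) = convex hull {0, y', z'}"
    unfolding im[symmetric] convex_hull_linear_image[OF lin, symmetric]
    by (rule inj_vimage_image_eq[OF inj])
  also have "measure lborel \<dots> = \<bar>cross y z\<bar> / 2"
    by (simp add: content_triangle y'_def z'_def cross_def abs_minus_commute mult.commute)
  finally show ?thesis .
qed

section \<open>The boundary curve of a convex body\<close>

lemma cross_cis: "cross (cis u) (cis v) = sin (v - u)"
  by (simp add: cross_def sin_diff)

lemma cross_chord: "cross (p + c *\<^sub>R (q - p)) (p + d *\<^sub>R (q - p)) = (d - c) * cross p q"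
  by (simp add: cross_def algebra_simps)

lemma norm_cis_diff_le: "norm (cis u - cis v) \<le> \<bar>u - v\<bar>"
proof -
  have "cis u - cis v = cis v * (exp (\<i> * of_real (u - v)) - 1)"
    by (simp add: cis_conv_exp algebra_simps flip: exp_add)
  then have "norm (cis u - cis v) = 2 * \<bar>sin ((u - v) / 2)\<bar>"
    by (simp only: norm_mult norm_cis dist_exp_i_1 mult_1)
  also have "\<dots> \<le> 2 * \<bar>(u - v) / 2\<bar>"
    using abs_sin_x_le_abs_x[of "(u - v) / 2"] by linarith
  finally show ?thesis by simp
qed

lemma cis_eq_cisD:
  assumes "cis u = cis v" "u \<le> v" "v \<le> u + 2 * pi"
  shows "v = u \<or> v = u + 2 * pi"
proof (rule ccontr)
  assume *: "\<not> ?thesis"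
  have "cis (v - u) = 1" using assms(1) by (simp flip: cis_divide)
  then have "cos (v - u) = 1" by (simp add: complex_eq_iff)
  then obtain n :: int where "v - u = of_int n * 2 * pi" by (auto simp: cos_one_2pi_int)
  moreover have "0 < v - u" "v - u < 2 * pi" using assms * by auto
  ultimately have "0 < of_int n * pi" "of_int n * (2 * pi) < 1 * (2 * pi)" by (auto simp: mult_ac)
  then have "0 < (of_int n :: real)" "(of_int n :: real) < 1"
    by (auto simp: zero_less_mult_iff)
  then show False by simp
qed

text \<open>A point of the cone between the directions \<open>s\<close> and \<open>t\<close> has its angle in \<open>{s..t}\<close>. The angle \<open>s\<close> itself
  occurs at both ends of the period, hence the second alternative.\<close>

lemma angle_in_cone:
  assumes "s < t" "t < s + pi" "s \<le> u" "u \<le> s + 2 * pi" "0 \<le> sin (u - s)" "0 \<le> sin (t - u)"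
  shows "u \<le> t \<or> u = s + 2 * pi"
proof (rule ccontr)
  assume *: "\<not> ?thesis"
  have "u - s \<le> pi"
  proof (rule ccontr)
    assume "\<not> u - s \<le> pi"
    then have "sin (u - s) < 0" using * assms by (intro sin_lt_zero) auto
    then show False using assms by simp
  qed
  then have "0 < sin (u - t)" using * assms by (intro sin_gt_zero) auto
  then show False using assms(6) by (metis minus_diff_eq neg_0_le_iff_le not_le sin_minus)
qed

text \<open>The region swept by the segment from \<open>0\<close> to the curve. It is defined from the curve and not as the
  intersection of a body with a cone, so that bodies whose boundary curves agree on an interval visibly
  have the same sector there.\<close>

definition sector :: "(real \<Rightarrow> complex) \<Rightarrow> real \<Rightarrow> real \<Rightarrow> complex set" where
  "sector g s t = (\<lambda>(r, u). r *\<^sub>R g u) ` ({0..1} \<times> {s..t})"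

lemma sector_iff: "z \<in> sector g s t \<longleftrightarrow> (\<exists>r u. 0 \<le> r \<and> r \<le> 1 \<and> s \<le> u \<and> u \<le> t \<and> z = r *\<^sub>R g u)"
  by (force simp: sector_def)

text \<open>The contribution of an arc to \<open>- J l\<close>. For a polygonal arc it is the value of the chain.\<close>

definition arc_value :: "real \<Rightarrow> (real \<Rightarrow> complex) \<Rightarrow> real \<Rightarrow> real \<Rightarrow> real" where
  "arc_value l g s t = curve_length g s t - l * measure lebesgue (sector g s t)"

lemma sector_cong:
  assumes "\<And>u. s \<le> u \<Longrightarrow> u \<le> t \<Longrightarrow> g u = h u"
  shows "sector g s t = sector h s t"
  using assms by (fastforce simp: sector_iff)

lemma arc_value_cong:
  assumes "\<And>u. s \<le> u \<Longrightarrow> u \<le> t \<Longrightarrow> g u = h u"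
  shows "arc_value l g s t = arc_value l h s t"
  unfolding arc_value_def using curve_length_cong[of s t g h] sector_cong[of s t g h] assms by metis

lemma sum_list_telescope:
  fixes f :: "nat \<Rightarrow> 'a::ab_group_add"
  shows "sum_list (map (\<lambda>i. f (Suc i) - f i) [0..<n]) = f n - f 0"
  by (induction n) auto

lemma chain_value_inscribed:
  "chain_value l (p 0) (map (\<lambda>i. p (Suc i) - p i) [0..<n]) =
    (\<Sum>i<n. dist (p i) (p (Suc i)) - l / 2 * cross (p i) (p (Suc i)))"
  by (induction n) (auto simp: chain_value_append sum_list_telescope cross_diff_right dist_norm norm_minus_commute)

text \<open>The bodies are star-shaped about \<open>0\<close>, and everything is expressed by the curve \<open>boundary_point K\<close>,
  called \<open>g\<close> here; the angle \<open>u\<close> is its parameter.\<close>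

locale ring_body =
  fixes a b :: real and K :: "complex set"
  assumes a_pos: "0 < a" and body: "K \<in> convex_ring_class a b"
begin

abbreviation g where "g \<equiv> boundary_point K"
abbreviation \<rho> where "\<rho> \<equiv> radial K"

lemma compact_body: "compact K" and convex_body: "convex K"
  and inner_disc: "cball 0 a \<subseteq> K" and outer_disc: "K \<subseteq> cball 0 b"
  using body by (auto simp: convex_ring_class_def)

lemma zero_in_body: "0 \<in> K"
  using inner_disc a_pos by auto

lemma g_eq: "g u = \<rho> u *\<^sub>R cis u"
  by (simp add: boundary_point_def scaleR_conv_of_real)

lemma radial_pos: "0 < \<rho> u"
  and g_frontier: "g u \<in> frontier K"
  and le_radial: "r *\<^sub>R cis u \<in> K \<Longrightarrow> r \<le> \<rho> u"
  using boundary_point_in_frontier[OF a_pos compact_body inner_disc]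
  by (auto simp: scaleR_conv_of_real)

lemma frontier_subset_body: "frontier K \<subseteq> K"
  by (simp add: compact_body compact_imp_closed frontier_subset_eq)

lemma g_in_body: "g u \<in> K"
  using g_frontier frontier_subset_body by blast

lemma scaled_in_body: "z \<in> K \<Longrightarrow> 0 \<le> r \<Longrightarrow> r \<le> 1 \<Longrightarrow> r *\<^sub>R z \<in> K"
  using convexD_alt[OF convex_body zero_in_body, of z r] by simp

lemma norm_g: "norm (g u) = \<rho> u"
  using radial_pos[of u] by (simp add: g_eq)

lemma radial_ge: "a \<le> \<rho> u"
proof -
  have "a *\<^sub>R cis u \<in> cball 0 a" using a_pos by simp
  then show ?thesis using inner_disc le_radial by blast
qed

lemma radial_le: "\<rho> u \<le> b"
  using g_in_body[of u] outer_disc norm_g[of u] by (metis mem_cball_0 subsetD)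

lemma g_periodic: "g (u + 2 * pi) = g u"
  by (simp add: boundary_point_def radial_def flip: cis_mult)

lemma g_cong: "cis u = cis v \<Longrightarrow> g u = g v"
  by (simp add: boundary_point_def radial_def)

lemma frontier_eq: "frontier K = g ` {0..2*pi}"
  by (rule frontier_eq_boundary_points[OF a_pos compact_body convex_body inner_disc])

lemma frontier_point_unique:
  assumes "r *\<^sub>R cis u \<in> frontier K" "0 \<le> r"
  shows "g u = r *\<^sub>R cis u"
proof -
  obtain v where v: "r *\<^sub>R cis u = g v" using assms frontier_eq by auto
  then have "norm (r *\<^sub>R cis u) = norm (g v)" by (rule arg_cong)
  then have "r = \<rho> v" using assms(2) by (simp add: norm_g)
  then have "cis u = cis v" using v radial_pos[of v] by (simp add: g_eq)
  then show ?thesis using v g_cong by metis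
qed

lemma cross_g: "cross (g u) (g v) = \<rho> u * \<rho> v * sin (v - u)"
  by (simp add: g_eq cross_cis)

lemma cross_g_sign:
  "0 \<le> cross (g u) (g v) \<longleftrightarrow> 0 \<le> sin (v - u)" "0 < cross (g u) (g v) \<longleftrightarrow> 0 < sin (v - u)"
  using mult_pos_pos[OF radial_pos[of u] radial_pos[of v]]
  unfolding cross_g by (simp_all add: zero_le_mult_iff[of "_ * _" "sin _"] zero_less_mult_iff[of "_ * _" "sin _"])

lemma cross_g_pos: "u < v \<Longrightarrow> v < u + pi \<Longrightarrow> 0 < cross (g u) (g v)"
  unfolding cross_g_sign by (rule sin_gt_zero) auto

lemma supporting_frontier:
  assumes "z \<in> K" "n \<noteq> 0" "\<And>y. y \<in> K \<Longrightarrow> inner n y \<le> inner n z"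
  shows "z \<in> frontier K"
proof -
  have "z \<notin> interior K"
  proof
    assume "z \<in> interior K"
    then obtain e where e: "e > 0" "cball z e \<subseteq> K" by (meson mem_interior_cball)
    let ?y = "z + (e / norm n) *\<^sub>R n"
    have "?y \<in> cball z e" using e(1) assms(2) by (simp add: dist_norm)
    then have "inner n ?y \<le> inner n z" using e(2) assms(3) by blast
    moreover have "0 < e / norm n * inner n n" using e(1) assms(2) by simp
    ultimately show False by (simp add: inner_add_right)
  qed
  then show ?thesis using assms(1) closure_subset by (auto simp: frontier_def)
qed

lemma support_normal:
  assumes "z \<in> frontier K"
  obtains n where "norm n = 1" "\<And>y. y \<in> K \<Longrightarrow> inner n y \<le> inner n z" "a \<le> inner n z"
proof -
  have int: "interior K \<noteq> {}"
  proof -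
    have "ball 0 a \<subseteq> interior K" using inner_disc by (intro interior_maximal) auto
    then show ?thesis using a_pos by auto
  qed
  then have "z \<notin> rel_interior K"
    using assms by (simp add: rel_interior_nonempty_interior frontier_def)
  moreover have "z \<in> K" using assms frontier_subset_body by blast
  ultimately obtain m where m: "m \<noteq> 0" "\<And>y. y \<in> K \<Longrightarrow> inner m z \<le> inner m y"
    using supporting_hyperplane_rel_boundary[OF convex_body] by metis
  define n where "n = (-1 / norm m) *\<^sub>R m"
  have n1: "norm n = 1" using m by (simp add: n_def)
  have le: "inner n y \<le> inner n z" if "y \<in> K" for y
    using m(2)[OF that] m(1) by (simp add: n_def divide_right_mono)
  have "a *\<^sub>R n \<in> K" using inner_disc n1 a_pos by auto
  from le[OF this] have "a \<le> inner n z" using n1 by (simp add: dot_square_norm)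
  with n1 le that show thesis by blast
qed

text \<open>The reciprocal of the radius is the gauge of \<open>K\<close>, which is \<open>1 / a\<close>-Lipschitz because \<open>K\<close> contains the
  disc of radius \<open>a\<close>.\<close>

sublocale lipschitz_curve g "b * b / a + b"
proof
  fix u v
  have radial_inverse: "1 / \<rho> u - 1 / \<rho> v \<le> norm (cis u - cis v) / a" for u v
  proof (cases "cis u = cis v")
    case True
    then show ?thesis by (simp add: radial_def)
  next
    case False
    let ?d = "norm (cis u - cis v)"
    let ?c = "1 / \<rho> v + ?d / a"
    have d: "?d > 0" using False by simp
    have c: "?c > 0" using d radial_pos[of v] a_pos by (simp add: add_pos_pos)
    define w where "w = (a / ?d) *\<^sub>R (cis u - cis v)"
    have "w \<in> K" using inner_disc a_pos d by (auto simp: w_def)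
    moreover have "(1 / \<rho> v) / ?c + (?d / a) / ?c = 1" using c by (simp only: add_divide_distrib[symmetric]) simp
    ultimately have "((1 / \<rho> v) / ?c) *\<^sub>R g v + ((?d / a) / ?c) *\<^sub>R w \<in> K"
      using c radial_pos[of v] a_pos by (intro convexD[OF convex_body g_in_body]) auto
    moreover have "((1 / \<rho> v) / ?c) *\<^sub>R g v = (1 / ?c) *\<^sub>R cis v"
      using radial_pos[of v] by (simp add: g_eq)
    moreover have "((?d / a) / ?c) *\<^sub>R w = (1 / ?c) *\<^sub>R (cis u - cis v)"
      using d a_pos by (simp add: w_def)
    ultimately have "(1 / ?c) *\<^sub>R cis u \<in> K" by (simp add: scaleR_diff_right)
    then have "1 / ?c \<le> \<rho> u" by (rule le_radial)
    then have "1 / \<rho> u \<le> ?c" using c radial_pos[of u] by (simp add: field_simps)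
    then show ?thesis by simp
  qed
  have "\<bar>1 / \<rho> u - 1 / \<rho> v\<bar> \<le> norm (cis u - cis v) / a"
    using radial_inverse[of u v] radial_inverse[of v u] by (simp add: norm_minus_commute)
  also have "\<dots> \<le> \<bar>u - v\<bar> / a"
    using norm_cis_diff_le a_pos by (simp add: divide_right_mono)
  finally have *: "\<bar>1 / \<rho> u - 1 / \<rho> v\<bar> \<le> \<bar>u - v\<bar> / a" .
  have "\<rho> u - \<rho> v = (\<rho> u * \<rho> v) * (1 / \<rho> v - 1 / \<rho> u)"
    using radial_pos[of u] radial_pos[of v] by (simp add: field_simps)
  then have "\<bar>\<rho> u - \<rho> v\<bar> = (\<rho> u * \<rho> v) * \<bar>1 / \<rho> u - 1 / \<rho> v\<bar>"
    using radial_pos[of u] radial_pos[of v] by (simp add: abs_mult abs_minus_commute)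
  also have "\<dots> \<le> (b * b) * (\<bar>u - v\<bar> / a)"
    using * radial_pos[of u] radial_pos[of v] radial_le[of u] radial_le[of v]
    by (intro mult_mono mult_nonneg_nonneg) auto
  finally have r: "\<bar>\<rho> u - \<rho> v\<bar> \<le> b * b / a * \<bar>u - v\<bar>" by simp
  have "g u - g v = (\<rho> u - \<rho> v) *\<^sub>R cis u + \<rho> v *\<^sub>R (cis u - cis v)"
    by (simp add: g_eq algebra_simps)
  then have "dist (g u) (g v) \<le> \<bar>\<rho> u - \<rho> v\<bar> + \<rho> v * norm (cis u - cis v)"
    using norm_triangle_ineq[of "(\<rho> u - \<rho> v) *\<^sub>R cis u" "\<rho> v *\<^sub>R (cis u - cis v)"] radial_pos[of v]
    by (simp add: dist_norm)
  also have "\<dots> \<le> b * b / a * \<bar>u - v\<bar> + b * \<bar>u - v\<bar>"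
    using r norm_cis_diff_le[of u v] radial_pos[of v] radial_le[of v]
    by (intro add_mono mult_mono) auto
  finally show "dist (g u) (g v) \<le> (b * b / a + b) * \<bar>u - v\<bar>" by (simp add: algebra_simps)
qed

lemma continuous_g: "continuous_on S g"
proof -
  have "b > 0" using radial_pos[of 0] radial_le[of 0] by linarith
  then have "0 \<le> b * b / a + b" using a_pos by simp
  then have "(b * b / a + b)-lipschitz_on S g"
    using lipschitz by (intro lipschitz_onI) (auto simp: dist_real_def)
  then show ?thesis by (rule lipschitz_on_continuous_on)
qed

lemma compact_sector: "compact (sector g s t)"
  unfolding sector_def
  by (intro compact_continuous_image compact_Times compact_Icc)
    (auto simp: case_prod_unfold intro!: continuous_intros continuous_on_compose2[OF continuous_g])

lemma body_eq_sector: "K = sector g s (s + 2 * pi)"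
proof (intro equalityI subsetI)
  fix z assume z: "z \<in> K"
  obtain u where u: "s \<le> u" "u \<le> s + 2 * pi" "z = norm z *\<^sub>R cis u"
  proof -
    define m where "m = \<lfloor>(Arg z - s) / (2 * pi)\<rfloor>"
    define u where "u = Arg z - 2 * pi * of_int m"
    have "of_int m \<le> (Arg z - s) / (2 * pi)" "(Arg z - s) / (2 * pi) < of_int m + 1"
      by (simp_all add: m_def)
    then have "s \<le> u" "u \<le> s + 2 * pi"
      using pi_gt_zero by (auto simp: u_def field_simps)
    moreover have "cis u = cis (Arg z)"
      using cis_multiple_2pi[of "- of_int m"] by (simp add: u_def cis_mult[symmetric] diff_conv_add_uminus del: add_uminus_conv_diff)
    then have "z = norm z *\<^sub>R cis u"
      using rcis_cmod_Arg[of z] by (simp add: rcis_def scaleR_conv_of_real)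
    ultimately show thesis using that by blast
  qed
  have "norm z \<le> \<rho> u" using z u(3) le_radial by metis
  then show "z \<in> sector g s (s + 2 * pi)"
    unfolding sector_iff using u radial_pos[of u]
    by (intro exI[of _ "norm z / \<rho> u"] exI[of _ u]) (auto simp: g_eq)
next
  fix z assume "z \<in> sector g s (s + 2 * pi)"
  then show "z \<in> K" using scaled_in_body[OF g_in_body] by (auto simp: sector_iff)
qed

text \<open>Over at most one turn, two adjacent sectors overlap in at most two rays, which are null sets.\<close>

lemma area_sector_add:
  assumes "s \<le> u" "u \<le> t" "t \<le> s + 2 * pi"
  shows "measure lebesgue (sector g s t) = measure lebesgue (sector g s u) + measure lebesgue (sector g u t)"
proof -
  have neg: "negligible (closed_segment 0 z)" for z :: complex
  proof -
    have "closed_segment 0 z = convex hull {0, 0, z}" by (simp add: segment_convex_hull)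
    moreover have "compact (convex hull {0, 0, z})" by (intro finite_imp_compact_convex_hull) auto
    ultimately show ?thesis
      using area_triangle[of 0 z] by (simp add: negligible_iff_measure lmeasurable_compact)
  qed
  have "sector g s u \<inter> sector g u t \<subseteq> closed_segment 0 (g u) \<union> closed_segment 0 (g s)"
  proof
    fix z assume "z \<in> sector g s u \<inter> sector g u t"
    then obtain r v r' w where v: "0 \<le> r" "r \<le> 1" "s \<le> v" "v \<le> u" "z = r *\<^sub>R g v"
      and w: "0 \<le> r'" "r' \<le> 1" "u \<le> w" "w \<le> t" "z = r' *\<^sub>R g w"
      by (auto simp: sector_iff)
    show "z \<in> closed_segment 0 (g u) \<union> closed_segment 0 (g s)"
    proof (cases "z = 0")
      case False
      then have "r \<noteq> 0" "r' \<noteq> 0" using v(5) w(5) by auto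
      then have pos: "r * \<rho> v > 0" "r' * \<rho> w > 0"
        using v(1) w(1) radial_pos[of v] radial_pos[of w] by auto
      have eq: "(r * \<rho> v) *\<^sub>R cis v = (r' * \<rho> w) *\<^sub>R cis w"
        using v(5) w(5) by (simp add: g_eq)
      from arg_cong[OF eq, of norm] have "r * \<rho> v = r' * \<rho> w"
        by (simp only: norm_scaleR norm_cis abs_of_pos[OF pos(1)] abs_of_pos[OF pos(2)] mult_1_right)
      with eq pos have "cis v = cis w" by (metis less_irrefl scaleR_left_imp_eq)
      then have "w = v \<or> w = v + 2 * pi" using v w assms by (intro cis_eq_cisD) auto
      then have "v = u \<or> v = s" using v w assms by auto
      then show ?thesis using v(1,2,5) by (auto simp: in_segment)
    qed auto
  qed
  then have "negligible (sector g s u \<inter> sector g u t)"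
    using negligible_subset neg by (meson negligible_Un)
  then have 0: "measure lebesgue (sector g s u \<inter> sector g u t) = 0"
    by (rule negligible_imp_measure0)
  have "{s..t} = {s..u} \<union> {u..t}" using assms by auto
  then have "sector g s t = sector g s u \<union> sector g u t"
    by (simp add: sector_def Sigma_Un_distrib2 image_Un)
  then show ?thesis
    using 0 lmeasurable_compact[OF compact_sector] by (simp add: measure_Un3)
qed

lemma arc_value_add:
  assumes "s \<le> u" "u \<le> t" "t \<le> s + 2 * pi"
  shows "arc_value l g s t = arc_value l g s u + arc_value l g u t"
  using assms by (simp add: arc_value_def area_sector_add[of s u t] curve_length_add[of s u t] algebra_simps)

text \<open>The starting angle is arbitrary, so that any short arc can be separated from the rest of the
  boundary without crossing the ends of the parameter interval.\<close>

lemma J_eq_arc_value: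
  assumes "- 2 * pi \<le> s" "s \<le> 2 * pi"
  shows "J l K = - arc_value l g s (s + 2 * pi)"
proof -
  have "curve_length g s (s + 2 * pi) = perimeter K"
  proof (cases "s \<ge> 0")
    case True
    then show ?thesis unfolding perimeter_def
      using assms g_periodic by (intro curve_length_period) auto
  next
    case False
    have "curve_length g 0 (2 * pi) = curve_length g 0 (s + 2 * pi) + curve_length g (s + 2 * pi) (0 + 2 * pi)"
      using assms False by (subst curve_length_add[of 0 "s + 2 * pi"]) auto
    also have "curve_length g (s + 2 * pi) (0 + 2 * pi) = curve_length g s 0"
      by (rule curve_length_periodic) (rule g_periodic)
    also have "curve_length g 0 (s + 2 * pi) + \<dots> = curve_length g s (s + 2 * pi)"
      using assms False by (subst curve_length_add[of s 0]) auto
    finally show ?thesis by (simp add: perimeter_def)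
  qed
  then show ?thesis
    by (simp add: arc_value_def J_def area_def flip: body_eq_sector)
qed

lemma triangle_subset_sector:
  assumes "s < t" "t < s + pi"
  shows "convex hull {0, g s, g t} \<subseteq> sector g s t"
proof
  fix z assume "z \<in> convex hull {0, g s, g t}"
  then obtain \<alpha> \<beta> where z: "0 \<le> \<alpha>" "0 \<le> \<beta>" "\<alpha> + \<beta> \<le> 1" "z = \<alpha> *\<^sub>R g s + \<beta> *\<^sub>R g t"
    unfolding convex_hull_3_alt by auto
  show "z \<in> sector g s t"
  proof (cases "z = 0")
    case True
    then show ?thesis using assms unfolding sector_iff by (intro exI[of _ 0] exI[of _ s]) auto
  next
    case False
    have "convex hull {0, g s, g t} \<subseteq> K"
      using zero_in_body g_in_body convex_body by (intro hull_minimal) auto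
    then have "z \<in> K" using \<open>z \<in> convex hull _\<close> by blast
    then have "z \<in> sector g s (s + 2 * pi)" by (simp flip: body_eq_sector)
    then obtain r u where u: "0 \<le> r" "r \<le> 1" "s \<le> u" "u \<le> s + 2 * pi" "z = r *\<^sub>R g u"
      by (auto simp: sector_iff)
    have r: "r > 0" using u False by auto
    have pos: "0 < cross (g s) (g t)" using assms by (rule cross_g_pos)
    have "cross (g s) z = \<beta> * cross (g s) (g t)" "cross z (g t) = \<alpha> * cross (g s) (g t)"
      by (simp_all add: z(4) cross_bilinear)
    then have "0 \<le> cross (g s) z" "0 \<le> cross z (g t)" using z(1,2) pos by auto
    then have "0 \<le> r * cross (g s) (g u)" "0 \<le> r * cross (g u) (g t)"
      by (auto simp: u(5))
    then have "0 \<le> sin (u - s)" "0 \<le> sin (t - u)"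
      using r by (auto simp: zero_le_mult_iff cross_g_sign)
    then have "u \<le> t \<or> u = s + 2 * pi" using assms u by (intro angle_in_cone) auto
    then show ?thesis unfolding sector_iff using u assms g_periodic by force
  qed
qed

lemma area_sector_ge:
  assumes "s \<le> t" "t < s + pi"
  shows "cross (g s) (g t) / 2 \<le> measure lebesgue (sector g s t)"
proof (cases "s = t")
  case False
  have "\<bar>cross (g s) (g t)\<bar> / 2 \<le> measure lebesgue (sector g s t)"
    unfolding area_triangle[symmetric] using False assms
    by (intro measure_mono_fmeasurable triangle_subset_sector)
      (auto intro!: lmeasurable_compact compact_sector fmeasurableD finite_imp_compact_convex_hull)
  then show ?thesis by linarith
qed simp

text \<open>An inscribed chain nearly attains the length of the arc and encloses less area; as \<open>l\<close> is
  nonnegative, its value is at least that of the arc up to \<open>\<epsilon>\<close>.\<close>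

lemma inscribed_chain:
  assumes "s \<le> t" "t < s + pi" "0 \<le> l" "0 < \<epsilon>"
  obtains n x where "subdivision s t n x"
    "arc_value l g s t - \<epsilon> < chain_value l (g s) (map (\<lambda>i. g (x (Suc i)) - g (x i)) [0..<n])"
proof -
  obtain n x where nx: "subdivision s t n x" "curve_length g s t - \<epsilon> < partition_sum g n x"
    using curve_length_le[of s t g "curve_length g s t - \<epsilon>"] assms by fastforce
  have "(\<Sum>i<k. cross (g (x i)) (g (x (Suc i))) / 2) \<le> measure lebesgue (sector g s (x k))" if "k \<le> n" for k
    using that
  proof (induction k)
    case (Suc k)
    have x: "s \<le> x k" "x k \<le> x (Suc k)" "x (Suc k) \<le> t"
      using subdivision_range[OF nx(1)] subdivision_mono[OF nx(1), of k "Suc k"] Suc.prems by auto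
    have "(\<Sum>i<Suc k. cross (g (x i)) (g (x (Suc i))) / 2) \<le>
        measure lebesgue (sector g s (x k)) + measure lebesgue (sector g (x k) (x (Suc k)))"
      using Suc area_sector_ge[of "x k" "x (Suc k)"] x assms by simp
    also have "\<dots> = measure lebesgue (sector g s (x (Suc k)))"
      using x assms pi_gt_zero by (intro area_sector_add[symmetric]) linarith+
    finally show ?case .
  qed simp
  from this[of n] have "(\<Sum>i<n. cross (g (x i)) (g (x (Suc i))) / 2) \<le> measure lebesgue (sector g s t)"
    using nx(1) by (simp add: subdivision_def)
  then have "l * (\<Sum>i<n. cross (g (x i)) (g (x (Suc i))) / 2) \<le> l * measure lebesgue (sector g s t)"
    using assms by (intro mult_left_mono)
  moreover have "chain_value l (g s) (map (\<lambda>i. g (x (Suc i)) - g (x i)) [0..<n]) =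
      partition_sum g n x - l * (\<Sum>i<n. cross (g (x i)) (g (x (Suc i))) / 2)"
    using chain_value_inscribed[of l "\<lambda>i. g (x i)" n] nx(1)
    by (simp add: subdivision_def partition_sum_def sum_subtractf sum_distrib_left)
  ultimately show thesis using nx that by (simp add: arc_value_def)
qed

text \<open>Along a segment in the boundary, the curve moves monotonically. Comparing \<open>cross (g u) (g w)\<close> with
  the angle between the two points gives the monotonicity.\<close>

lemma segment_frontier_param:
  assumes "s < t" "t < s + pi" "closed_segment (g s) (g t) \<subseteq> frontier K"
  obtains \<phi> where "\<And>u. s \<le> u \<Longrightarrow> u \<le> t \<Longrightarrow> g u = g s + \<phi> u *\<^sub>R (g t - g s)"
    "\<And>u. s \<le> u \<Longrightarrow> u \<le> t \<Longrightarrow> 0 \<le> \<phi> u \<and> \<phi> u \<le> 1" "\<phi> s = 0" "\<phi> t = 1"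
    "\<And>u w. s \<le> u \<Longrightarrow> u \<le> w \<Longrightarrow> w \<le> t \<Longrightarrow> \<phi> u \<le> \<phi> w"
proof -
  have pq: "0 < cross (g s) (g t)" using assms(1,2) by (rule cross_g_pos)
  define \<phi> where "\<phi> u = cross (g s) (cis u) / (cross (g s) (cis u) + cross (cis u) (g t))" for u
  have gu: "g u = g s + \<phi> u *\<^sub>R (g t - g s) \<and> 0 \<le> \<phi> u \<and> \<phi> u \<le> 1" if u: "s \<le> u" "u \<le> t" for u
  proof -
    have c: "cross (g s) (cis u) = \<rho> s * sin (u - s)" "cross (cis u) (g t) = \<rho> t * sin (t - u)"
      by (simp_all add: g_eq cross_cis)
    have nn: "0 \<le> cross (g s) (cis u)" "0 \<le> cross (cis u) (g t)"
      unfolding c using radial_pos[of s] radial_pos[of t] u assms by (auto intro!: mult_nonneg_nonneg sin_ge_zero)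
    have "0 < cross (g s) (cis u) \<or> 0 < cross (cis u) (g t)"
    proof (cases "u = s")
      case True
      then show ?thesis unfolding c using radial_pos[of t] assms by (auto intro!: mult_pos_pos sin_gt_zero)
    next
      case False
      then show ?thesis unfolding c using radial_pos[of s] u assms by (auto intro!: mult_pos_pos sin_gt_zero)
    qed
    then have D: "0 < cross (g s) (cis u) + cross (cis u) (g t)" (is "0 < ?D") using nn by linarith
    have \<phi>01: "0 \<le> \<phi> u" "\<phi> u \<le> 1" using nn D by (auto simp: \<phi>_def)
    define r where "r = cross (g s) (g t) / ?D"
    have "?D *\<^sub>R (g s + \<phi> u *\<^sub>R (g t - g s)) = ?D *\<^sub>R (r *\<^sub>R cis u)"
    proof -
      have "?D * \<phi> u = cross (g s) (cis u)" using D by (simp add: \<phi>_def)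
      then have "?D *\<^sub>R (g s + \<phi> u *\<^sub>R (g t - g s)) = ?D *\<^sub>R g s + cross (g s) (cis u) *\<^sub>R (g t - g s)"
        by (simp add: scaleR_add_right del: distrib_right)
      also have "\<dots> = cross (g s) (cis u) *\<^sub>R g t + cross (cis u) (g t) *\<^sub>R g s"
        by (simp add: algebra_simps)
      also have "\<dots> = cross (g s) (g t) *\<^sub>R cis u" by (rule cross_cyclic[symmetric])
      finally show ?thesis using D by (simp add: r_def)
    qed
    then have eq: "g s + \<phi> u *\<^sub>R (g t - g s) = r *\<^sub>R cis u"
      using D by (simp only: scaleR_cancel_left) simp
    have "g s + \<phi> u *\<^sub>R (g t - g s) \<in> closed_segment (g s) (g t)"
      using \<phi>01 by (auto simp: in_segment algebra_simps intro!: exI[of _ "\<phi> u"])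
    then have "r *\<^sub>R cis u \<in> frontier K" using assms(3) eq by auto
    moreover have "0 \<le> r" using pq D by (simp add: r_def)
    ultimately have "g u = r *\<^sub>R cis u" by (rule frontier_point_unique)
    with eq \<phi>01 show ?thesis by simp
  qed
  show thesis
  proof (rule that)
    show "\<phi> s = 0" by (simp add: \<phi>_def g_eq cross_cis)
    have "cross (cis t) (g t) = 0" "cross (g s) (cis t) = \<rho> s * sin (t - s)" by (simp_all add: g_eq cross_cis)
    moreover have "\<rho> s * sin (t - s) > 0" using radial_pos[of s] assms by (auto intro!: mult_pos_pos sin_gt_zero)
    ultimately show "\<phi> t = 1" by (auto simp: \<phi>_def)
    fix u w assume uw: "s \<le> u" "u \<le> w" "w \<le> t"
    have "cross (g u) (g w) = (\<phi> w - \<phi> u) * cross (g s) (g t)"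
      using arg_cong2[of "g u" "g s + \<phi> u *\<^sub>R (g t - g s)" "g w" "g s + \<phi> w *\<^sub>R (g t - g s)" cross]
        gu[of u] gu[of w] uw unfolding cross_chord by simp
    moreover have "0 \<le> cross (g u) (g w)"
      unfolding cross_g_sign using uw assms by (intro sin_ge_zero) auto
    ultimately show "\<phi> u \<le> \<phi> w" using pq by (simp add: zero_le_mult_iff)
  next
    fix u assume "s \<le> u" "u \<le> t"
    from gu[OF this] show "g u = g s + \<phi> u *\<^sub>R (g t - g s)" "0 \<le> \<phi> u \<and> \<phi> u \<le> 1" by blast+
  qed
qed

lemma arc_value_segment:
  assumes "s \<le> t" "t < s + pi" "closed_segment (g s) (g t) \<subseteq> frontier K"
  shows "arc_value l g s t = chain_value l (g s) [g t - g s]"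
proof (cases "s = t")
  case True
  then show ?thesis using arc_value_add[of s s s l] by simp
next
  case False
  then have st: "s < t" using assms(1) by simp
  obtain \<phi> where \<phi>: "\<And>u. s \<le> u \<Longrightarrow> u \<le> t \<Longrightarrow> g u = g s + \<phi> u *\<^sub>R (g t - g s)"
    "\<And>u. s \<le> u \<Longrightarrow> u \<le> t \<Longrightarrow> 0 \<le> \<phi> u \<and> \<phi> u \<le> 1" "\<phi> s = 0" "\<phi> t = 1"
    "\<And>u w. s \<le> u \<Longrightarrow> u \<le> w \<Longrightarrow> w \<le> t \<Longrightarrow> \<phi> u \<le> \<phi> w"
    using segment_frontier_param[OF st assms(2,3)] by metis
  have "curve_length g s t = (\<phi> t - \<phi> s) * norm (g t - g s)"
    using assms(1) by (intro curve_length_segment[where p = "g s"] \<phi>(1) \<phi>(5)) auto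
  then have len: "curve_length g s t = norm (g t - g s)" by (simp add: \<phi>(3,4))
  have "sector g s t \<subseteq> convex hull {0, g s, g t}"
  proof
    fix z assume "z \<in> sector g s t"
    then obtain r u where u: "0 \<le> r" "r \<le> 1" "s \<le> u" "u \<le> t" "z = r *\<^sub>R g u" by (auto simp: sector_iff)
    have "z = 0 + (r * (1 - \<phi> u)) *\<^sub>R (g s - 0) + (r * \<phi> u) *\<^sub>R (g t - 0)"
      using u(5) arg_cong[OF \<phi>(1)[OF u(3,4)], of "scaleR r"] by (simp add: algebra_simps)
    moreover have "0 \<le> r * (1 - \<phi> u)" "0 \<le> r * \<phi> u" "r * (1 - \<phi> u) + r * \<phi> u \<le> 1"
      using u \<phi>(2)[OF u(3,4)] by (simp_all add: algebra_simps mult_left_le)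
    ultimately show "z \<in> convex hull {0, g s, g t}"
      unfolding convex_hull_3_alt by blast
  qed
  then have "sector g s t = convex hull {0, g s, g t}"
    using triangle_subset_sector st assms(2) by blast
  moreover have "0 < cross (g s) (g t)" using st assms(2) by (rule cross_g_pos)
  ultimately show ?thesis
    by (simp add: arc_value_def len area_triangle cross_diff_right)
qed

end

section \<open>Replacing an arc by a chain of two edges\<close>

context ring_body begin

lemma segment_frontier:
  assumes "z \<in> K" "z' \<in> K" "n \<noteq> 0" "\<And>y. y \<in> K \<Longrightarrow> inner n y \<le> c" "inner n z = c" "inner n z' = c"
  shows "closed_segment z z' \<subseteq> frontier K"
proof
  fix y assume y: "y \<in> closed_segment z z'"
  then obtain u where u: "y = (1 - u) *\<^sub>R z + u *\<^sub>R z'" by (auto simp: in_segment)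
  have "inner n y = c" by (simp add: u inner_add_right assms(5,6) algebra_simps)
  moreover have "y \<in> K"
    using y assms(1,2) convex_body by (meson closed_segment_subset subsetD)
  ultimately show "y \<in> frontier K" using assms(3,4) by (intro supporting_frontier) auto
qed

lemma arc_value_two_edges:
  assumes st: "s < t" "t < s + pi" and y: "0 \<le> cross (g s) y" "0 \<le> cross y (g t)"
    and segs: "closed_segment (g s) y \<subseteq> frontier K" "closed_segment y (g t) \<subseteq> frontier K"
  shows "arc_value l g s t = chain_value l (g s) [y - g s, g t - y]"
proof -
  have yF: "y \<in> frontier K" using segs by auto
  then have "y \<in> sector g s (s + 2 * pi)" using frontier_subset_body by (auto simp flip: body_eq_sector)
  then obtain r \<alpha> where \<alpha>: "0 \<le> r" "s \<le> \<alpha>" "\<alpha> \<le> s + 2 * pi" "y = (r * \<rho> \<alpha>) *\<^sub>R cis \<alpha>"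
    by (auto simp: sector_iff g_eq)
  have g\<alpha>: "g \<alpha> = y"
    using frontier_point_unique[of "r * \<rho> \<alpha>" \<alpha>] yF \<alpha> radial_pos[of \<alpha>] by simp
  then have sin: "0 \<le> sin (\<alpha> - s)" "0 \<le> sin (t - \<alpha>)"
    using y by (auto simp: cross_g_sign simp flip: g\<alpha>)
  obtain \<beta> where \<beta>: "s \<le> \<beta>" "\<beta> \<le> t" "g \<beta> = y"
  proof (cases "\<alpha> = s + 2 * pi")
    case True
    then show ?thesis using that[of s] g_periodic[of s] g\<alpha> st by simp
  next
    case False
    then show ?thesis using that[of \<alpha>] angle_in_cone[OF st \<alpha>(2,3) sin] g\<alpha> \<alpha> by blast
  qed
  have "arc_value l g s t = arc_value l g s \<beta> + arc_value l g \<beta> t"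
    using \<beta> st pi_gt_zero by (intro arc_value_add) auto
  also have "arc_value l g s \<beta> = chain_value l (g s) [y - g s]"
    using \<beta> st segs arc_value_segment[of s \<beta> l] by simp
  also have "arc_value l g \<beta> t = chain_value l y [g t - y]"
    using \<beta> st segs arc_value_segment[of \<beta> t l] by simp
  finally show ?thesis by simp
qed

text \<open>A competitor that differs from \<open>K\<close> only over the angles between \<open>s\<close> and \<open>t\<close> changes \<open>J l\<close> only through
  this arc.\<close>

lemma arc_comparison:
  assumes "M \<in> convex_ring_class a b" "J l K \<le> J l M" "- 2 * pi \<le> s" "s \<le> 2 * pi"
    and "s \<le> t" "t \<le> s + 2 * pi" "\<And>u. t \<le> u \<Longrightarrow> u \<le> s + 2 * pi \<Longrightarrow> boundary_point M u = g u"
  shows "arc_value l (boundary_point M) s t \<le> arc_value l g s t"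
proof -
  interpret M: ring_body a b M using assms a_pos by unfold_locales auto
  have "J l M = - (arc_value l M.g s t + arc_value l M.g t (s + 2 * pi))"
    using M.J_eq_arc_value[of s l] M.arc_value_add[of s t "s + 2 * pi" l] assms by simp
  moreover have "J l K = - (arc_value l g s t + arc_value l g t (s + 2 * pi))"
    using J_eq_arc_value[of s l] arc_value_add[of s t "s + 2 * pi" l] assms by simp
  moreover have "arc_value l M.g t (s + 2 * pi) = arc_value l g t (s + 2 * pi)"
    using assms(7) by (rule arc_value_cong)
  ultimately show ?thesis using assms(2) by simp
qed

text \<open>The competitor keeps the part of \<open>K\<close> on the inner side of the chord from \<open>p\<close> to \<open>q\<close> and
  replaces the rest by the triangle \<open>p, v, q\<close>. The apex \<open>v\<close> lies beyond the chord, but inside the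
  half-planes of supporting lines at \<open>p\<close> and \<open>q\<close>; this is exactly what keeps the angles at \<open>p\<close> and \<open>q\<close>
  convex. The inner disc is not cut off because the chord does not enter its interior.\<close>

lemma two_edge_comparison:
  assumes opt: "\<And>M. M \<in> convex_ring_class a b \<Longrightarrow> J l K \<le> J l M"
    and s: "- 2 * pi \<le> s" "s \<le> 2 * pi" and st: "s < t" "t < s + pi"
    and p: "p = g s" and q: "q = g t"
    and n1: "\<And>y. y \<in> K \<Longrightarrow> inner n1 y \<le> inner n1 p" "inner n1 q < inner n1 p"
    and n2: "\<And>y. y \<in> K \<Longrightarrow> inner n2 y \<le> inner n2 q" "inner n2 p < inner n2 q"
    and v: "norm v \<le> b" "inner n1 v \<le> inner n1 p" "inner n2 v \<le> inner n2 q" "0 \<le> cross (v - p) (q - p)"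
    and chord: "\<And>z. z \<in> closed_segment p q \<Longrightarrow> a \<le> norm z"
  shows "chain_value l p [v - p, q - v] \<le> arc_value l g s t"
proof -
  define w u u' where "w = q - p" and "u = v - p" and "u' = q - v"
  \<comment> \<open>\<open>f\<close> is positive beyond the chord and negative at \<open>0\<close>.\<close>
  define f where "f y = cross (y - p) w" for y
  have pq: "0 < cross p q"
    unfolding p q using st by (rule cross_g_pos)
  have pK: "p \<in> K" and qK: "q \<in> K" using g_in_body p q by auto
  have f_comb: "f ((1 - c) *\<^sub>R y + c *\<^sub>R z) = (1 - c) * f y + c * f z" for c y z
    by (simp add: f_def cross_def algebra_simps)
  have f0: "f 0 < 0" using pq by (simp add: f_def w_def cross_def algebra_simps)
  have fv: "0 \<le> f v" using v(4) by (simp add: f_def w_def)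
  have fp: "f p = 0" and fq: "f q = 0" by (simp_all add: f_def w_def)
  have on_chord: "y \<in> closed_segment p q"
    if y: "f y = 0" "inner n1 y \<le> inner n1 p" "inner n2 y \<le> inner n2 q" for y
  proof -
    have "w \<noteq> 0" using pq by (auto simp: w_def)
    obtain k where k: "y = p + k *\<^sub>R w"
    proof -
      have "inner w w *\<^sub>R (y - p) = inner w (y - p) *\<^sub>R w + cross w (y - p) *\<^sub>R (\<i> * w)"
        by (rule orthogonal_decomposition)
      then have "inner w w *\<^sub>R (y - p) = inner w (y - p) *\<^sub>R w"
        using y(1) cross_commute[of w "y - p"] by (simp add: f_def)
      then have "inner w w *\<^sub>R (y - p) = inner w w *\<^sub>R ((inner w (y - p) / inner w w) *\<^sub>R w)"
        using \<open>w \<noteq> 0\<close> by simp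
      then have "y - p = (inner w (y - p) / inner w w) *\<^sub>R w"
        using \<open>w \<noteq> 0\<close> by (simp only: scaleR_cancel_left) simp
      then show thesis using that by (metis add.commute diff_add_cancel)
    qed
    have "k * (inner n1 q - inner n1 p) \<le> 0"
      using y(2) by (simp add: k w_def inner_add_right inner_diff_right)
    then have "0 \<le> k" using n1(2) by (simp add: mult_le_0_iff)
    have "(1 - k) * (inner n2 q - inner n2 p) \<ge> 0"
      using y(3) by (simp add: k w_def inner_add_right inner_diff_right algebra_simps)
    then have "k \<le> 1" using n2(2) by (simp add: zero_le_mult_iff)
    then show ?thesis using \<open>0 \<le> k\<close>
      unfolding in_segment by (intro exI[of _ k]) (simp add: k w_def algebra_simps)
  qed
  have chord_K: "closed_segment p q \<subseteq> K"
    using pK qK convex_body by (rule closed_segment_subset)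
  define B where "B = {y \<in> K. f y \<le> 0}"
  define M where "M = convex hull (insert v B)"
  have "continuous_on UNIV f" unfolding f_def cross_def by (intro continuous_intros)
  then have "closed {y. f y \<le> 0}"
    using closed_Collect_le[of f "\<lambda>_. 0"] by simp
  then have "compact B" using compact_body by (simp add: B_def Collect_conj_eq compact_Int_closed)
  then have "compact M" unfolding M_def by (intro compact_convex_hull compact_insert)
  have "convex B"
    unfolding convex_alt B_def using convexD_alt[OF convex_body]
    by (auto simp: f_comb mult_nonneg_nonpos intro!: add_nonpos_nonpos)
  have B0: "0 \<in> B" using zero_in_body f0 by (simp add: B_def)
  have pB: "p \<in> B" and qB: "q \<in> B" using pK qK fp fq by (auto simp: B_def)
  have BM: "B \<subseteq> M" and vM: "v \<in> M" unfolding M_def by (auto simp: hull_inc)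
  have disc: "cball 0 a \<subseteq> B"
  proof
    fix y :: complex assume y: "y \<in> cball 0 a"
    then have yK: "y \<in> K" using inner_disc by blast
    have "f y \<le> 0"
    proof (rule ccontr)
      assume "\<not> f y \<le> 0"
      then have fy: "0 < f y" by simp
      \<comment> \<open>The segment from \<open>0\<close> to \<open>y\<close> would cross the chord inside the open disc.\<close>
      define c where "c = - f 0 / (f y - f 0)"
      have c: "0 < c" "c < 1" using f0 fy by (auto simp: c_def field_simps)
      have "f (c *\<^sub>R y) = (1 - c) * f 0 + c * f y" using f_comb[of c 0 y] by simp
      also have "\<dots> = 0" using f0 fy by (simp add: c_def field_simps)
      finally have fc: "f (c *\<^sub>R y) = 0" .
      have cK: "c *\<^sub>R y \<in> K" using yK c by (intro scaled_in_body) auto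
      have "a \<le> norm (c *\<^sub>R y)" using fc n1(1)[OF cK] n2(1)[OF cK] by (rule chord[OF on_chord])
      moreover have "y \<noteq> 0" using fy f0 by auto
      then have "c * norm y < 1 * norm y" using c by (intro mult_strict_right_mono) auto
      then have "norm (c *\<^sub>R y) < a" using c y by simp
      ultimately show False by simp
    qed
    then show "y \<in> B" using yK by (simp add: B_def)
  qed
  have "M \<subseteq> cball 0 b" unfolding M_def
    using v(1) outer_disc by (intro hull_minimal) (auto simp: B_def)
  then have M: "M \<in> convex_ring_class a b"
    using \<open>compact M\<close> disc BM by (auto simp: convex_ring_class_def M_def convex_convex_hull)
  interpret M: ring_body a b M using M a_pos by unfold_locales auto
  have in_K: "m \<in> K" if m: "m \<in> M" "f m < 0" for m
  proof -
    obtain y where y: "y \<in> B" "m \<in> closed_segment v y"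
    proof -
      have "convex hull B = B" using \<open>convex B\<close> by (simp add: convex_hull_eq)
      then have "M = \<Union> (closed_segment v ` B)"
        using B0 unfolding M_def convex_hull_insert_segments by auto
      then show thesis using m(1) that by blast
    qed
    then obtain c where c: "0 \<le> c" "c \<le> 1" "m = (1 - c) *\<^sub>R v + c *\<^sub>R y" by (auto simp: in_segment)
    have neg: "(1 - c) * f v + c * f y < 0" using m(2) c(3) f_comb by simp
    moreover have "0 \<le> (1 - c) * f v" using fv c by simp
    ultimately have "c * f y < 0" by linarith
    then have fy: "f y < 0" and cpos: "0 < c" using c y by (auto simp: mult_less_0_iff B_def)
    \<comment> \<open>The segment from \<open>v\<close> to \<open>y\<close> crosses the chord at \<open>z\<close>, and \<open>m\<close> lies between \<open>z\<close> and \<open>y\<close>.\<close>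
    define k where "k = f v / (f v - f y)"
    have k: "0 \<le> k" "k < 1" using fy fv by (auto simp: k_def field_simps)
    define z where "z = (1 - k) *\<^sub>R v + k *\<^sub>R y"
    have k0: "(1 - k) * f v + k * f y = 0" using fy fv by (simp add: k_def field_simps)
    then have fz: "f z = 0" by (simp add: z_def f_comb)
    have yK: "y \<in> K" using y by (simp add: B_def)
    have "inner n1 z \<le> (1 - k) * inner n1 p + k * inner n1 p"
      using v(2) n1(1)[OF yK] k by (auto simp: z_def inner_add_right intro!: add_mono mult_left_mono)
    moreover have "inner n2 z \<le> (1 - k) * inner n2 q + k * inner n2 q"
      using v(3) n2(1)[OF yK] k by (auto simp: z_def inner_add_right intro!: add_mono mult_left_mono)
    ultimately have "z \<in> K"
      using on_chord[OF fz] chord_K by (auto simp: algebra_simps)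
    have "(1 - c) * f v + c * f y < (1 - k) * f v + k * f y"
      using neg k0 by simp
    then have "0 < (c - k) * (f v - f y)" by (simp add: algebra_simps)
    then have ck: "k < c" using fy fv by (simp add: zero_less_mult_iff)
    define d where "d = (c - k) / (1 - k)"
    have d: "0 \<le> d" "d \<le> 1" using ck k c by (auto simp: d_def field_simps)
    have "m = (1 - d) *\<^sub>R z + d *\<^sub>R y"
    proof -
      have "d * (1 - k) = c - k" using k by (simp add: d_def)
      then have "(1 - d) * (1 - k) = 1 - c" "(1 - d) * k + d = c" by (simp_all add: algebra_simps)
      then have "c *\<^sub>R y = ((1 - d) * k) *\<^sub>R y + d *\<^sub>R y" "(1 - c) *\<^sub>R v = ((1 - d) * (1 - k)) *\<^sub>R v"
        by (simp_all flip: scaleR_add_left)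
      then show ?thesis unfolding c(3) z_def by (simp add: scaleR_add_right)
    qed
    then show ?thesis using convexD_alt[OF convex_body \<open>z \<in> K\<close> yK d] by simp
  qed
  have M_le: "inner n m \<le> c" if "inner n v \<le> c" "\<And>y. y \<in> B \<Longrightarrow> inner n y \<le> c" "m \<in> M" for n m c
  proof -
    have "M \<subseteq> {y. inner n y \<le> c}"
      unfolding M_def using that by (intro hull_minimal convex_halfspace_le) auto
    then show ?thesis using that by blast
  qed
  \<comment> \<open>The directions \<open>d, u, w, u', d'\<close> of the supporting line at \<open>p\<close>, the first edge, the chord, the second
    edge and the supporting line at \<open>q\<close>: \<open>u\<close> is a conic combination of \<open>d\<close> and \<open>w\<close>, and \<open>u'\<close> is one of \<open>w\<close> and \<open>d'\<close>.\<close>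
  define d d' where "d = \<i> * n1" and "d' = \<i> * n2"
  have cross_d: "cross d e = - inner n1 e" "cross e d = inner n1 e"
     "cross d' e = - inner n2 e" "cross e d' = inner n2 e" for e
    by (simp_all add: d_def d'_def cross_def inner_complex_def algebra_simps)
  have dw: "0 < cross d w" "0 < cross w d'" using n1(2) n2(2) by (simp_all add: cross_d w_def inner_diff_right)
  have du: "0 \<le> cross d u" "0 \<le> cross u w" "0 \<le> cross w u'" "0 \<le> cross u' d'"
    using v by (simp_all add: cross_d u_def w_def u'_def inner_diff_right cross_bilinear
      cross_commute[of q p] cross_commute[of q v] cross_commute[of p v])
  have pos_u: "0 \<le> cross e u" if "0 \<le> cross e w" "0 \<le> cross e d" for e
  proof -
    have "cross d w * cross e u = cross d u * cross e w + cross u w * cross e d"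
      by (rule cross_cyclic_value)
    then show ?thesis using that du dw by (metis add_nonneg_nonneg mult_nonneg_nonneg zero_le_mult_iff not_le)
  qed
  have pos_u': "0 \<le> cross e u'" if "0 \<le> cross e w" "0 \<le> cross e d'" for e
  proof -
    have "cross w d' * cross e u' = cross w u' * cross e d' + cross u' d' * cross e w"
      by (rule cross_cyclic_value)
    then show ?thesis using that du dw by (metis add_nonneg_nonneg mult_nonneg_nonneg zero_le_mult_iff not_le)
  qed
  have n0: "n1 \<noteq> 0" "n2 \<noteq> 0" using n1(2) n2(2) by auto
  have pF: "p \<in> frontier M"
  proof (rule M.supporting_frontier[OF _ n0(1)])
    show "inner n1 y \<le> inner n1 p" if "y \<in> M" for y
      by (rule M_le[OF v(2) _ that]) (use n1(1) in \<open>simp add: B_def\<close>)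
  qed (use pB BM in blast)
  have qF: "q \<in> frontier M"
  proof (rule M.supporting_frontier[OF _ n0(2)])
    show "inner n2 y \<le> inner n2 q" if "y \<in> M" for y
      by (rule M_le[OF v(3) _ that]) (use n2(1) in \<open>simp add: B_def\<close>)
  qed (use qB BM in blast)
  \<comment> \<open>Each new edge has \<open>v\<close> as an end, so its line supports the competitor as soon as it leaves \<open>B\<close> on
    one side.\<close>
  have edge_frontier: "closed_segment x y \<subseteq> frontier M"
    if xy: "x \<in> M" "y \<in> M" "x \<in> frontier M \<or> y \<in> frontier M" "v = x \<or> v = y"
      and left: "\<And>z. z \<in> B \<Longrightarrow> 0 \<le> cross (x - z) (y - x)" for x y
  proof (cases "x = y")
    case True
    then show ?thesis using xy by auto
  next
    case False
    let ?n = "- (\<i> * (y - x))"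
    have n: "inner ?n z = - cross (y - x) z" for z by (simp add: cross_eq_inner)
    have xe: "inner ?n y = inner ?n x" unfolding n by (simp add: cross_def algebra_simps)
    show ?thesis
    proof (rule M.segment_frontier[OF xy(1,2) _ _ refl xe])
      show "inner ?n m \<le> inner ?n x" if "m \<in> M" for m
      proof (rule M_le[OF _ _ that])
        show "inner ?n v \<le> inner ?n x" using xy(4) xe by auto
        show "inner ?n z \<le> inner ?n x" if "z \<in> B" for z
          using left[OF that] unfolding n by (simp add: cross_def algebra_simps)
      qed
    qed (use False in simp)
  qed
  have segs: "closed_segment p v \<subseteq> frontier M"
  proof (rule edge_frontier)
    fix y assume y: "y \<in> B"
    show "0 \<le> cross (p - y) (v - p)"
      using y n1(1)[of y] pos_u[of "p - y"] by (simp add: B_def f_def u_def cross_d cross_bilinear inner_diff_right)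
  qed (use pF pB BM vM in auto)
  have segs': "closed_segment v q \<subseteq> frontier M"
  proof (rule edge_frontier)
    fix y assume y: "y \<in> B"
    have "0 \<le> cross (q - y) u'"
    proof (rule pos_u')
      show "0 \<le> cross (q - y) w" using y by (simp add: B_def f_def w_def cross_bilinear cross_commute[of q p])
      show "0 \<le> cross (q - y) d'" using y n2(1)[of y] by (simp add: B_def cross_d inner_diff_right)
    qed
    then show "0 \<le> cross (v - y) (q - v)" by (simp add: u'_def cross_bilinear cross_commute[of q v])
  qed (use qF qB BM vM in auto)
  have Mp: "M.g s = p"
    using M.frontier_point_unique[of "\<rho> s" s] pF radial_pos[of s] by (simp add: p g_eq)
  have Mq: "M.g t = q"
    using M.frontier_point_unique[of "\<rho> t" t] qF radial_pos[of t] by (simp add: q g_eq)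
  have "0 \<le> inner n1 p" "0 \<le> inner n2 q" using n1(1)[OF zero_in_body] n2(1)[OF zero_in_body] by auto
  then have "0 \<le> cross p u" "0 \<le> cross q u'"
    using pq by (auto intro!: pos_u pos_u' simp: w_def cross_d cross_bilinear cross_commute[of q p])
  then have "0 \<le> cross p v" "0 \<le> cross v q"
    by (simp_all add: u_def u'_def cross_bilinear cross_commute[of q v])
  then have arc: "arc_value l M.g s t = chain_value l p [v - p, q - v]"
    using M.arc_value_two_edges[of s t v l] st segs segs' unfolding Mp Mq by simp
  have "M.g x = g x" if x: "t \<le> x" "x \<le> s + 2 * pi" for x
  proof -
    consider "x = t" | "x = s + 2 * pi" | "t < x" "x < s + 2 * pi" using x by linarith
    then show ?thesis
    proof cases
      case 1
      then show ?thesis using Mq q by simp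
    next
      case 2
      then show ?thesis using Mp p M.g_periodic[of s] g_periodic[of s] by simp
    next
      case 3
      have fx: "f (g x) < 0"
      proof (rule ccontr)
        assume "\<not> f (g x) < 0"
        then have fx: "0 \<le> f (g x)" by simp
        define c where "c = - f 0 / (f (g x) - f 0)"
        have c: "0 < c" "c \<le> 1" using f0 fx by (auto simp: c_def field_simps)
        have "f (c *\<^sub>R g x) = (1 - c) * f 0 + c * f (g x)" using f_comb[of c 0 "g x"] by simp
        also have "\<dots> = 0" using f0 fx by (simp add: c_def field_simps)
        finally have fc: "f (c *\<^sub>R g x) = 0" .
        have cK: "c *\<^sub>R g x \<in> K" using g_in_body c by (intro scaled_in_body) auto
        have "c *\<^sub>R g x \<in> closed_segment p q" using fc n1(1)[OF cK] n2(1)[OF cK] by (rule on_chord)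
        then obtain k where k: "0 \<le> k" "k \<le> 1" "c *\<^sub>R g x = (1 - k) *\<^sub>R p + k *\<^sub>R q"
          by (auto simp: in_segment)
        have "cross p (c *\<^sub>R g x) = k * cross p q" "cross (c *\<^sub>R g x) q = (1 - k) * cross p q"
          unfolding k(3) by (simp_all add: cross_bilinear)
        then have "0 \<le> cross p (c *\<^sub>R g x)" "0 \<le> cross (c *\<^sub>R g x) q" using pq k(1,2) by auto
        then have "0 \<le> c * cross p (g x)" "0 \<le> c * cross (g x) q" by simp_all
        then have "0 \<le> sin (x - s)" "0 \<le> sin (t - x)"
          using c by (auto simp: p q cross_g_sign zero_le_mult_iff)
        then show False using angle_in_cone[OF st, of x] 3 st by auto
      qed
      have "g x \<in> M" using BM fx g_in_body by (auto simp: B_def)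
      moreover have "g x \<notin> interior M"
      proof
        assume "g x \<in> interior M"
        then have "g x \<in> interior M \<inter> {y. f y < 0}" using fx by simp
        moreover have "open (interior M \<inter> {y. f y < 0})"
          using open_Collect_less[OF \<open>continuous_on UNIV f\<close> continuous_on_const] by auto
        moreover have "interior M \<inter> {y. f y < 0} \<subseteq> K" using in_K interior_subset by blast
        ultimately have "g x \<in> interior K" by (meson interior_maximal subsetD)
        then show False using g_frontier by (simp add: frontier_def)
      qed
      ultimately have "g x \<in> frontier M" using closure_subset by (auto simp: frontier_def)
      then show ?thesis using M.frontier_point_unique[of "\<rho> x" x] radial_pos[of x] by (simp add: g_eq)
    qed
  qed
  then have "arc_value l M.g s t \<le> arc_value l g s t"
    using opt[OF M] s st by (intro arc_comparison[OF M]) auto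
  then show ?thesis by (simp only: arc)
qed

end

section \<open>Short arcs inside the ring\<close>

lemma normal_tangential_components:
  "inner x x * inner n e = inner x n * inner x e + cross x n * cross x e"
  by (simp add: inner_complex_def cross_def algebra_simps)

context ring_body begin

definition normal :: "real \<Rightarrow> complex" where
  "normal u = (SOME n. norm n = 1 \<and> (\<forall>y\<in>K. inner n y \<le> inner n (g u)) \<and> a \<le> inner n (g u))"

lemma normal: "norm (normal u) = 1" "y \<in> K \<Longrightarrow> inner (normal u) y \<le> inner (normal u) (g u)"
  "a \<le> inner (normal u) (g u)"
proof -
  have "\<exists>n. norm n = 1 \<and> (\<forall>y\<in>K. inner n y \<le> inner n (g u)) \<and> a \<le> inner n (g u)"
    using support_normal[OF g_frontier[of u]] by metis
  from someI_ex[OF this, folded normal_def]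
  show "norm (normal u) = 1" "y \<in> K \<Longrightarrow> inner (normal u) y \<le> inner (normal u) (g u)"
    "a \<le> inner (normal u) (g u)" by auto
qed

end

text \<open>A stretch of the boundary close to a point \<open>x\<close> of the open ring. The bound by \<open>a / 4\<close> gives all outer
  normals along the stretch a positive component along \<open>x\<close>, the next bound keeps chords out of the
  inner disc, and the last one keeps the support triangles inside the outer disc: two points of the
  stretch differ by at most \<open>2 * \<delta>\<close>, and the apex of their triangle is at most \<open>1 + 2 * b / a\<close> times as
  far from the first of them.\<close>

locale arc_window = ring_body +
  fixes x :: complex and lo hi \<delta> :: real
  assumes window: "hi < lo + pi" "- 2 * pi \<le> lo" "hi \<le> 2 * pi"
    and near: "\<And>u. lo \<le> u \<Longrightarrow> u \<le> hi \<Longrightarrow> norm (g u - x) \<le> \<delta>"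
    and small: "0 < \<delta>" "\<delta> \<le> a / 4" "\<delta> \<le> norm x - a" "\<delta> * (3 + 4 * b / a) \<le> b - norm x"
begin

text \<open>The counterclockwise direction of the chosen supporting line.\<close>

definition tangent :: "real \<Rightarrow> complex" where "tangent u = \<i> * normal u"

lemma cross_tangent:
  "cross (tangent u) e = - inner (normal u) e" "cross e (tangent u) = inner (normal u) e"
  by (simp_all add: tangent_def cross_def inner_complex_def algebra_simps)

lemma normal_near:
  assumes "lo \<le> u" "u \<le> hi" "norm (y - x) \<le> \<delta>"
  shows "a / 2 \<le> inner (normal u) y"
proof -
  have "inner (normal u) (g u - y) \<le> norm (normal u) * norm (g u - y)" by (rule norm_cauchy_schwarz)
  also have "norm (g u - y) \<le> norm (g u - x) + norm (y - x)"
    using norm_triangle_ineq4[of "g u - x" "y - x"] by simp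
  finally have "inner (normal u) (g u - y) \<le> a / 2"
    using near[OF assms(1,2)] assms(3) small(2) by (simp add: normal(1))
  then show ?thesis using normal(3)[of u] by (simp add: inner_diff_right)
qed

lemma normal_x: "lo \<le> u \<Longrightarrow> u \<le> hi \<Longrightarrow> a / 2 \<le> inner (normal u) x"
  using normal_near[of u x] small(1) by simp

lemma tangent_pos: "lo \<le> u \<Longrightarrow> u \<le> hi \<Longrightarrow> 0 < cross x (tangent u)"
  using normal_x[of u] a_pos by (simp add: cross_tangent)

text \<open>Turning of the normals and the direction of the chord are linked by the Binet-Cauchy identity,
  applied once at the boundary point \<open>g u\<close>, where the direction of the chord is known from the angles,
  and once at \<open>x\<close>.\<close>

lemma edge_and_normals:
  assumes "lo \<le> u" "u < v" "v \<le> hi"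
  shows "0 < cross x (g v - g u)" "0 \<le> cross (tangent u) (tangent v)"
proof -
  define e n m where "e = g v - g u" and "n = normal u" and "m = normal v"
  have ne: "inner n e \<le> 0" and me: "0 \<le> inner m e"
    using normal(2)[OF g_in_body] by (auto simp: e_def n_def m_def inner_diff_right)
  have ge: "0 < cross (g u) e"
    using assms window by (simp add: e_def cross_diff_right cross_g_pos)
  have binet: "cross y e * cross n m = inner y n * inner m e - inner y m * inner n e" for y
    by (simp add: cross_def inner_complex_def algebra_simps)
  have pos: "0 < inner y n" "0 < inner y m" if "norm (y - x) \<le> \<delta>" for y
    using normal_near[of u y] normal_near[of v y] assms that a_pos by (simp_all add: n_def m_def inner_commute)
  have g_pos: "0 < inner (g u) n" "0 < inner (g u) m"
    using pos[of "g u"] near[of u] assms by auto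
  have x_pos: "0 < inner x n" "0 < inner x m" using pos[of x] small by auto
  have "0 \<le> cross (g u) e * cross n m"
    unfolding binet using mult_nonneg_nonneg[of "inner (g u) n" "inner m e"] mult_nonneg_nonpos[of "inner (g u) m" "inner n e"]
      g_pos ne me by linarith
  then have nm: "0 \<le> cross n m" using ge by (simp add: zero_le_mult_iff)
  then show "0 \<le> cross (tangent u) (tangent v)"
    by (simp add: tangent_def n_def m_def cross_def)
  show "0 < cross x (g v - g u)"
  proof (cases "inner n e = 0 \<and> inner m e = 0")
    case True
    have "inner n n *\<^sub>R e = inner n e *\<^sub>R n + cross n e *\<^sub>R (\<i> * n)"
      by (rule orthogonal_decomposition)
    then have e: "e = cross n e *\<^sub>R (\<i> * n)" using True normal(1)[of u] by (simp add: n_def dot_square_norm)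
    have c: "cross y e = cross n e * inner y n" for y
      by (subst e) (simp add: cross_def inner_complex_def algebra_simps)
    have "0 < cross n e" using ge c[of "g u"] g_pos by (simp add: zero_less_mult_iff)
    then show ?thesis using c[of x] x_pos by (simp add: e_def)
  next
    case False
    then have "0 < - inner n e \<or> 0 < inner m e" using ne me by auto
    then have "0 < cross x e * cross n m"
      unfolding binet using ne me x_pos
      by (smt (verit, best) mult_nonneg_nonpos mult_pos_neg mult_pos_pos mult_nonneg_nonneg)
    then show ?thesis using nm by (auto simp: zero_less_mult_iff e_def)
  qed
qed

lemma tangent_mono: "lo \<le> u \<Longrightarrow> u \<le> v \<Longrightarrow> v \<le> hi \<Longrightarrow> 0 \<le> cross (tangent u) (tangent v)"
  using edge_and_normals(2)[of u v] by (cases "u = v") auto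

text \<open>The direction of \<open>e\<close> lies between the directions of the supporting lines at \<open>s\<close> and \<open>t\<close>. Zero is
  admitted because the edges of two-edge chains may degenerate.\<close>

definition edge_between :: "real \<Rightarrow> real \<Rightarrow> complex \<Rightarrow> bool" where
  "edge_between s t e \<longleftrightarrow> (e = 0 \<or> 0 < cross x e) \<and> 0 \<le> cross (tangent s) e \<and> 0 \<le> cross e (tangent t)"

lemma edge_between_mono:
  assumes "edge_between s t e" "lo \<le> s'" "s' \<le> s" "s \<le> t" "t \<le> t'" "t' \<le> hi"
  shows "edge_between s' t' e"
proof (cases "e = 0")
  case False
  then have e: "0 < cross x e" "0 \<le> cross (tangent s) e" "0 \<le> cross e (tangent t)"
    using assms by (auto simp: edge_between_def)
  have "0 \<le> cross (tangent s') e"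
    using assms e by (intro cross_trans[of x "tangent s'" "tangent s" e] tangent_pos tangent_mono) auto
  moreover have "0 \<le> cross e (tangent t')"
    using assms e by (intro cross_trans[of x e "tangent t" "tangent t'"] tangent_pos tangent_mono) auto
  ultimately show ?thesis using e by (simp add: edge_between_def)
qed (simp add: edge_between_def)

lemma edge_between_cross:
  assumes "edge_between s t e" "edge_between s' t' f" "lo \<le> t" "t \<le> s'" "s' \<le> hi"
  shows "0 \<le> cross e f"
proof (cases "e = 0 \<or> f = 0")
  case False
  then have e: "0 < cross x e" "0 \<le> cross e (tangent t)" and f: "0 < cross x f" "0 \<le> cross (tangent s') f"
    using assms by (auto simp: edge_between_def)
  have "0 \<le> cross e (tangent s')"
    using assms e by (intro cross_trans[of x e "tangent t" "tangent s'"] tangent_pos tangent_mono) auto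
  then show ?thesis
    using assms e f by (intro cross_trans[of x e "tangent s'" f] tangent_pos) auto
qed auto

lemma edge_between_boundary:
  assumes "lo \<le> s" "s \<le> t" "t \<le> hi"
  shows "edge_between s t (g t - g s)"
  using assms edge_and_normals(1)[of s t] normal(2)[OF g_in_body]
  by (cases "s = t") (auto simp: edge_between_def cross_tangent inner_diff_right)

text \<open>The first edges \<open>u\<close> of the convex two-edge chains from \<open>g s\<close> to \<open>g t\<close> inside the support triangle.
  All conditions are weak inequalities, which makes this set closed.\<close>

definition two_edge_paths :: "real \<Rightarrow> real \<Rightarrow> complex set" where
  "two_edge_paths s t = {u. (\<forall>e\<in>{u, g t - g s - u}. 0 \<le> cross x e \<and>
     0 \<le> cross (tangent s) e \<and> 0 \<le> cross e (tangent t)) \<and> 0 \<le> cross u (g t - g s - u)}"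

text \<open>An edge in the direction of \<open>x\<close> or \<open>- x\<close> would leave the half-plane of one of the two supporting
  lines, since both normals have a positive component along \<open>x\<close>.\<close>

lemma edge_betweenI:
  assumes "0 \<le> cross x e" "0 \<le> cross (tangent s) e" "0 \<le> cross e (tangent t)"
    and "lo \<le> s" "s \<le> hi" "lo \<le> t" "t \<le> hi"
  shows "edge_between s t e"
proof (cases "cross x e = 0")
  case True
  have xx: "inner x x * inner (normal u) e = inner x (normal u) * inner x e" for u
    using normal_tangential_components[of x "normal u" e] True by simp
  have pos: "0 < inner x (normal s)" "0 < inner x (normal t)" "0 < inner x x"
    using normal_x[of s] normal_x[of t] assms a_pos small by (auto simp: inner_commute)
  have "inner x x * inner (normal s) e \<le> 0" "0 \<le> inner x x * inner (normal t) e"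
    using assms(2,3) by (auto simp: cross_tangent mult_nonneg_nonpos)
  then have "inner x e \<le> 0" "0 \<le> inner x e" using pos unfolding xx
    by (auto simp: mult_le_0_iff zero_le_mult_iff)
  then have "inner x e = 0" by simp
  have "inner x x *\<^sub>R e = inner x e *\<^sub>R x + cross x e *\<^sub>R (\<i> * x)"
    by (rule orthogonal_decomposition)
  then have "e = 0" using True \<open>inner x e = 0\<close> pos by auto
  then show ?thesis by (simp add: edge_between_def)
qed (use assms in \<open>auto simp: edge_between_def\<close>)

lemma two_edge_paths_edges:
  assumes "u \<in> two_edge_paths s t" "lo \<le> s" "s \<le> t" "t \<le> hi"
  shows "edge_between s t u" "edge_between s t (g t - g s - u)" "0 \<le> cross u (g t - g s - u)"
  using assms by (auto simp: two_edge_paths_def intro!: edge_betweenI)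

text \<open>The tangential component of \<open>u\<close> is at most that of the chord. The radial component is controlled
  by the supporting line at \<open>s\<close> if it points outward and by the one at \<open>t\<close> if it points inward.\<close>

lemma two_edge_paths_norm:
  assumes "u \<in> two_edge_paths s t" "lo \<le> s" "s \<le> t" "t \<le> hi"
  shows "norm u \<le> norm (g t - g s) * (1 + 2 * b / a)"
proof -
  let ?w = "g t - g s"
  have T: "0 \<le> cross x u" "0 \<le> cross x (?w - u)" "inner (normal s) u \<le> 0" "0 \<le> inner (normal t) u"
    using assms(1) by (auto simp: two_edge_paths_def cross_tangent)
  have xpos: "norm x > 0" using a_pos small by linarith
  have xb: "norm x \<le> b"
  proof -
    have "0 \<le> \<delta> * (3 + 4 * b / a)" using small(1) a_pos radial_pos[of 0] radial_le[of 0] by simp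
    then show ?thesis using small by linarith
  qed
  have cw: "\<bar>cross y z\<bar> \<le> norm y * norm z" for y z
    using Cauchy_Schwarz_ineq2[of "\<i> * y" z] by (simp add: cross_eq_inner norm_mult)
  have "cross x u \<le> cross x ?w" using T by (simp add: cross_diff_right)
  also have "\<dots> \<le> norm x * norm ?w" using cw[of x ?w] by simp
  finally have tang: "cross x u \<le> norm x * norm ?w" .
  have bound: "a / 2 * \<bar>inner x u\<bar> \<le> norm x * (norm x * norm ?w)"
  proof -
    have *: "a / 2 * \<bar>inner x u\<bar> \<le> norm x * (norm x * norm ?w)"
      if v: "lo \<le> v" "v \<le> hi" and sg: "inner (normal v) u * inner x u \<le> 0" for v
    proof -
      have eq: "inner x (normal v) * inner x u = inner x x * inner (normal v) u - cross x (normal v) * cross x u"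
        using normal_tangential_components[of x "normal v" u] by simp
      have "inner x (normal v) * \<bar>inner x u\<bar> \<le> \<bar>cross x (normal v)\<bar> * \<bar>cross x u\<bar>"
      proof -
        have "inner x (normal v) * (inner x u * inner x u) \<le> - (cross x (normal v) * cross x u) * inner x u"
        proof -
          have "inner x (normal v) * (inner x u * inner x u) =
            inner x x * (inner (normal v) u * inner x u) - (cross x (normal v) * cross x u) * inner x u"
            using arg_cong[OF eq, of "\<lambda>z. z * inner x u"] by (simp add: algebra_simps)
          then show ?thesis using sg by (simp add: mult_nonneg_nonpos)
        qed
        also have "\<dots> \<le> \<bar>cross x (normal v)\<bar> * \<bar>cross x u\<bar> * \<bar>inner x u\<bar>"
          by (metis abs_ge_minus_self abs_mult mult_minus_left)
        finally have "(inner x (normal v) * \<bar>inner x u\<bar>) * \<bar>inner x u\<bar> \<le> \<bar>cross x (normal v)\<bar> * \<bar>cross x u\<bar> * \<bar>inner x u\<bar>"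
          by (simp add: abs_mult_self_eq mult.assoc)
        then show ?thesis by (cases "inner x u = 0") auto
      qed
      also have "\<dots> \<le> norm x * (norm x * norm ?w)"
        using cw[of x "normal v"] tang T(1) normal(1)[of v] by (intro mult_mono) auto
      finally show ?thesis
        using normal_x[OF v] by (smt (verit) abs_ge_zero inner_commute mult_right_mono)
    qed
    show ?thesis
    proof (cases "inner x u \<ge> 0")
      case True
      then show ?thesis using *[of s] T assms by (simp add: mult_nonpos_nonneg)
    next
      case False
      then show ?thesis using *[of t] T assms by (simp add: mult_nonneg_nonpos)
    qed
  qed
  then have "\<bar>inner x u\<bar> \<le> 2 * b / a * (norm x * norm ?w)"
  proof -
    have "norm x * (norm x * norm ?w) \<le> b * (norm x * norm ?w)" using xb by (intro mult_right_mono) auto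
    with bound have "a / 2 * \<bar>inner x u\<bar> \<le> b * (norm x * norm ?w)" by linarith
    then show ?thesis using a_pos by (simp add: field_simps)
  qed
  have "inner x x *\<^sub>R u = inner x u *\<^sub>R x + cross x u *\<^sub>R (\<i> * x)"
    by (rule orthogonal_decomposition)
  then have "norm (inner x x *\<^sub>R u) \<le> norm (inner x u *\<^sub>R x) + norm (cross x u *\<^sub>R (\<i> * x))"
    by (simp only: norm_triangle_ineq)
  then have "norm x * norm x * norm u \<le> \<bar>inner x u\<bar> * norm x + \<bar>cross x u\<bar> * norm x"
    by (simp add: norm_mult dot_square_norm power2_eq_square)
  also have "\<dots> = norm x * (\<bar>inner x u\<bar> + \<bar>cross x u\<bar>)" by (simp add: algebra_simps)
  also have "\<dots> \<le> norm x * (2 * b / a * (norm x * norm ?w) + norm x * norm ?w)"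
    using \<open>\<bar>inner x u\<bar> \<le> _\<close> tang T(1) by (intro mult_left_mono add_mono) auto
  also have "\<dots> = norm x * norm x * (norm ?w * (1 + 2 * b / a))" by (simp add: algebra_simps)
  finally show ?thesis using xpos by (simp add: mult_le_cancel_left)
qed

lemma compact_two_edge_paths:
  assumes "lo \<le> s" "s \<le> t" "t \<le> hi"
  shows "compact (two_edge_paths s t)"
proof -
  let ?S = "\<lambda>e. {u. 0 \<le> cross x (e u)} \<inter> {u. 0 \<le> cross (tangent s) (e u)} \<inter> {u. 0 \<le> cross (e u) (tangent t)}"
  have eq: "two_edge_paths s t = ?S (\<lambda>u. u) \<inter> ?S (\<lambda>u. g t - g s - u) \<inter> {u. 0 \<le> cross u (g t - g s - u)}"
    by (auto simp: two_edge_paths_def)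
  have "closed (two_edge_paths s t)"
    unfolding eq cross_def by (intro closed_Int closed_Collect_le continuous_intros)
  moreover have "bounded (two_edge_paths s t)"
    unfolding bounded_iff using two_edge_paths_norm[OF _ assms] by blast
  ultimately show ?thesis by (simp add: compact_eq_bounded_closed)
qed

lemma chain_to_two_edges:
  assumes st: "lo \<le> s" "s < t" "t \<le> hi" and "sum_list es = g t - g s"
    and "sorted_wrt (\<lambda>e f. 0 \<le> cross e f) es" "\<And>e. e \<in> set es \<Longrightarrow> edge_between s t e"
  obtains u where "u \<in> two_edge_paths s t"
    "chain_value l p es < chain_value l p [u, g t - g s - u] \<or>
     chain_value l p es = chain_value l p [u, g t - g s - u] \<and> 0 < cross x u \<and> 0 < cross x (g t - g s - u) \<and>
       (\<forall>e\<in>set es. cross e u = 0 \<or> cross e (g t - g s - u) = 0)"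
proof -
  define fs where "fs = filter (\<lambda>e. e \<noteq> 0) es"
  have sum: "sum_list fs = g t - g s" by (simp add: fs_def sum_list_filter_nonzero assms)
  have "g t - g s \<noteq> 0" using edge_and_normals(1)[of s t] st by auto
  then have "fs \<noteq> []" using sum by auto
  moreover have "sorted_wrt (\<lambda>e f. 0 \<le> cross e f) fs" unfolding fs_def using assms by (intro sorted_wrt_filter)
  moreover have fs: "0 < cross x e \<and> 0 \<le> cross (tangent s) e \<and> 0 \<le> cross e (tangent t)" if "e \<in> set fs" for e
    using that assms(6)[of e] by (auto simp: fs_def edge_between_def)
  ultimately obtain u w where uw: "u + w = g t - g s" "0 \<le> cross u w" "0 < cross x u" "0 < cross x w"
    and conic: "\<And>n. (\<forall>e\<in>set fs. 0 \<le> inner n e) \<Longrightarrow> 0 \<le> inner n u \<and> 0 \<le> inner n w"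
    and val: "chain_value l p fs < chain_value l p [u, w] \<or>
     chain_value l p fs = chain_value l p [u, w] \<and> (\<forall>e\<in>set fs. cross e u = 0 \<or> cross e w = 0)"
    using convex_chain_two_edges[of fs x l p] sum by metis
  have w: "g t - g s - u = w" using uw(1) by (simp add: algebra_simps)
  have "0 \<le> inner (- normal s) u \<and> 0 \<le> inner (- normal s) w"
    using fs by (intro conic) (auto simp: cross_tangent)
  moreover have "0 \<le> inner (normal t) u \<and> 0 \<le> inner (normal t) w"
    using fs by (intro conic) (auto simp: cross_tangent)
  ultimately have "u \<in> two_edge_paths s t"
    using uw w by (auto simp: two_edge_paths_def cross_tangent)
  moreover have "chain_value l p fs = chain_value l p es" by (simp add: fs_def chain_value_filter_nonzero)
  moreover have "\<forall>e\<in>set es. cross e u = 0 \<or> cross e w = 0" if "\<forall>e\<in>set fs. cross e u = 0 \<or> cross e w = 0"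
    using that by (auto simp: fs_def)
  ultimately show thesis using val uw w by (intro that[of u]) (auto simp del: chain_value.simps)
qed

text \<open>Inscribed chains and \<open>chain_to_two_edges\<close> give this up to any \<open>\<epsilon>\<close>; by compactness one chain
  serves for all \<open>\<epsilon>\<close>.\<close>

lemma arc_value_le_two_edges:
  assumes st: "lo \<le> s" "s < t" "t \<le> hi" and l: "0 \<le> l"
  obtains u where "u \<in> two_edge_paths s t"
    "arc_value l g s t \<le> chain_value l (g s) [u, g t - g s - u]"
proof -
  define F where "F u = chain_value l (g s) [u, g t - g s - u]" for u
  have approx: "\<exists>u\<in>two_edge_paths s t. arc_value l g s t - \<epsilon> < F u" if eps: "0 < \<epsilon>" for \<epsilon>
  proof -
    obtain n y where sub: "subdivision s t n y"
      and val: "arc_value l g s t - \<epsilon> < chain_value l (g s) (map (\<lambda>i. g (y (Suc i)) - g (y i)) [0..<n])"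
      using inscribed_chain[of s t l \<epsilon>] st window l eps by auto
    define e where "e i = g (y (Suc i)) - g (y i)" for i
    have eb: "edge_between (y i) (y (Suc i)) (e i)" if "i < n" for i
      unfolding e_def using subdivision_range[OF sub, of i] subdivision_range[OF sub, of "Suc i"]
        subdivision_mono[OF sub, of i "Suc i"] that st by (intro edge_between_boundary) auto
    have "sorted_wrt (\<lambda>e f. 0 \<le> cross e f) (map e [0..<n])"
      unfolding sorted_wrt_iff_nth_less
    proof (intro allI impI)
      fix i j assume ij: "i < j" "j < length (map e [0..<n])"
      have "0 \<le> cross (e i) (e j)"
        using eb[of i] eb[of j] ij subdivision_range[OF sub, of "Suc i"] subdivision_range[OF sub, of j]
          subdivision_mono[OF sub, of "Suc i" j] st
        by (intro edge_between_cross[of "y i" "y (Suc i)" "e i" "y j" "y (Suc j)" "e j"]) auto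
      then show "0 \<le> cross (map e [0..<n] ! i) (map e [0..<n] ! j)" using ij by simp
    qed
    moreover have "edge_between s t f" if "f \<in> set (map e [0..<n])" for f
    proof -
      obtain i where i: "i < n" "f = e i" using \<open>f \<in> set (map e [0..<n])\<close> by auto
      show ?thesis
        unfolding i(2) using subdivision_range[OF sub, of i] subdivision_range[OF sub, of "Suc i"]
          subdivision_mono[OF sub, of i "Suc i"] i(1) st eb[OF i(1)]
        by (intro edge_between_mono[of "y i" "y (Suc i)" "e i" s t]) auto
    qed
    moreover have "sum_list (map e [0..<n]) = g t - g s"
      using sum_list_telescope[of "\<lambda>i. g (y i)" n] sub by (simp add: e_def[abs_def] subdivision_def)
    ultimately obtain u where "u \<in> two_edge_paths s t" "chain_value l (g s) (map e [0..<n]) \<le> F u"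
      using chain_to_two_edges[OF st, of "map e [0..<n]" l "g s"] unfolding F_def by (metis less_imp_le order_refl)
    then show ?thesis using val unfolding e_def by force
  qed
  then have "two_edge_paths s t \<noteq> {}" using zero_less_one by blast
  moreover have "continuous_on (two_edge_paths s t) F"
    unfolding F_def cross_def chain_value.simps by (intro continuous_intros)
  ultimately have "\<exists>u\<in>two_edge_paths s t. \<forall>v\<in>two_edge_paths s t. F v \<le> F u"
    using st by (intro continuous_attains_sup compact_two_edge_paths) auto
  then obtain u where u: "u \<in> two_edge_paths s t" "\<And>v. v \<in> two_edge_paths s t \<Longrightarrow> F v \<le> F u"
    by blast
  have "arc_value l g s t \<le> F u + \<epsilon>" if "0 < \<epsilon>" for \<epsilon>
    using approx[OF that] u(2) by fastforce
  then have "arc_value l g s t \<le> F u" by (rule field_le_epsilon)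
  then show thesis using u(1) that unfolding F_def by blast
qed

text \<open>Otherwise the boundary turns strictly between the arcs from \<open>t1\<close> to \<open>t2\<close> and from \<open>t3\<close> to \<open>t4\<close>, on both
  sides of the middle arc. Concatenating optimal two-edge chains of the three arcs yields a chain that
  is at least as good as the whole arc and has edges in three directions, so a two-edge chain is strictly
  better, against minimality.\<close>

lemma three_arcs:
  assumes opt: "\<And>M. M \<in> convex_ring_class a b \<Longrightarrow> J l K \<le> J l M" and l: "0 \<le> l"
    and ord: "lo \<le> t1" "t1 < t2" "t2 < t3" "t3 < t4" "t4 \<le> hi"
  shows "inner (normal t2) (g t1) = inner (normal t2) (g t2) \<or> inner (normal t3) (g t4) = inner (normal t3) (g t3)"
proof (rule ccontr)
  assume "\<not> ?thesis"
  then have strict: "0 < inner (normal t2) (g t2 - g t1)" "inner (normal t3) (g t4 - g t3) < 0"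
    using normal(2)[OF g_in_body, of t2 t1] normal(2)[OF g_in_body, of t3 t4] by (auto simp: inner_diff_right)
  obtain u1 where u1: "u1 \<in> two_edge_paths t1 t2"
    "arc_value l g t1 t2 \<le> chain_value l (g t1) [u1, g t2 - g t1 - u1]"
    using arc_value_le_two_edges[of t1 t2 l] ord l by auto
  obtain u2 where u2: "u2 \<in> two_edge_paths t2 t3"
    "arc_value l g t2 t3 \<le> chain_value l (g t2) [u2, g t3 - g t2 - u2]"
    using arc_value_le_two_edges[of t2 t3 l] ord l by auto
  obtain u3 where u3: "u3 \<in> two_edge_paths t3 t4"
    "arc_value l g t3 t4 \<le> chain_value l (g t3) [u3, g t4 - g t3 - u3]"
    using arc_value_le_two_edges[of t3 t4 l] ord l by auto
  define w1 w2 w3 where "w1 = g t2 - g t1 - u1" and "w2 = g t3 - g t2 - u2" and "w3 = g t4 - g t3 - u3"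
  define es where "es = [u1, w1, u2, w2, u3, w3]"
  have eb: "edge_between t1 t2 u1" "edge_between t1 t2 w1" "edge_between t2 t3 u2" "edge_between t2 t3 w2"
    "edge_between t3 t4 u3" "edge_between t3 t4 w3" and uw: "0 \<le> cross u1 w1" "0 \<le> cross u2 w2" "0 \<le> cross u3 w3"
    using two_edge_paths_edges[OF u1(1)] two_edge_paths_edges[OF u2(1)] two_edge_paths_edges[OF u3(1)] ord
    by (auto simp: w1_def w2_def w3_def)
  have c12: "0 \<le> cross e f" if "edge_between t1 t2 e" "edge_between t2 t3 f" for e f
    using edge_between_cross[OF that] ord by auto
  have c13: "0 \<le> cross e f" if "edge_between t1 t2 e" "edge_between t3 t4 f" for e f
    using edge_between_cross[OF that] ord by auto
  have c23: "0 \<le> cross e f" if "edge_between t2 t3 e" "edge_between t3 t4 f" for e f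
    using edge_between_cross[OF that] ord by auto
  have sorted: "sorted_wrt (\<lambda>e f. 0 \<le> cross e f) es"
    using eb uw c12 c13 c23 by (simp add: es_def)
  have all: "edge_between t1 t4 e" if "e \<in> set es" for e
    using that eb edge_between_mono[of t1 t2 _ t1 t4] edge_between_mono[of t2 t3 _ t1 t4]
      edge_between_mono[of t3 t4 _ t1 t4] ord by (auto simp: es_def)
  have sum: "sum_list es = g t4 - g t1" by (simp add: es_def w1_def w2_def w3_def)
  have "arc_value l g t1 t4 = arc_value l g t1 t2 + arc_value l g t2 t4"
    using ord window pi_gt_zero by (intro arc_value_add) linarith+
  moreover have "arc_value l g t2 t4 = arc_value l g t2 t3 + arc_value l g t3 t4"
    using ord window pi_gt_zero by (intro arc_value_add) linarith+
  moreover have "chain_value l (g t1) es = chain_value l (g t1) [u1, w1] + chain_value l (g t2) [u2, w2]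
      + chain_value l (g t3) [u3, w3]"
    by (simp add: es_def w1_def w2_def w3_def)
  ultimately have le: "arc_value l g t1 t4 \<le> chain_value l (g t1) es"
    using u1(2) u2(2) u3(2) unfolding w1_def w2_def w3_def by linarith
  have ord14: "lo \<le> t1" "t1 < t4" "t4 \<le> hi" using ord by auto
  obtain u where u: "u \<in> two_edge_paths t1 t4"
    and val: "chain_value l (g t1) es < chain_value l (g t1) [u, g t4 - g t1 - u] \<or>
     chain_value l (g t1) es = chain_value l (g t1) [u, g t4 - g t1 - u] \<and> 0 < cross x u \<and> 0 < cross x (g t4 - g t1 - u) \<and>
       (\<forall>e\<in>set es. cross e u = 0 \<or> cross e (g t4 - g t1 - u) = 0)"
    using chain_to_two_edges[OF ord14 sum sorted all] by metis
  \<comment> \<open>Three edges \<open>e\<close>, \<open>f\<close>, \<open>h\<close>, one from each arc, with pairwise different directions.\<close>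
  obtain e where e: "e \<in> {u1, w1}" "0 < inner (normal t2) e"
  proof -
    have "0 < inner (normal t2) u1 \<or> 0 < inner (normal t2) w1"
      using strict(1) by (auto simp: w1_def inner_diff_right)
    then show thesis using that by blast
  qed
  obtain f where f: "f \<in> {u2, w2}" "f \<noteq> 0"
  proof -
    have "g t3 - g t2 \<noteq> 0" using edge_and_normals(1)[of t2 t3] ord by auto
    then have "u2 \<noteq> 0 \<or> w2 \<noteq> 0" by (auto simp: w2_def)
    then show thesis using that by blast
  qed
  obtain h where h: "h \<in> {u3, w3}" "inner (normal t3) h < 0"
  proof -
    have "inner (normal t3) u3 < 0 \<or> inner (normal t3) w3 < 0"
      using strict(2) by (auto simp: w3_def inner_diff_right)
    then show thesis using that by blast
  qed
  have in_es: "e \<in> set es" "f \<in> set es" "h \<in> set es" using e f h by (auto simp: es_def)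
  have "e \<noteq> 0" "h \<noteq> 0" using e h by auto
  then have xpos: "0 < cross x e" "0 < cross x f" "0 < cross x h"
    using all in_es f by (auto simp: edge_between_def)
  have ef: "0 < cross e f"
    using e f eb xpos ord tangent_pos
    by (intro cross_trans_strict[of x e "tangent t2" f]) (auto simp: cross_tangent edge_between_def)
  have fh: "0 < cross f h"
    using h f eb xpos ord tangent_pos
    by (intro cross_trans_strict[of x f "tangent t3" h]) (auto simp: cross_tangent edge_between_def)
  have eh: "0 < cross e h" using cross_trans_strict[of x e f h] xpos ef fh by auto
  have "chain_value l (g t1) es < chain_value l (g t1) [u, g t4 - g t1 - u]"
  proof (rule ccontr)
    assume "\<not> ?thesis"
    with val have u': "0 < cross x u" "0 < cross x (g t4 - g t1 - u)"
      and par: "\<forall>e\<in>set es. cross e u = 0 \<or> cross e (g t4 - g t1 - u) = 0" by auto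
    \<comment> \<open>Two of the three edges would be parallel to the same edge of the new chain.\<close>
    have trans: "cross c d = 0" if "0 < cross x k" "cross c k = 0" "cross d k = 0" for c d k
      using cross_cyclic_value[of c d x k] that cross_commute[of d k] by simp
    show False
      using par in_es trans[OF u'(1)] trans[OF u'(2)] ef fh eh by (metis less_irrefl)
  qed
  then have gt: "arc_value l g t1 t4 < chain_value l (g t1) [u, g t4 - g t1 - u]" using le by simp
  have eb14: "\<And>k. k \<in> set es \<Longrightarrow> inner (normal t1) k \<le> 0" "\<And>k. k \<in> set es \<Longrightarrow> 0 \<le> inner (normal t4) k"
    using all by (auto simp: edge_between_def cross_tangent)
  have f1: "inner (normal t1) f < 0"
    using cross_trans_strict[of x "tangent t1" e f] xpos ef in_es all[of e] ord tangent_pos[of t1]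
    by (auto simp: edge_between_def cross_tangent)
  have f4: "0 < inner (normal t4) f"
    using cross_trans_strict[of x f h "tangent t4"] xpos fh in_es all[of h] ord tangent_pos[of t4]
    by (auto simp: edge_between_def cross_tangent)
  have k1: "inner (normal t1) u1 \<le> 0" "inner (normal t1) w1 \<le> 0" "inner (normal t1) u2 \<le> 0"
    "inner (normal t1) w2 \<le> 0" "inner (normal t1) u3 \<le> 0" "inner (normal t1) w3 \<le> 0"
    using eb14(1) by (auto simp: es_def)
  have k4: "0 \<le> inner (normal t4) u1" "0 \<le> inner (normal t4) w1" "0 \<le> inner (normal t4) u2"
    "0 \<le> inner (normal t4) w2" "0 \<le> inner (normal t4) u3" "0 \<le> inner (normal t4) w3"
    using eb14(2) by (auto simp: es_def)
  have g41: "g t4 - g t1 = u1 + w1 + u2 + w2 + u3 + w3" by (simp add: w1_def w2_def w3_def)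
  have "inner (normal t1) (g t4 - g t1) < 0" unfolding g41 inner_add_right
    using f(1) f1 k1 by auto
  then have n1: "inner (normal t1) (g t4) < inner (normal t1) (g t1)" by (simp add: inner_diff_right)
  have "0 < inner (normal t4) (g t4 - g t1)" unfolding g41 inner_add_right
    using f(1) f4 k4 by auto
  then have n4: "inner (normal t4) (g t1) < inner (normal t4) (g t4)" by (simp add: inner_diff_right)
  have nearx: "norm (g t1 - x) \<le> \<delta>" "norm (g t4 - x) \<le> \<delta>" using near ord by auto
  have T: "0 \<le> cross (tangent t1) u" "0 \<le> cross (g t4 - g t1 - u) (tangent t4)" "0 \<le> cross u (g t4 - g t1 - u)"
    using u by (auto simp: two_edge_paths_def)
  have "chain_value l (g t1) [g t1 + u - g t1, g t4 - (g t1 + u)] \<le> arc_value l g t1 t4"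
  proof (rule two_edge_comparison[OF opt])
    show "- 2 * pi \<le> t1" "t1 \<le> 2 * pi" "t1 < t4" "t4 < t1 + pi" using ord window by auto
    show "inner (normal t1) y \<le> inner (normal t1) (g t1)" "inner (normal t4) y \<le> inner (normal t4) (g t4)" if "y \<in> K" for y
      using normal(2) that by auto
    have w: "norm (g t4 - g t1) \<le> 2 * \<delta>"
      using nearx norm_triangle_ineq4[of "g t4 - x" "g t1 - x"] by simp
    have "norm u \<le> norm (g t4 - g t1) * (1 + 2 * b / a)"
      using two_edge_paths_norm[OF u] ord by simp
    also have "\<dots> \<le> 2 * \<delta> * (1 + 2 * b / a)"
      using w a_pos radial_pos[of 0] radial_le[of 0] by (intro mult_right_mono) auto
    finally have "norm u \<le> 2 * \<delta> * (1 + 2 * b / a)" .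
    moreover have "norm (g t1 + u) \<le> norm x + norm (g t1 - x) + norm u"
      using norm_triangle_ineq[of "x + (g t1 - x)" u] norm_triangle_ineq[of x "g t1 - x"] by simp
    ultimately have "norm (g t1 + u) \<le> norm x + (\<delta> + 2 * \<delta> * (1 + 2 * b / a))" using nearx by linarith
    also have "\<delta> + 2 * \<delta> * (1 + 2 * b / a) = \<delta> * (3 + 4 * b / a)" using a_pos by (simp add: field_simps)
    finally show "norm (g t1 + u) \<le> b" using small(4) by linarith
    show "inner (normal t1) (g t1 + u) \<le> inner (normal t1) (g t1)"
      using T(1) by (simp add: cross_tangent inner_add_right)
    show "inner (normal t4) (g t1 + u) \<le> inner (normal t4) (g t4)"
      using T(2) by (simp add: cross_tangent inner_add_right inner_diff_right)
    show "0 \<le> cross (g t1 + u - g t1) (g t4 - g t1)"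
      using T(3) by (simp add: cross_diff_right)
    fix z assume "z \<in> closed_segment (g t1) (g t4)"
    moreover have "closed_segment (g t1) (g t4) \<subseteq> cball x \<delta>"
      using nearx by (intro closed_segment_subset) (auto simp: dist_norm norm_minus_commute)
    ultimately have "norm (x - z) \<le> \<delta>" by (auto simp: dist_norm)
    then show "a \<le> norm z" using norm_triangle_ineq2[of x z] small(3) by linarith
  qed (use n1 n4 in auto)
  moreover have "g t1 + u - g t1 = u" "g t4 - (g t1 + u) = g t4 - g t1 - u" by (simp_all add: algebra_simps)
  ultimately show False using gt by simp
qed

end

section \<open>Faces of a minimizer\<close>

lemma common_support_lines_eq:
  fixes n m :: complex
  assumes "norm n = 1" "norm m = 1" "y \<noteq> z" "inner n y = inner n z" "inner m y = inner m z"
    and "0 < inner n z" "0 < inner m z"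
  shows "n = m"
proof -
  have decomp: "y - z = cross k (y - z) *\<^sub>R (\<i> * k)" if "norm k = 1" "inner k y = inner k z" for k :: complex
  proof -
    have "inner k k *\<^sub>R (y - z) = inner k (y - z) *\<^sub>R k + cross k (y - z) *\<^sub>R (\<i> * k)"
      by (rule orthogonal_decomposition)
    then show ?thesis using that by (simp add: dot_square_norm inner_diff_right)
  qed
  define c d where "c = cross n (y - z)" and "d = cross m (y - z)"
  have eqs: "y - z = c *\<^sub>R (\<i> * n)" "y - z = d *\<^sub>R (\<i> * m)"
    using decomp[of n] decomp[of m] assms by (auto simp: c_def d_def)
  have "c \<noteq> 0" using eqs(1) assms(3) by auto
  have "\<i> * (c *\<^sub>R n) = \<i> * (d *\<^sub>R m)" using eqs by (metis mult_scaleR_right)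
  then have cd: "c *\<^sub>R n = d *\<^sub>R m" by (metis complex_i_not_zero mult_left_cancel)
  then have "c * inner n z = d * inner m z" by (metis inner_scaleR_left)
  then have "c * d > 0" using assms(6,7) \<open>c \<noteq> 0\<close>
    by (metis mult_eq_0_iff mult_less_0_iff not_less_iff_gr_or_eq zero_less_mult_iff)
  moreover have "\<bar>c\<bar> = \<bar>d\<bar>" using arg_cong[OF cd, of norm] assms(1,2) by simp
  ultimately have "c = d" by (auto simp: abs_if zero_less_mult_iff split: if_splits)
  then show ?thesis using cd \<open>c \<noteq> 0\<close> by simp
qed

text \<open>Moving the vertex \<open>y\<close> of a two-edge chain by \<open>f\<close> and by \<open>- f\<close> changes the area by opposite amounts, while
  the sum of the two lengths increases strictly unless both edges are parallel to \<open>f\<close>.\<close>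

lemma chain_value_strict_convex:
  assumes "chain_value l p [y + f - p, q - (y + f)] \<le> chain_value l p [y - p, q - y]"
    and "chain_value l p [y - f - p, q - (y - f)] \<le> chain_value l p [y - p, q - y]"
  shows "cross f (y - p) = 0 \<and> cross f (q - y) = 0"
proof -
  have conv: "2 * norm v \<le> norm (v + f) + norm (v - f)" for v
    using norm_triangle_ineq[of "v + f" "v - f"] by (simp flip: mult_2)
  have strict: "2 * norm v < norm (v + f) + norm (v - f)" if "cross f v \<noteq> 0" for v
  proof -
    have "cross (v + f) (v - f) = 2 * cross f v" by (simp add: cross_def algebra_simps)
    then have "norm ((1/2) *\<^sub>R (v + f) + (1/2) *\<^sub>R (v - f)) < 1/2 * norm (v + f) + 1/2 * norm (v - f)"
      using that by (intro norm_convex_strict) auto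
    moreover have "(1/2) *\<^sub>R (v + f) + (1/2) *\<^sub>R (v - f) = v"
      by (simp add: complex_eq_iff field_simps)
    ultimately show ?thesis by simp
  qed
  have val: "chain_value l p [v - p, q - v] = norm (v - p) + norm (q - v) - l / 2 * (cross p v + cross v q)" for v
    by (simp add: cross_bilinear algebra_simps)
  have "norm (y - p + f) + norm (q - y - f) + norm (y - p - f) + norm (q - y + f)
      \<le> 2 * norm (y - p) + 2 * norm (q - y)"
  proof -
    have "y + f - p = y - p + f" "q - (y + f) = q - y - f" "y - f - p = y - p - f" "q - (y - f) = q - y + f"
      by (simp_all add: algebra_simps)
    then show ?thesis
      using assms unfolding val by (simp add: cross_bilinear algebra_simps)
  qed
  then show ?thesis
    using conv[of "y - p"] conv[of "q - y"] strict[of "y - p"] strict[of "q - y"] by argo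
qed

context ring_body begin

text \<open>The line \<open>inner n y = h\<close> is a supporting line of \<open>K\<close> once \<open>face n h\<close> is nonempty.\<close>

definition supports :: "complex \<Rightarrow> real \<Rightarrow> bool" where
  "supports n h \<longleftrightarrow> norm n = 1 \<and> (\<forall>y\<in>K. inner n y \<le> h)"

definition face :: "complex \<Rightarrow> real \<Rightarrow> complex set" where
  "face n h = {y \<in> K. inner n y = h}"

lemma supports_ge: "supports n h \<Longrightarrow> a \<le> h"
proof -
  assume n: "supports n h"
  then have "a *\<^sub>R n \<in> K" using inner_disc a_pos by (auto simp: supports_def)
  then have "inner n (a *\<^sub>R n) \<le> h" using n by (auto simp: supports_def)
  then show ?thesis using n by (simp add: supports_def dot_square_norm)
qed

lemma segment_in_face:
  assumes "supports n h" "y \<in> face n h" "z \<in> face n h"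
  shows "closed_segment y z \<subseteq> face n h" "closed_segment y z \<subseteq> frontier K"
proof -
  have "convex (face n h)"
  proof -
    have "face n h = K \<inter> {y. inner n y = h}" by (auto simp: face_def)
    then show ?thesis using convex_Int[OF convex_body convex_hyperplane] by simp
  qed
  then show "closed_segment y z \<subseteq> face n h" using assms by (simp add: closed_segment_subset)
  show "closed_segment y z \<subseteq> frontier K"
    using assms by (intro segment_frontier[of y z n h]) (auto simp: supports_def face_def)
qed

text \<open>A supporting line at the midpoint of a boundary segment contains the whole segment.\<close>

lemma frontier_segment_in_face:
  assumes "closed_segment y z \<subseteq> frontier K"
  obtains n h where "supports n h" "y \<in> face n h" "z \<in> face n h"
proof -
  have "midpoint y z \<in> frontier K" using assms midpoint_in_closed_segment by blast
  then obtain n where n: "norm n = 1" "\<And>x. x \<in> K \<Longrightarrow> inner n x \<le> inner n (midpoint y z)"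
    using support_normal by metis
  have yz: "y \<in> K" "z \<in> K" using assms frontier_subset_body by auto
  have "inner n (midpoint y z) = (inner n y + inner n z) / 2"
    by (simp add: midpoint_def inner_add_right)
  then have "inner n y = inner n (midpoint y z)" "inner n z = inner n (midpoint y z)"
    using n(2)[OF yz(1)] n(2)[OF yz(2)] by auto
  then show thesis using that[of n "inner n (midpoint y z)"] n yz by (auto simp: supports_def face_def)
qed

lemma face_decomp:
  assumes "supports n h" "y \<in> face n h"
  shows "y = h *\<^sub>R n + cross n y *\<^sub>R (\<i> * n)"
proof -
  have "inner n n *\<^sub>R y = inner n y *\<^sub>R n + cross n y *\<^sub>R (\<i> * n)"
    by (rule orthogonal_decomposition)
  then show ?thesis using assms by (simp add: supports_def face_def dot_square_norm)
qed

lemma face_segment: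
  assumes n: "supports n h" and ne: "face n h \<noteq> {}"
  obtains y z where "face n h = closed_segment y z" "y \<in> face n h" "z \<in> face n h"
proof -
  have "face n h = K \<inter> {y. inner n y = h}" by (auto simp: face_def)
  then have comp: "compact (face n h)" by (simp add: compact_body compact_Int_closed closed_hyperplane)
  have cont: "continuous_on (face n h) (cross n)" unfolding cross_def by (intro continuous_intros)
  obtain y where y: "y \<in> face n h" "\<And>x. x \<in> face n h \<Longrightarrow> cross n y \<le> cross n x"
    using continuous_attains_inf[OF comp ne cont] by auto
  obtain z where z: "z \<in> face n h" "\<And>x. x \<in> face n h \<Longrightarrow> cross n x \<le> cross n z"
    using continuous_attains_sup[OF comp ne cont] by auto
  have "x \<in> closed_segment y z" if x: "x \<in> face n h" for x
  proof -
    have le: "cross n y \<le> cross n x" "cross n x \<le> cross n z" using x y z by auto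
    then have "cross n x \<in> closed_segment (cross n y) (cross n z)" by (auto simp: closed_segment_eq_real_ivl)
    then obtain u where u: "0 \<le> u" "u \<le> 1" "cross n x = (1 - u) * cross n y + u * cross n z"
      by (auto simp: in_segment)
    define cx cy cz where "cx = cross n x" and "cy = cross n y" and "cz = cross n z"
    have "x = h *\<^sub>R n + cx *\<^sub>R (\<i> * n)" "y = h *\<^sub>R n + cy *\<^sub>R (\<i> * n)" "z = h *\<^sub>R n + cz *\<^sub>R (\<i> * n)"
      using face_decomp[OF n] x y z by (auto simp: cx_def cy_def cz_def)
    moreover have "cx = (1 - u) * cy + u * cz" using u(3) by (simp add: cx_def cy_def cz_def)
    ultimately have "x = (1 - u) *\<^sub>R y + u *\<^sub>R z"
      by (simp only:) (simp add: algebra_simps)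
    then show ?thesis using u by (auto simp: in_segment)
  qed
  then have "face n h = closed_segment y z" using segment_in_face(1)[OF n y(1) z(1)] by blast
  then show thesis using that y z by blast
qed

lemma face_inj:
  assumes "supports n h" "supports m k" "y \<in> face n h" "z \<in> face n h" "y \<in> face m k" "z \<in> face m k" "y \<noteq> z"
  shows "n = m"
  using common_support_lines_eq[of n m y z] assms supports_ge[OF assms(1)] supports_ge[OF assms(2)] a_pos
  by (auto simp: supports_def face_def)

lemma angles_of_cross_pos:
  assumes "p \<in> frontier K" "q \<in> frontier K" "0 < cross p q"
  obtains s t where "0 \<le> s" "s \<le> 2 * pi" "s < t" "t < s + pi" "p = g s" "q = g t"
proof -
  obtain s where s: "0 \<le> s" "s \<le> 2 * pi" "p = g s" using assms(1) frontier_eq by auto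
  obtain t' where t': "0 \<le> t'" "t' \<le> 2 * pi" "q = g t'" using assms(2) frontier_eq by auto
  obtain t where t: "s \<le> t" "t \<le> s + 2 * pi" "q = g t"
  proof (cases "s \<le> t'")
    case True
    then show ?thesis using that[of t'] t' s by auto
  next
    case False
    then show ?thesis using that[of "t' + 2 * pi"] t' s g_periodic[of t'] by auto
  qed
  have sin: "0 < sin (t - s)"
    using assms(3) by (simp add: s(3) t(3) cross_g_sign)
  then have "t \<noteq> s" by auto
  moreover have "t - s < pi"
  proof (rule ccontr)
    assume "\<not> t - s < pi"
    moreover have "t - s \<noteq> 2 * pi" using sin by auto
    ultimately have "sin (t - s) \<le> 0" using t by (intro sin_le_zero) auto
    then show False using sin by simp
  qed
  ultimately show thesis using that[of s t] s t by auto
qed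

end

locale minimizer = ring_body +
  fixes l :: real
  assumes l_nonneg: "0 \<le> l" and optimal: "\<And>M. M \<in> convex_ring_class a b \<Longrightarrow> J l K \<le> J l M"
begin

text \<open>Were there no segment ending at \<open>z\<close> on one side, \<open>three_arcs\<close> would make all arcs on this side
  straight that end before \<open>z\<close>; as the boundary is closed, so would be the arc that ends at \<open>z\<close>.\<close>

lemma adjacent_segments:
  assumes z: "z \<in> frontier K" "a < norm z" "norm z < b"
  obtains p q where "closed_segment p z \<subseteq> frontier K" "closed_segment z q \<subseteq> frontier K"
    "0 < cross p z" "0 < cross z q"
proof -
  obtain t0 where t0: "0 \<le> t0" "t0 < 2 * pi" "z = g t0"
  proof -
    obtain u where u: "0 \<le> u" "u \<le> 2 * pi" "z = g u" using z frontier_eq by auto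
    then show thesis using that[of u] that[of 0] g_periodic[of 0] by (cases "u = 2 * pi") auto
  qed
  have b_pos: "0 < b" using z a_pos by linarith
  define \<delta> where "\<delta> = min (a / 4) (min (norm z - a) ((b - norm z) / (3 + 4 * b / a)))"
  have D: "0 < 3 + 4 * b / a" using a_pos b_pos by (simp add: add_pos_pos)
  have \<delta>: "0 < \<delta>" "\<delta> \<le> a / 4" "\<delta> \<le> norm z - a" "\<delta> \<le> (b - norm z) / (3 + 4 * b / a)"
    using a_pos z D unfolding \<delta>_def min_less_iff_conj min_le_iff_disj by auto
  define C where "C = b * b / a + b"
  have C: "0 < C" using a_pos b_pos by (simp add: C_def add_pos_pos)
  define \<eta> where "\<eta> = min (pi / 4) (min (2 * pi - t0) (\<delta> / C))"
  have \<eta>: "0 < \<eta>" "\<eta> \<le> pi / 4" "\<eta> \<le> 2 * pi - t0" "\<eta> \<le> \<delta> / C"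
    using t0(1,2) \<delta>(1) C unfolding \<eta>_def min_less_iff_conj min_le_iff_disj by auto
  define lo hi where "lo = t0 - \<eta>" and "hi = t0 + \<eta>"
  interpret arc_window a b K z lo hi \<delta>
  proof
    show "hi < lo + pi" "- 2 * pi \<le> lo" "hi \<le> 2 * pi" using \<eta> t0 pi_gt_zero by (auto simp: lo_def hi_def)
    show "\<delta> * (3 + 4 * b / a) \<le> b - norm z" using \<delta>(4) D by (simp add: pos_le_divide_eq)
    fix u assume u: "lo \<le> u" "u \<le> hi"
    have "norm (g u - z) \<le> C * \<bar>u - t0\<bar>" using lipschitz[of u t0] by (simp add: t0 dist_norm C_def)
    also have "\<dots> \<le> C * (\<delta> / C)" using u \<eta> C by (intro mult_left_mono) (auto simp: lo_def hi_def)
    also have "\<dots> = \<delta>" using C by simp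
    finally show "norm (g u - z) \<le> \<delta>" .
  qed (use \<delta> in auto)
  have seg: "closed_segment (g u) (g v) \<subseteq> frontier K"
    if "inner (normal u) (g v) = inner (normal u) (g u) \<or> inner (normal v) (g u) = inner (normal v) (g v)" for u v
    using that
  proof
    assume "inner (normal u) (g v) = inner (normal u) (g u)"
    then show ?thesis using normal(1)[of u] normal(2)[of _ u]
      by (intro segment_frontier[of _ _ "normal u" "inner (normal u) (g u)"] g_in_body) auto
  next
    assume "inner (normal v) (g u) = inner (normal v) (g v)"
    then show ?thesis using normal(1)[of v] normal(2)[of _ v]
      by (intro segment_frontier[of _ _ "normal v" "inner (normal v) (g v)"] g_in_body) auto
  qed
  have limit: "closed_segment (g u) (g t0) \<subseteq> frontier K"
    if S: "\<And>v. v \<in> S \<Longrightarrow> closed_segment (g u) (g v) \<subseteq> frontier K" and cl: "t0 \<in> closure S" for u S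
  proof
    fix y assume "y \<in> closed_segment (g u) (g t0)"
    then obtain k where k: "0 \<le> k" "k \<le> 1" "y = (1 - k) *\<^sub>R g u + k *\<^sub>R g t0" by (auto simp: in_segment)
    have "(\<lambda>v. (1 - k) *\<^sub>R g u + k *\<^sub>R g v) ` closure S \<subseteq> frontier K"
    proof (rule image_closure_subset)
      show "continuous_on (closure S) (\<lambda>v. (1 - k) *\<^sub>R g u + k *\<^sub>R g v)"
        by (intro continuous_intros continuous_g)
      show "(\<lambda>v. (1 - k) *\<^sub>R g u + k *\<^sub>R g v) ` S \<subseteq> frontier K"
        using S k by (force simp: in_segment)
    qed auto
    then show "y \<in> frontier K" using cl k(3) by blast
  qed
  have cross_pos: "0 < cross (g u) (g v)" if "lo \<le> u" "u < v" "v \<le> hi" for u v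
    using that window by (intro cross_g_pos) auto
  have bounds: "lo < t0" "t0 < hi" using \<eta> by (auto simp: lo_def hi_def)
  have side: "\<exists>u\<in>closed_segment c t0 - {t0}. closed_segment (g u) z \<subseteq> frontier K" if c: "c = lo \<or> c = hi" for c
  proof (rule ccontr)
    assume no: "\<not> ?thesis"
    have "closed_segment (g c) (g v) \<subseteq> frontier K" if v: "v \<in> open_segment c t0" for v
    proof -
      define w where "w = (v + t0) / 2"
      have "w \<in> closed_segment c t0 - {t0}"
        using v by (auto simp: w_def open_segment_eq_real_ivl closed_segment_eq_real_ivl split: if_splits)
      then have "inner (normal w) (g t0) \<noteq> inner (normal w) (g w)"
        using no seg[of w t0] t0(3) by blast
      then show ?thesis
        using three_arcs[OF optimal l_nonneg, of lo v w t0] three_arcs[OF optimal l_nonneg, of t0 w v hi]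
          c v bounds seg[of c v] by (auto simp: w_def open_segment_eq_real_ivl)
    qed
    moreover have "t0 \<in> closure (open_segment c t0)" using bounds c by auto
    ultimately have "closed_segment (g c) z \<subseteq> frontier K" using limit t0(3) by blast
    then show False using no bounds c by auto
  qed
  obtain u v where "u \<in> closed_segment lo t0 - {t0}" "v \<in> closed_segment hi t0 - {t0}"
    and segs: "closed_segment (g u) z \<subseteq> frontier K" "closed_segment (g v) z \<subseteq> frontier K"
    using side[of lo] side[of hi] by blast
  then have uv: "lo \<le> u" "u < t0" "t0 < v" "v \<le> hi"
    using bounds by (auto simp: closed_segment_eq_real_ivl split: if_splits)
  show thesis
    using that[of "g u" "g v"] uv segs cross_pos[of u t0] cross_pos[of t0 v] bounds t0(3)
    by (simp add: closed_segment_commute)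
qed

text \<open>There are boundary segments on both sides of \<open>z\<close>, and the face cannot contain both of them
  because it ends at \<open>z\<close>.\<close>

lemma second_face_at_vertex:
  assumes n: "supports n h" and face: "face n h = closed_segment z y" and z: "a < norm z" "norm z < b"
  obtains m k w where "supports m k" "z \<in> face m k" "w \<in> face m k" "w \<noteq> z" "m \<noteq> n"
proof -
  have zf: "z \<in> face n h" using face by simp
  then have "z \<in> frontier K" using segment_in_face(2)[OF n zf zf] by simp
  then obtain p q where pq: "closed_segment p z \<subseteq> frontier K" "closed_segment z q \<subseteq> frontier K"
    and c: "0 < cross p z" "0 < cross z q" using adjacent_segments z by metis
  have pqz: "p \<noteq> z" "q \<noteq> z" using c by auto
  have "\<not> (p \<in> face n h \<and> q \<in> face n h)"
  proof
    assume "p \<in> face n h \<and> q \<in> face n h"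
    then obtain u v where u: "0 \<le> u" "p = (1 - u) *\<^sub>R z + u *\<^sub>R y" and v: "0 \<le> v" "q = (1 - v) *\<^sub>R z + v *\<^sub>R y"
      unfolding face by (auto simp: in_segment)
    have "cross p z = - u * cross z y" "cross z q = v * cross z y"
      unfolding u(2) v(2) by (simp_all add: cross_bilinear cross_commute[of y z])
    then have "0 < - (u * cross z y)" "0 < v * cross z y" using c by auto
    then show False using u(1) v(1) by (auto simp: zero_less_mult_iff mult_less_0_iff)
  qed
  then obtain w where w: "w \<notin> face n h" "w \<noteq> z" "closed_segment z w \<subseteq> frontier K"
    using pq pqz closed_segment_commute by metis
  obtain m k where "supports m k" "z \<in> face m k" "w \<in> face m k"
    using frontier_segment_in_face[OF w(3)] by metis
  then show thesis using that w
    by (metis (mono_tags, lifting) face_def mem_Collect_eq zf)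
qed

text \<open>Suppose the face keeps away from the inner disc. Let \<open>w\<close> be a point of the second face
  at \<open>y\<close>. Moving \<open>y\<close> a little in either direction along the line through \<open>w\<close> and \<open>y\<close> is admissible: at a
  point \<open>x\<close> between \<open>w\<close> and \<open>y\<close> the angle does not change, and at \<open>z\<close> there is a supporting line other
  than the line of the face, because the face ends there. By strict convexity one of the two moves
  decreases \<open>J l\<close>.\<close>

lemma free_vertex_touches:
  assumes n: "supports n h" and face: "face n h = closed_segment y z" and "y \<noteq> z"
    and y: "a < norm y" "norm y < b"
  shows "\<exists>T\<in>face n h. norm T \<le> a"
proof (rule ccontr)
  assume "\<not> ?thesis"
  then have far: "a < norm T" if "T \<in> face n h" for T using that by force
  have yf: "y \<in> face n h" and zf: "z \<in> face n h" using face by auto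
  have h: "a \<le> h" using supports_ge[OF n] .
  obtain m k w where m: "supports m k" "y \<in> face m k" "w \<in> face m k" "w \<noteq> y" "m \<noteq> n"
    using second_face_at_vertex[OF n face y] .
  have k: "a \<le> k" using supports_ge[OF m(1)] .
  \<comment> \<open>A supporting line at \<open>z\<close> that does not contain \<open>y\<close>: the tangent of the outer circle or the line of
    the second face at \<open>z\<close>.\<close>
  obtain r where r: "\<And>x. x \<in> K \<Longrightarrow> inner r x \<le> inner r z" "inner r y < inner r z"
  proof (cases "norm z = b")
    case True
    have "inner z x \<le> inner z z" if "x \<in> K" for x
    proof -
      have "inner z x \<le> norm z * norm x" by (rule norm_cauchy_schwarz)
      also have "\<dots> \<le> norm z * norm z" using that outer_disc True by (intro mult_left_mono) auto
      finally show ?thesis by (simp add: dot_square_norm power2_eq_square)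
    qed
    moreover have "inner z y < inner z z"
    proof -
      have "inner z y \<le> norm z * norm y" by (rule norm_cauchy_schwarz)
      also have "\<dots> < norm z * norm z" using y True a_pos by (intro mult_strict_left_mono) auto
      finally show ?thesis by (simp add: dot_square_norm power2_eq_square)
    qed
    ultimately show thesis using that by blast
  next
    case False
    then have "norm z < b" using zf outer_disc by (force simp: face_def)
    moreover have "face n h = closed_segment z y" using face by (simp add: closed_segment_commute)
    ultimately obtain r j w' where r: "supports r j" "z \<in> face r j" "w' \<in> face r j" "w' \<noteq> z" "r \<noteq> n"
      using second_face_at_vertex[OF n _ far[OF zf]] by metis
    have "y \<notin> face r j" using face_inj[OF n r(1) yf zf _ r(2)] \<open>y \<noteq> z\<close> r(5) by auto
    then have "inner r y < inner r z" using r yf by (force simp: supports_def face_def)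
    then show thesis using that[of r] r by (auto simp: supports_def face_def)
  qed
  define f where "f = y - w"
  have nf: "0 < inner n f"
  proof -
    have "w \<notin> face n h" using face_inj[OF n m(1) _ yf m(3,2)] m(4,5) by auto
    then show ?thesis using n m(3) yf by (force simp: f_def supports_def face_def inner_diff_right)
  qed
  have mf: "inner m f = 0" using m by (simp add: f_def face_def inner_diff_right)
  have mz: "inner m z < k"
  proof -
    have "z \<notin> face m k" using face_inj[OF n m(1) yf zf m(2)] \<open>y \<noteq> z\<close> m(5) by auto
    then show ?thesis using m(1) zf by (force simp: supports_def face_def)
  qed
  \<comment> \<open>The sign of \<open>\<beta>\<close> is the orientation: for positive \<open>\<beta>\<close>, \<open>z\<close> follows \<open>y\<close> counterclockwise.\<close>
  define \<beta> where "\<beta> = cross n z - cross n y"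
  have zy: "z - y = \<beta> *\<^sub>R (\<i> * n)"
    using face_decomp[OF n zf] face_decomp[OF n yf] by (simp add: \<beta>_def scaleR_diff_left) (metis add_diff_cancel_left)
  have cross_zy: "cross e (z - y) = \<beta> * inner n e" for e
    by (simp add: zy) (simp add: cross_def inner_complex_def algebra_simps)
  have \<beta>: "\<beta> \<noteq> 0" using zy \<open>y \<noteq> z\<close> by auto
  have cyz: "cross y z = \<beta> * h"
    using cross_zy[of y] yf by (simp add: cross_diff_right face_def)
  have cyz': "0 < \<beta> * cross y z"
  proof -
    have "0 < \<beta> * \<beta>" using \<beta> by (auto simp: zero_less_mult_iff linorder_neq_iff)
    moreover have "0 < h" using h a_pos by simp
    ultimately show ?thesis unfolding cyz mult.assoc[symmetric] by (rule mult_pos_pos)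
  qed
  have cfy: "0 < \<beta> * cross y f"
  proof -
    \<comment> \<open>Seen from the second face, \<open>z\<close> lies on the inner side; seen from the face, so does \<open>w\<close>. Hence
      the chain from \<open>w\<close> over \<open>y\<close> to \<open>z\<close> runs around \<open>0\<close> in one sense.\<close>
    obtain \<phi> where \<phi>: "f = \<phi> *\<^sub>R (\<i> * m)"
    proof -
      have "inner m m *\<^sub>R f = inner m f *\<^sub>R m + cross m f *\<^sub>R (\<i> * m)"
        by (rule orthogonal_decomposition)
      then have "f = cross m f *\<^sub>R (\<i> * m)" using mf m(1) by (simp add: supports_def dot_square_norm)
      then show thesis using that by blast
    qed
    have "inner m (z - y) < 0" using mz m(2) by (simp add: face_def inner_diff_right)
    then have "\<beta> * cross m n > 0" unfolding zy by (simp add: inner_complex_def cross_def algebra_simps)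
    moreover have "\<phi> * cross m n > 0"
      using nf unfolding \<phi> by (simp add: inner_complex_def cross_def algebra_simps)
    ultimately have "0 < \<beta> * \<phi>" by (auto simp: zero_less_mult_iff)
    moreover have "cross y f = \<phi> * inner m y"
      unfolding \<phi> by (simp add: inner_complex_def cross_def algebra_simps)
    then have "cross y f = \<phi> * k" using m(2) by (simp add: face_def)
    ultimately show ?thesis using k a_pos by (simp add: mult.assoc[symmetric])
  qed
  obtain d where d: "a < d" "\<And>T. T \<in> face n h \<Longrightarrow> d \<le> norm T"
  proof -
    have "\<exists>x\<in>closed_segment y z. \<forall>T\<in>closed_segment y z. norm x \<le> norm T"
      by (intro continuous_attains_inf continuous_intros) auto
    then show thesis using that far face by metis
  qed
  have "\<forall>\<^sub>F \<epsilon> in at_right 0. 0 < \<epsilon> \<and> \<epsilon> < 1 \<and> norm (y + \<epsilon> *\<^sub>R f) < b \<and> norm (y - \<epsilon> *\<^sub>R f) < b \<and>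
      inner r (y + \<epsilon> *\<^sub>R f) < inner r z \<and> inner r (y - \<epsilon> *\<^sub>R f) < inner r z \<and>
      a < d - \<epsilon> * norm f \<and> 0 < \<beta> * cross (y - \<epsilon> *\<^sub>R f) z"
  proof (intro eventually_conj)
    have ev: "\<forall>\<^sub>F \<epsilon> in at_right 0. F \<epsilon> < c" if "continuous_on UNIV F" "F 0 < c" for F :: "real \<Rightarrow> real" and c
    proof -
      have "(F \<longlongrightarrow> F 0) (at_right 0)"
        using that(1) by (metis UNIV_I continuous_on_def filterlim_at_split tendsto_within_subset top_greatest)
      then show ?thesis using that(2) by (rule order_tendstoD)
    qed
    show "\<forall>\<^sub>F \<epsilon> in at_right 0. (0::real) < \<epsilon>" by (rule eventually_at_right_less)
    show "\<forall>\<^sub>F \<epsilon> in at_right 0. (\<epsilon>::real) < 1" by (rule ev) (auto intro: continuous_intros)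
    show "\<forall>\<^sub>F \<epsilon> in at_right 0. norm (y + \<epsilon> *\<^sub>R f) < b" using y by (intro ev continuous_intros) auto
    show "\<forall>\<^sub>F \<epsilon> in at_right 0. norm (y - \<epsilon> *\<^sub>R f) < b" using y by (intro ev continuous_intros) auto
    show "\<forall>\<^sub>F \<epsilon> in at_right 0. inner r (y + \<epsilon> *\<^sub>R f) < inner r z" using r(2) by (intro ev continuous_intros) auto
    show "\<forall>\<^sub>F \<epsilon> in at_right 0. inner r (y - \<epsilon> *\<^sub>R f) < inner r z" using r(2) by (intro ev continuous_intros) auto
    have "\<forall>\<^sub>F \<epsilon> in at_right 0. \<epsilon> * norm f - d < - a" using d(1) by (intro ev continuous_intros) auto
    then show "\<forall>\<^sub>F \<epsilon> in at_right 0. a < d - \<epsilon> * norm f" by (rule eventually_mono) linarith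
    have "\<forall>\<^sub>F \<epsilon> in at_right 0. - (\<beta> * cross (y - \<epsilon> *\<^sub>R f) z) < 0"
      unfolding cross_def using cyz' by (intro ev continuous_intros) (auto simp: cross_def)
    then show "\<forall>\<^sub>F \<epsilon> in at_right 0. 0 < \<beta> * cross (y - \<epsilon> *\<^sub>R f) z" by simp
  qed
  then obtain \<epsilon> where \<epsilon>: "0 < \<epsilon>" "\<epsilon> < 1" "norm (y + \<epsilon> *\<^sub>R f) < b" "norm (y - \<epsilon> *\<^sub>R f) < b"
      "inner r (y + \<epsilon> *\<^sub>R f) < inner r z" "inner r (y - \<epsilon> *\<^sub>R f) < inner r z"
      "a < d - \<epsilon> * norm f" "0 < \<beta> * cross (y - \<epsilon> *\<^sub>R f) z"
    using eventually_happens'[OF trivial_limit_at_right_real] by blast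
  define x where "x = y - \<epsilon> *\<^sub>R f"
  have x_seg: "x \<in> closed_segment y w"
    using \<epsilon> unfolding in_segment by (intro exI[of _ \<epsilon>]) (auto simp: x_def f_def algebra_simps)
  have xf: "x \<in> face m k" using segment_in_face(1)[OF m(1-3)] x_seg by blast
  have segs: "closed_segment x y \<subseteq> frontier K" "closed_segment y z \<subseteq> frontier K"
    using segment_in_face(2)[OF m(1) xf m(2)] segment_in_face(2)[OF n yf zf] by auto
  have chord: "a \<le> norm c" if c: "c \<in> closed_segment x z" for c
  proof -
    obtain u where u: "0 \<le> u" "u \<le> 1" "c = (1 - u) *\<^sub>R x + u *\<^sub>R z" using c by (auto simp: in_segment)
    let ?c = "(1 - u) *\<^sub>R y + u *\<^sub>R z"
    have "?c \<in> face n h" unfolding face using u by (auto simp: in_segment)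
    then have "d \<le> norm ?c" by (rule d)
    moreover have "?c - c = ((1 - u) * \<epsilon>) *\<^sub>R f" by (simp add: u(3) x_def algebra_simps)
    then have "norm (?c - c) = ((1 - u) * \<epsilon>) * norm f" using u \<epsilon> by simp
    moreover have "((1 - u) * \<epsilon>) * norm f \<le> \<epsilon> * norm f" using u \<epsilon> by (intro mult_right_mono) (auto simp: mult_left_le_one_le)
    moreover have "norm ?c - norm c \<le> norm (?c - c)" by (rule norm_triangle_ineq2)
    ultimately show ?thesis using \<epsilon>(7) by linarith
  qed
  have mK: "inner m v \<le> inner m x" if "v \<in> K" for v
    using m(1) xf that by (auto simp: supports_def face_def)
  have mzx: "inner m z < inner m x" using mz xf by (simp add: face_def)
  have rx: "inner r x < inner r z" using \<epsilon>(6) by (simp add: x_def)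
  \<comment> \<open>Half of the distance from \<open>y\<close> to \<open>x\<close>, so that the moved vertex stays beyond the chord from \<open>x\<close> to \<open>z\<close>.\<close>
  define c where "c = \<epsilon> / 2"
  have moves: "norm (y + s *\<^sub>R (c *\<^sub>R f)) \<le> b" "inner m (y + s *\<^sub>R (c *\<^sub>R f)) \<le> inner m x" "inner r (y + s *\<^sub>R (c *\<^sub>R f)) \<le> inner r z"
    "0 \<le> \<beta> * cross (y + s *\<^sub>R (c *\<^sub>R f) - x) (z - x)" if s: "s = 1 \<or> s = -1" for s
  proof -
    have in_seg: "y + s *\<^sub>R (c *\<^sub>R f) \<in> closed_segment (y - \<epsilon> *\<^sub>R f) (y + \<epsilon> *\<^sub>R f)"
      using s \<epsilon>(1) unfolding in_segment
      by (intro exI[of _ "(1 + s / 2) / 2"]) (auto simp: c_def complex_eq_iff field_simps)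
    have "closed_segment (y - \<epsilon> *\<^sub>R f) (y + \<epsilon> *\<^sub>R f) \<subseteq> cball 0 b"
      using \<epsilon> by (intro closed_segment_subset) auto
    then show "norm (y + s *\<^sub>R (c *\<^sub>R f)) \<le> b" using in_seg by auto
    have "closed_segment (y - \<epsilon> *\<^sub>R f) (y + \<epsilon> *\<^sub>R f) \<subseteq> {v. inner r v \<le> inner r z}"
      using \<epsilon> by (intro closed_segment_subset convex_halfspace_le) auto
    then show "inner r (y + s *\<^sub>R (c *\<^sub>R f)) \<le> inner r z" using in_seg by auto
    show "inner m (y + s *\<^sub>R (c *\<^sub>R f)) \<le> inner m x"
      using mf by (simp add: x_def inner_add_right inner_diff_right)
    have "cross (y + s *\<^sub>R (c *\<^sub>R f) - x) (z - x) = (s * c + \<epsilon>) * cross f (z - y)"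
      by (simp add: x_def cross_bilinear algebra_simps)
    also have "\<dots> = (s * c + \<epsilon>) * (\<beta> * inner n f)" by (simp only: cross_zy)
    finally have eq: "\<beta> * cross (y + s *\<^sub>R (c *\<^sub>R f) - x) (z - x) = (\<beta> * \<beta>) * ((s * c + \<epsilon>) * inner n f)"
      by simp
    have "0 \<le> s * c + \<epsilon>" using s \<epsilon>(1) by (auto simp: c_def)
    then show "0 \<le> \<beta> * cross (y + s *\<^sub>R (c *\<^sub>R f) - x) (z - x)"
      unfolding eq using nf by (intro mult_nonneg_nonneg[OF zero_le_square]) auto
  qed
  have not0: "cross (c *\<^sub>R f) (z - y) \<noteq> 0" "cross (c *\<^sub>R f) (y - z) \<noteq> 0"
    using nf \<beta> \<epsilon>(1) cross_zy[of f] by (auto simp: c_def cross_diff_right)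
  have xF: "x \<in> frontier K" and zF: "z \<in> frontier K" using segs by auto
  have cxy: "0 < \<beta> * cross x y"
  proof -
    have "\<beta> * cross x y = \<epsilon> * (\<beta> * cross y f)"
      by (simp add: x_def cross_bilinear cross_commute[of f y])
    then show ?thesis by (simp only: mult_pos_pos[OF \<epsilon>(1) cfy])
  qed
  have minus: "y + (- 1) *\<^sub>R (c *\<^sub>R f) = y - c *\<^sub>R f" "y + 1 *\<^sub>R (c *\<^sub>R f) = y + c *\<^sub>R f" by simp_all
  show False
  proof (cases "\<beta> > 0")
    case True
    then have pos: "0 < cross x z" "0 \<le> cross x y" "0 \<le> cross y z"
      using \<epsilon>(8) cxy cyz' by (auto simp: x_def zero_less_mult_iff)
    obtain s t where st: "0 \<le> s" "s \<le> 2 * pi" "s < t" "t < s + pi" "x = g s" "z = g t"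
      using angles_of_cross_pos[OF xF zF pos(1)] .
    have val: "arc_value l g s t = chain_value l x [y - x, z - y]"
      using arc_value_two_edges[OF st(3,4), of y l] pos segs st(5,6) by simp
    have comp: "chain_value l x [y + e *\<^sub>R (c *\<^sub>R f) - x, z - (y + e *\<^sub>R (c *\<^sub>R f))] \<le> arc_value l g s t" if "e = 1 \<or> e = -1" for e
    proof (rule two_edge_comparison[OF optimal _ st(2,3,4,5,6) mK mzx r(1) rx])
      show "0 \<le> cross (y + e *\<^sub>R (c *\<^sub>R f) - x) (z - x)" using moves(4)[OF that] True by (simp add: zero_le_mult_iff)
    qed (use moves[OF that] chord st in auto)
    have "cross (c *\<^sub>R f) (y - x) = 0 \<and> cross (c *\<^sub>R f) (z - y) = 0"
      using comp[of 1] comp[of "-1"] unfolding val minus by (intro chain_value_strict_convex[of l x]) auto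
    then show False using not0 by simp
  next
    case False
    then have neg: "\<beta> < 0" using \<beta> by simp
    then have "0 > cross x z" "0 > cross x y" "0 > cross y z"
      using \<epsilon>(8) cxy cyz' by (auto simp: x_def zero_less_mult_iff)
    then have pos: "0 < cross z x" "0 \<le> cross y x" "0 \<le> cross z y"
      using cross_commute[of z x] cross_commute[of y x] cross_commute[of z y] by auto
    obtain s t where st: "0 \<le> s" "s \<le> 2 * pi" "s < t" "t < s + pi" "z = g s" "x = g t"
      using angles_of_cross_pos[OF zF xF pos(1)] .
    have val: "arc_value l g s t = chain_value l z [y - z, x - y]"
      using arc_value_two_edges[OF st(3,4), of y l] pos segs st(5,6) by (simp add: closed_segment_commute)
    have comp: "chain_value l z [y + e *\<^sub>R (c *\<^sub>R f) - z, x - (y + e *\<^sub>R (c *\<^sub>R f))] \<le> arc_value l g s t" if "e = 1 \<or> e = -1" for e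
    proof (rule two_edge_comparison[OF optimal _ st(2,3,4,5,6) r(1) rx mK mzx])
      have "cross (y + e *\<^sub>R (c *\<^sub>R f) - x) (z - x) \<le> 0" using moves(4)[OF that] neg by (simp add: zero_le_mult_iff)
      then show "0 \<le> cross (y + e *\<^sub>R (c *\<^sub>R f) - z) (x - z)"
        by (simp add: cross_def algebra_simps)
    qed (use moves[OF that] chord st in \<open>auto simp: closed_segment_commute\<close>)
    have "cross (c *\<^sub>R f) (y - z) = 0 \<and> cross (c *\<^sub>R f) (x - y) = 0"
      using comp[of 1] comp[of "-1"] unfolding val minus by (intro chain_value_strict_convex[of l z]) auto
    then show False using not0 by simp
  qed
qed

end

section \<open>The decomposition\<close>

abbreviation boundary_pieces :: "real \<Rightarrow> real \<Rightarrow> complex set \<Rightarrow> complex set set" where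
  "boundary_pieces a b \<Omega> \<equiv> tangent_chord_halves a b \<Omega> \<union> tangent_portions a b \<Omega> \<union> chord_halves a b \<Omega>"

context ring_body begin

text \<open>The distance of \<open>0\<close> from the supporting line is at least \<open>a\<close>, so a face meets the inner disc at most in the
  foot of the perpendicular from \<open>0\<close>.\<close>

lemma contact_point:
  assumes "supports n h" "T \<in> face n h" "norm T \<le> a"
  shows "h = a" "T = h *\<^sub>R n" "norm T = a"
proof -
  have n: "norm n = 1" "inner n T = h" using assms by (auto simp: supports_def face_def)
  have "h \<le> norm T" using norm_cauchy_schwarz[of n T] n by simp
  then show h: "h = a" and T: "norm T = a" using supports_ge[OF assms(1)] assms(3) by auto
  have "norm (T - h *\<^sub>R n) ^ 2 = norm T ^ 2 - 2 * h * inner n T + h ^ 2 * norm n ^ 2"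
    unfolding power2_norm_eq_inner
    by (simp add: inner_diff_left inner_diff_right inner_commute[of T n] power2_eq_square algebra_simps)
  also have "\<dots> = 0" using n h T by (simp add: power2_eq_square)
  finally show "T = h *\<^sub>R n" by simp
qed

lemma tangent_at_face:
  assumes "supports n h" "T \<in> face n h" "norm T \<le> a" "S \<subseteq> face n h" "T \<in> S"
  shows "tangent_at a T S"
  unfolding tangent_at_def
proof (intro conjI ballI)
  fix x assume "x \<in> S"
  then have "inner n x = h" "inner n T = h" using assms by (auto simp: face_def)
  then show "inner T (x - T) = 0"
    using contact_point[OF assms(1-3)] by (metis inner_diff_right inner_scaleR_left mult_zero_right diff_self)
qed (use contact_point[OF assms(1-3)] assms in auto)

lemma norm_face:
  assumes "supports n h" "y \<in> face n h"
  shows "norm y ^ 2 = h ^ 2 + cross n y ^ 2"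
proof -
  define c where "c = cross n y"
  have y: "y = h *\<^sub>R n + c *\<^sub>R (\<i> * n)" using face_decomp[OF assms] by (simp add: c_def)
  have "Re n ^ 2 + Im n ^ 2 = 1" using assms(1) by (simp add: supports_def cmod_def)
  moreover have "norm y ^ 2 = (h ^ 2 + c ^ 2) * (Re n ^ 2 + Im n ^ 2)"
    unfolding y by (simp add: cmod_power2) (simp add: power2_eq_square algebra_simps)
  ultimately show ?thesis by (simp add: c_def)
qed

text \<open>The foot \<open>h *\<^sub>R n\<close> of the perpendicular from \<open>0\<close> is inside the open outer disc, so a point strictly between
  it and a point of the body has norm less than \<open>b\<close>.\<close>

lemma sphere_endpoint:
  assumes n: "supports n h" and e: "e \<in> face n h" "e \<noteq> h *\<^sub>R n" "norm e = b"
    and y: "y \<in> face n h" "e \<in> closed_segment (h *\<^sub>R n) y"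
  shows "y = e"
proof (rule ccontr)
  assume "y \<noteq> e"
  obtain u where u: "0 \<le> u" "u \<le> 1" "e = (1 - u) *\<^sub>R (h *\<^sub>R n) + u *\<^sub>R y" using y(2) by (auto simp: in_segment)
  have u1: "u < 1" using u \<open>y \<noteq> e\<close> by (cases "u = 1") auto
  have n1: "norm n = 1" using n by (simp add: supports_def)
  have "cross n e \<noteq> 0" using face_decomp[OF n e(1)] e(2) by auto
  then have "h ^ 2 < b ^ 2" using norm_face[OF n e(1)] e(3) by simp
  then have hb: "h < b" using radial_pos[of 0] radial_le[of 0] by (auto intro: power2_less_imp_less)
  have "norm y \<le> b" using y outer_disc by (auto simp: face_def)
  have "b \<le> norm ((1 - u) *\<^sub>R (h *\<^sub>R n)) + norm (u *\<^sub>R y)"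
    using norm_triangle_ineq[of "(1 - u) *\<^sub>R (h *\<^sub>R n)" "u *\<^sub>R y"] u(3) e(3) by simp
  also have "\<dots> = (1 - u) * h + u * norm y" using u n1 supports_ge[OF n] a_pos by simp
  also have "\<dots> < (1 - u) * b + u * b"
    using u u1 hb \<open>norm y \<le> b\<close> by (intro add_less_le_mono mult_strict_left_mono mult_left_mono) auto
  finally show False by (simp add: algebra_simps)
qed

text \<open>The common form of all three classes: from the point of the supporting line closest to \<open>0\<close> to
  an end of the face. For the tangent segments that point is the point of contact, for chords it is the
  midpoint. In the second class, the mate of the segment is what forces the common vertex to be an
  end of the face.\<close>

lemma piece_is_half_face:
  assumes ab: "a < b" and X: "X \<in> boundary_pieces a b K"
  obtains n h e where "supports n h" "h *\<^sub>R n \<in> face n h" "e \<in> face n h" "e \<noteq> h *\<^sub>R n"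
    "X = closed_segment (h *\<^sub>R n) e" "\<And>y. y \<in> face n h \<Longrightarrow> e \<in> closed_segment (h *\<^sub>R n) y \<Longrightarrow> y = e"
proof -
  consider (half) "X \<in> tangent_chord_halves a b K" | (portion) "X \<in> tangent_portions a b K"
    | (chord) "X \<in> chord_halves a b K" using X by blast
  then show thesis
  proof cases
    case half
    then obtain P T where X: "X = closed_segment P T" "norm P = b" "tangent_at a T (closed_segment P T)"
      "closed_segment P T \<subseteq> frontier K" by (auto simp: tangent_chord_halves_def)
    obtain n h where n: "supports n h" "P \<in> face n h" "T \<in> face n h" using frontier_segment_in_face[OF X(4)] .
    have T: "h = a" "T = h *\<^sub>R n" "norm T = a"
      using contact_point[OF n(1,3)] X(3) by (auto simp: tangent_at_def)
    have "P \<noteq> h *\<^sub>R n" using T X(2) ab by auto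
    then show thesis using that[OF n(1), of P] n T X sphere_endpoint[OF n(1,2) _ X(2)]
      by (simp add: closed_segment_commute)
  next
    case portion
    then obtain P V Q where X: "X = closed_segment P V" "tangent_at a P (closed_segment P V)"
      "closed_segment P V \<subseteq> frontier K" and Q: "Q \<noteq> P" "tangent_at a Q (closed_segment V Q)" "closed_segment V Q \<subseteq> frontier K"
      by (auto simp: tangent_portions_def)
    obtain n h where n: "supports n h" "P \<in> face n h" "V \<in> face n h" using frontier_segment_in_face[OF X(3)] .
    obtain m k where m: "supports m k" "V \<in> face m k" "Q \<in> face m k" using frontier_segment_in_face[OF Q(3)] .
    have P: "h = a" "P = h *\<^sub>R n" "norm P = a" using contact_point[OF n(1,2)] X(2) by (auto simp: tangent_at_def)
    have Q': "k = a" "Q = k *\<^sub>R m" using contact_point[OF m(1,3)] Q(2) by (auto simp: tangent_at_def)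
    have Pm: "P \<notin> face m k" using contact_point(2)[OF m(1) _ eq_refl[OF P(3)]] Q' Q(1) by auto
    have "V \<noteq> h *\<^sub>R n" using Pm m(2) P(2) by auto
    moreover have "y = V" if y: "y \<in> face n h" "V \<in> closed_segment (h *\<^sub>R n) y" for y
    proof (rule ccontr)
      assume "y \<noteq> V"
      obtain u where u: "0 \<le> u" "u \<le> 1" "V = (1 - u) *\<^sub>R P + u *\<^sub>R y" using y(2) P(2) by (auto simp: in_segment)
      have u1: "u < 1" using u \<open>y \<noteq> V\<close> by (cases "u = 1") auto
      have "inner m P < k" using m(1) Pm n(2) by (force simp: supports_def face_def)
      moreover have "inner m y \<le> k" using m(1) y(1) by (auto simp: supports_def face_def)
      ultimately have "(1 - u) * inner m P + u * inner m y < (1 - u) * k + u * k"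
        using u u1 by (intro add_less_le_mono mult_strict_left_mono mult_left_mono) auto
      moreover have "inner m V = k" using m by (simp add: face_def)
      ultimately show False using u(3) by (simp add: inner_add_right algebra_simps)
    qed
    ultimately show thesis using that[OF n(1), of V] n P X(1) by simp
  next
    case chord
    then obtain P Q where X: "X = closed_segment P (midpoint P Q)" "norm P = b" "norm Q = b" "P \<noteq> Q"
      "closed_segment P Q \<subseteq> frontier K" by (auto simp: chord_halves_def)
    obtain n h where n: "supports n h" "P \<in> face n h" "Q \<in> face n h" using frontier_segment_in_face[OF X(5)] .
    have eq: "P = h *\<^sub>R n + cross n P *\<^sub>R (\<i> * n)" "Q = h *\<^sub>R n + cross n Q *\<^sub>R (\<i> * n)"
      using face_decomp n by auto
    have "cross n P ^ 2 = cross n Q ^ 2" using norm_face[OF n(1,2)] norm_face[OF n(1,3)] X by simp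
    moreover have "cross n P \<noteq> cross n Q" using eq X(4) by metis
    ultimately have "cross n Q = - cross n P" by (auto simp: power2_eq_iff)
    then have "P + Q = 2 *\<^sub>R (h *\<^sub>R n)" using arg_cong2[OF eq, of "(+)"] unfolding scaleR_2 by simp
    then have mid: "midpoint P Q = h *\<^sub>R n" by (simp add: midpoint_def)
    have "midpoint P Q \<in> face n h"
      using segment_in_face(1)[OF n] midpoint_in_closed_segment by blast
    moreover have "P \<noteq> midpoint P Q" using X(4) midpoint_eq_endpoint(1)[of P Q] by metis
    ultimately show thesis using that[OF n(1), of P] n X(1) mid sphere_endpoint[OF n(1,2) _ X(2)]
      by (simp add: closed_segment_commute)
  qed
qed

lemma piece_infinite:
  assumes "a < b" "X \<in> boundary_pieces a b K"
  shows "infinite X"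
  using piece_is_half_face[OF assms] by (metis finite_closed_segment)

lemma piece_frontier:
  assumes "a < b" "X \<in> boundary_pieces a b K"
  shows "X \<subseteq> frontier K"
proof -
  obtain n h e where "supports n h" "h *\<^sub>R n \<in> face n h" "e \<in> face n h" "X = closed_segment (h *\<^sub>R n) e"
    using piece_is_half_face[OF assms] by metis
  then show ?thesis using segment_in_face(2) by metis
qed

lemma closed_segment_nested:
  fixes c :: "'a::real_vector"
  assumes "u \<noteq> c" "u \<in> closed_segment c d" "u \<in> closed_segment c e"
  shows "d \<in> closed_segment c e \<or> e \<in> closed_segment c d"
proof -
  have "\<exists>r\<ge>0. r \<le> 1 \<and> u - c = r *\<^sub>R (v - c)" if "u \<in> closed_segment c v" for v
    using that by (auto simp: in_segment algebra_simps)
  then obtain r s where r: "0 \<le> r" "r \<le> 1" "u - c = r *\<^sub>R (d - c)" and s: "0 \<le> s" "s \<le> 1" "u - c = s *\<^sub>R (e - c)"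
    using assms by metis
  have pos: "0 < r" "0 < s" using r s assms(1) by (auto simp: less_le)
  have *: "v \<in> closed_segment c w" if v: "0 < k" "k \<le> j" "j *\<^sub>R (v - c) = k *\<^sub>R (w - c)" for k j :: real and v w :: 'a
  proof -
    have "(1 / j) *\<^sub>R (j *\<^sub>R (v - c)) = (1 / j) *\<^sub>R (k *\<^sub>R (w - c))" using v(3) by simp
    then have "v - c = (k / j) *\<^sub>R (w - c)" using v(1,2) by simp
    then have "v = (1 - k / j) *\<^sub>R c + (k / j) *\<^sub>R w" by (simp add: algebra_simps)
    then show ?thesis using v by (auto simp: in_segment intro!: exI[of _ "k / j"])
  qed
  show ?thesis using *[of s r d e] *[of r s e d] r s pos by (metis linear)
qed

text \<open>Two common points force the same face, and then, as both pieces start at the same point and reach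
  an end of the face, equality.\<close>

lemma pieces_meet_at_most_once:
  assumes ab: "a < b" and X: "X \<in> boundary_pieces a b K" and Y: "Y \<in> boundary_pieces a b K" and "X \<noteq> Y"
  shows "finite (X \<inter> Y)"
proof -
  obtain n h e where n: "supports n h" "h *\<^sub>R n \<in> face n h" "e \<in> face n h"
    "X = closed_segment (h *\<^sub>R n) e" and end_e: "\<And>y. y \<in> face n h \<Longrightarrow> e \<in> closed_segment (h *\<^sub>R n) y \<Longrightarrow> y = e"
    using piece_is_half_face[OF ab X] by metis
  obtain m k d where m: "supports m k" "k *\<^sub>R m \<in> face m k" "d \<in> face m k"
    "Y = closed_segment (k *\<^sub>R m) d" and end_d: "\<And>y. y \<in> face m k \<Longrightarrow> d \<in> closed_segment (k *\<^sub>R m) y \<Longrightarrow> y = d"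
    using piece_is_half_face[OF ab Y] by metis
  have Xf: "X \<subseteq> face n h" and Yf: "Y \<subseteq> face m k"
    using segment_in_face(1)[OF n(1-3)] segment_in_face(1)[OF m(1-3)] n m by auto
  have "u = v" if uv: "u \<in> X \<inter> Y" "v \<in> X \<inter> Y" for u v
  proof (rule ccontr)
    assume "u \<noteq> v"
    have "u \<in> face n h" "v \<in> face n h" "u \<in> face m k" "v \<in> face m k" using uv Xf Yf by auto
    then have nm: "n = m" "h = k" using face_inj[OF n(1) m(1), of u v] \<open>u \<noteq> v\<close> by (auto simp: face_def)
    obtain w where "w \<in> X \<inter> Y" "w \<noteq> h *\<^sub>R n" using uv \<open>u \<noteq> v\<close> by metis
    then have "e \<in> closed_segment (h *\<^sub>R n) d \<or> d \<in> closed_segment (h *\<^sub>R n) e"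
      using closed_segment_nested[of w "h *\<^sub>R n" e d] n(4) m(4) nm by auto
    then have "e = d" using end_e[of d] end_d[of e] n m nm by auto
    then show False using n(4) m(4) nm \<open>X \<noteq> Y\<close> by simp
  qed
  then have "X \<inter> Y \<subseteq> {SOME u. u \<in> X \<inter> Y}" by (metis insertI1 someI subsetI)
  then show ?thesis using finite_subset by blast
qed

lemma piece_sphere_finite:
  assumes "a < b" "X \<in> boundary_pieces a b K"
  shows "finite (X \<inter> sphere 0 r)"
proof -
  obtain n h e where n: "supports n h" "h *\<^sub>R n \<in> face n h" "e \<in> face n h"
    "X = closed_segment (h *\<^sub>R n) e" using piece_is_half_face[OF assms] by metis
  have "X \<inter> sphere 0 r \<subseteq> (\<lambda>s. h *\<^sub>R n + s *\<^sub>R (\<i> * n)) ` {sqrt (r\<^sup>2 - h\<^sup>2), - sqrt (r\<^sup>2 - h\<^sup>2)}"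
  proof
    fix y assume y: "y \<in> X \<inter> sphere 0 r"
    then have yf: "y \<in> face n h" using segment_in_face(1)[OF n(1-3)] n(4) by auto
    have "cross n y ^ 2 = r\<^sup>2 - h\<^sup>2" using norm_face[OF n(1) yf] y by simp
    then have "cross n y = sqrt (r\<^sup>2 - h\<^sup>2) \<or> cross n y = - sqrt (r\<^sup>2 - h\<^sup>2)"
      by (metis power2_eq_iff real_sqrt_pow2 zero_le_power2)
    then show "y \<in> (\<lambda>s. h *\<^sub>R n + s *\<^sub>R (\<i> * n)) ` {sqrt (r\<^sup>2 - h\<^sup>2), - sqrt (r\<^sup>2 - h\<^sup>2)}"
      using face_decomp[OF n(1) yf] by (metis image_eqI insertCI)
  qed
  then show ?thesis by (rule finite_subset) simp
qed

text \<open>Components are taken among the angles and not on the circle, because there they are intervals.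
  A contact arc through the angle \<open>0\<close> is thereby cut in two; the two parts share one point.\<close>

definition contact_angles :: "real \<Rightarrow> real set" where
  "contact_angles r = {u \<in> {0..2*pi}. norm (g u) = r}"

definition contact_arcs :: "real \<Rightarrow> complex set set" where
  "contact_arcs r = (`) g ` components (contact_angles r)"

lemma contact_component:
  assumes "C \<in> components (contact_angles r)"
  obtains s t where "0 \<le> s" "s \<le> t" "t \<le> 2 * pi" "C = {s..t}"
proof -
  have eq: "contact_angles r = {0..2*pi} \<inter> ((\<lambda>u. norm (g u)) -` {r} \<inter> UNIV)"
    by (auto simp: contact_angles_def)
  have "closed ((\<lambda>u. norm (g u)) -` {r} \<inter> UNIV)"
    by (intro continuous_on_closed_vimage[THEN iffD1, rule_format] continuous_intros continuous_g closed_UNIV)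
  then have "compact (contact_angles r)" unfolding eq by (intro compact_Int_closed) auto
  then have "compact C" by (rule compact_components) (rule assms)
  moreover have "connected C" using assms by (rule in_components_connected)
  ultimately obtain s t where st: "C = {s..t}" using connected_compact_interval_1[of C] by auto
  have "C \<noteq> {}" "C \<subseteq> contact_angles r"
    using in_components_nonempty[OF assms] in_components_subset[OF assms] by auto
  have "s \<le> t" using \<open>C \<noteq> {}\<close> unfolding st by simp
  then have "s \<in> {0..2*pi}" "t \<in> {0..2*pi}" using \<open>C \<subseteq> _\<close> st by (auto simp: contact_angles_def)
  then show thesis using that st \<open>s \<le> t\<close> by auto
qed

lemma contact_arcs_circular:
  assumes "X \<in> contact_arcs r"
  shows "circular_arc r X"
proof -
  obtain C where C: "C \<in> components (contact_angles r)" "X = g ` C" using assms by (auto simp: contact_arcs_def)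
  obtain s t where st: "0 \<le> s" "s \<le> t" "t \<le> 2 * pi" "C = {s..t}" using contact_component[OF C(1)] .
  have "g u = of_real r * cis u" if "u \<in> C" for u
  proof -
    have "norm (g u) = r" using that in_components_subset[OF C(1)] by (auto simp: contact_angles_def)
    then show ?thesis using norm_g[of u] by (simp add: boundary_point_def)
  qed
  then have "X = (\<lambda>u. of_real r * cis u) ` {s..t}" using C(2) st(4) by auto
  then show ?thesis using st unfolding circular_arc_def by (intro exI[of _ s] exI[of _ t]) auto
qed

lemma Union_contact_arcs: "\<Union> (contact_arcs r) = frontier K \<inter> sphere 0 r"
proof -
  have "\<Union> (contact_arcs r) = g ` \<Union> (components (contact_angles r))"
    unfolding contact_arcs_def by blast
  also have "\<dots> = frontier K \<inter> sphere 0 r"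
    unfolding Union_components frontier_eq by (auto simp: contact_angles_def)
  finally show ?thesis .
qed

lemma contact_arcs_disjoint:
  assumes "X \<in> contact_arcs r" "Y \<in> contact_arcs r" "X \<noteq> Y"
  shows "finite (X \<inter> Y)"
proof -
  obtain C D where C: "C \<in> components (contact_angles r)" "X = g ` C"
    and D: "D \<in> components (contact_angles r)" "Y = g ` D" using assms by (auto simp: contact_arcs_def)
  have disj: "C \<inter> D = {}" using components_nonoverlap[OF C(1) D(1)] assms(3) C(2) D(2) by auto
  have "X \<inter> Y \<subseteq> {g 0}"
  proof
    fix z assume "z \<in> X \<inter> Y"
    then obtain u v where uv: "u \<in> C" "v \<in> D" "z = g u" "z = g v" using C D by auto
    have range: "0 \<le> u" "u \<le> 2 * pi" "0 \<le> v" "v \<le> 2 * pi"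
      using uv in_components_subset[OF C(1)] in_components_subset[OF D(1)] by (auto simp: contact_angles_def)
    have "u \<noteq> v" using uv disj by auto
    have "\<rho> u = \<rho> v" using uv norm_g by metis
    moreover have "\<rho> u *\<^sub>R cis u = \<rho> v *\<^sub>R cis v" using uv g_eq by metis
    ultimately have "cis u = cis v" using radial_pos[of v] by simp
    then have "u = 0 \<or> v = 0"
      using cis_eq_cisD[of u v] cis_eq_cisD[of v u] range \<open>u \<noteq> v\<close> by (cases "u \<le> v") force+
    then show "z \<in> {g 0}" using uv by auto
  qed
  then show ?thesis by (rule finite_subset) simp
qed

text \<open>If nothing infinite came close to \<open>x\<close>, the boundary near \<open>x\<close> would lie on the two circles, by
  continuity on that of \<open>x\<close>. Then the component of the angle of \<open>x\<close> would contain an interval, and the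
  corresponding arc would be infinite.\<close>

lemma contact_point_accumulation:
  assumes x: "x \<in> frontier K" "norm x = r" "r = a \<or> r = b" and ab: "a < b"
    and covered: "\<And>z. z \<in> frontier K \<Longrightarrow> a < norm z \<Longrightarrow> norm z < b \<Longrightarrow> z \<in> U"
    and arcs: "\<And>X. X \<in> contact_arcs r \<Longrightarrow> infinite X \<Longrightarrow> X \<subseteq> U"
  shows "x \<in> closure U"
proof (rule ccontr)
  assume nx: "x \<notin> closure U"
  then obtain \<epsilon> where eps: "0 < \<epsilon>" "ball x \<epsilon> \<inter> U = {}"
  proof -
    obtain \<epsilon> where "0 < \<epsilon>" "\<forall>y\<in>U. \<not> dist y x < \<epsilon>" using nx by (auto simp: closure_approachable)
    then have "ball x \<epsilon> \<inter> U = {}" by (auto simp: dist_commute)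
    then show thesis using that \<open>0 < \<epsilon>\<close> by blast
  qed
  define \<gamma> where "\<gamma> = min \<epsilon> (b - a)"
  have \<gamma>: "0 < \<gamma>" "\<gamma> \<le> \<epsilon>" "\<gamma> \<le> b - a" using eps ab by (auto simp: \<gamma>_def)
  obtain u where u: "0 \<le> u" "u \<le> 2 * pi" "x = g u" using x(1) frontier_eq by auto
  have "isCont g u" using continuous_g[of UNIV] by (simp add: continuous_on_eq_continuous_at)
  then obtain \<eta> where \<eta>: "0 < \<eta>" "\<And>v. dist v u < \<eta> \<Longrightarrow> dist (g v) (g u) < \<gamma>"
    using \<gamma>(1) unfolding continuous_at_eps_delta by metis
  define I where "I = {max 0 (u - \<eta> / 2)..min (2 * pi) (u + \<eta> / 2)}"
  have I: "I \<subseteq> contact_angles r"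
  proof
    fix v assume v: "v \<in> I"
    then have "dist v u < \<eta>" using \<eta>(1) by (auto simp: I_def dist_real_def)
    then have close: "norm (g v - x) < \<gamma>" using \<eta>(2) u(3) by (simp add: dist_norm)
    then have "g v \<notin> U" using eps \<gamma> by (auto simp: dist_norm norm_minus_commute disjoint_iff)
    then have "norm (g v) \<le> a \<or> b \<le> norm (g v)" using covered[OF g_frontier, of v] by force
    moreover have "a \<le> norm (g v)" "norm (g v) \<le> b" using radial_ge radial_le by (auto simp: norm_g)
    moreover have "\<bar>norm (g v) - r\<bar> < b - a"
      using norm_triangle_ineq3[of "g v" x] close \<gamma> x(2) by simp
    ultimately have "norm (g v) = r" using x(3) by auto
    then show "v \<in> contact_angles r" using v by (auto simp: contact_angles_def I_def)
  qed
  have uI: "u \<in> I" using u \<eta>(1) by (auto simp: I_def)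
  obtain C where C: "C \<in> components (contact_angles r)" "u \<in> C"
    using uI I Union_components by blast
  have "connected I" "C \<inter> I \<noteq> {}" using uI C(2) by (auto simp: I_def)
  then have "I \<subseteq> C" using components_maximal[OF C(1) _ I] by blast
  obtain v where v: "v \<in> I" "v \<noteq> u" "\<bar>v - u\<bar> < 2 * pi"
  proof (cases "u = 0")
    case True
    then show thesis using that[of "min pi (\<eta> / 2)"] \<eta>(1) pi_gt_zero by (auto simp: I_def min_def)
  next
    case False
    then show thesis using that[of "max (u / 2) (u - \<eta> / 2)"] u \<eta>(1) pi_gt_zero by (auto simp: I_def max_def)
  qed
  have "g v \<noteq> g u"
  proof
    assume eq: "g v = g u"
    then have "\<rho> v = \<rho> u" using norm_g by metis
    moreover have "\<rho> v *\<^sub>R cis v = \<rho> u *\<^sub>R cis u" using eq g_eq by metis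
    ultimately have "cis v = cis u" using radial_pos[of u] by simp
    then show False
      using cis_eq_cisD[of u v] cis_eq_cisD[of v u] v by (cases "u \<le> v") force+
  qed
  have "connected (g ` C)"
    using in_components_connected[OF C(1)] by (intro connected_continuous_image continuous_g)
  moreover have "g u \<in> g ` C" "g v \<in> g ` C" using C v \<open>I \<subseteq> C\<close> by auto
  ultimately have "infinite (g ` C)"
    using \<open>g v \<noteq> g u\<close> connected_finite_iff_sing[of "g ` C"] by (metis empty_iff singletonD)
  moreover have "g ` C \<in> contact_arcs r" using C by (auto simp: contact_arcs_def)
  ultimately have "x \<in> U" using arcs C(2) u(3) by blast
  then show False using nx closure_subset by blast
qed

end

context minimizer begin

text \<open>If the end \<open>e\<close> of a tangent face is not on the outer circle, it is a vertex of the open ring. The second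
  face there also ends at \<open>e\<close>, so it touches the inner disc by \<open>free_vertex_touches\<close> and provides the mate.\<close>

lemma touching_face_covered:
  assumes n: "supports n h" and T: "T \<in> face n h" "norm T \<le> a" and face: "face n h = closed_segment e e'"
    and "e \<noteq> T" and ab: "a < b"
  shows "closed_segment T e \<in> boundary_pieces a b K"
proof -
  note cT = contact_point[OF n T]
  have ef: "e \<in> face n h" using face by auto
  have seg: "closed_segment T e \<subseteq> face n h" "closed_segment T e \<subseteq> frontier K"
    using segment_in_face[OF n T(1) ef] by auto
  have tan: "tangent_at a T (closed_segment T e)" using tangent_at_face[OF n T seg(1)] by simp
  have "norm e \<le> b" using ef outer_disc by (auto simp: face_def)
  show ?thesis
  proof (cases "norm e = b")
    case True
    have comm: "closed_segment e T = closed_segment T e" by (rule closed_segment_commute)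
    have "closed_segment e T \<in> tangent_chord_halves a b K"
      unfolding tangent_chord_halves_def
    proof (intro CollectI exI conjI)
      show "e \<in> sphere 0 b" using True by simp
      show "tangent_at a T (closed_segment e T)" "closed_segment e T \<subseteq> frontier K"
        using tan seg(2) by (simp_all only: comm)
    qed (rule refl)
    then show ?thesis using comm by simp
  next
    case False
    then have eb: "norm e < b" using \<open>norm e \<le> b\<close> by simp
    have "cross n e \<noteq> 0" using face_decomp[OF n ef] cT(2) \<open>e \<noteq> T\<close> by auto
    then have "a ^ 2 < norm e ^ 2" using norm_face[OF n ef] cT(1) by simp
    then have ea: "a < norm e" by (auto intro: power2_less_imp_less)
    obtain m k w where m: "supports m k" "e \<in> face m k" "w \<in> face m k" "w \<noteq> e" "m \<noteq> n"
      using second_face_at_vertex[OF n face ea eb] .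
    obtain y z where yz: "face m k = closed_segment y z" "y \<in> face m k" "z \<in> face m k"
      using face_segment[OF m(1)] m(2) by auto
    have "e = y \<or> e = z"
    proof (rule ccontr)
      assume ends: "\<not> ?thesis"
      then obtain u where u: "0 < u" "u < 1" "e = (1 - u) *\<^sub>R y + u *\<^sub>R z"
        using m(2) unfolding yz(1) in_segment by (metis less_le scaleR_one scaleR_zero_left add_0 add.right_neutral diff_zero diff_self)
      have K: "inner n y \<le> h" "inner n z \<le> h" using n yz by (auto simp: supports_def face_def)
      have "inner n e = h" using ef by (simp add: face_def)
      then have "(1 - u) * (h - inner n y) + u * (h - inner n z) = 0"
        using u(3) by (simp add: inner_add_right algebra_simps)
      moreover have "0 \<le> (1 - u) * (h - inner n y)" "0 \<le> u * (h - inner n z)" using K u by auto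
      ultimately have "(1 - u) * (h - inner n y) = 0" by linarith
      then have "inner n y = h" using u by simp
      then have "y \<in> face n h" using yz(2) by (auto simp: face_def)
      then show False using face_inj[OF n m(1), of e y] ef m yz(2) ends by auto
    qed
    then obtain e'' where face': "face m k = closed_segment e e''"
      using yz(1) by (auto simp: closed_segment_commute)
    have "e \<noteq> e''" using m(3,4) face' by auto
    then obtain Q where Q: "Q \<in> face m k" "norm Q \<le> a" using free_vertex_touches[OF m(1) face' _ ea eb] by blast
    note cQ = contact_point[OF m(1) Q]
    have "Q \<noteq> T" using cQ cT m(5) a_pos by auto
    moreover have "tangent_at a Q (closed_segment e Q)" "closed_segment e Q \<subseteq> frontier K"
      using tangent_at_face[OF m(1) Q, of "closed_segment e Q"] segment_in_face[OF m(1,2) Q(1)] by auto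
    ultimately have "closed_segment T e \<in> tangent_portions a b K"
      using tan seg(2) False unfolding tangent_portions_def by auto
    then show ?thesis by simp
  qed
qed

text \<open>A boundary point of the open ring lies on a face. A face that touches the inner disc is cut at the
  point of contact; any other face is a chord of the outer disc and is cut at its midpoint.\<close>

lemma ring_point_covered:
  assumes x: "x \<in> frontier K" "a < norm x" "norm x < b"
  shows "\<exists>X\<in>boundary_pieces a b K. x \<in> X"
proof -
  have ab: "a < b" using x by linarith
  obtain p q where q: "closed_segment x q \<subseteq> frontier K" "0 < cross x q" using adjacent_segments[OF x] .
  obtain n h where n: "supports n h" "x \<in> face n h" "q \<in> face n h" using frontier_segment_in_face[OF q(1)] .
  obtain y z where yz: "face n h = closed_segment y z" "y \<in> face n h" "z \<in> face n h"
    using face_segment[OF n(1)] n(2) by auto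
  have zy: "face n h = closed_segment z y" using yz(1) by (simp add: closed_segment_commute)
  have "y \<noteq> z" using q(2) n(2,3) yz(1) by auto
  show ?thesis
  proof (cases "\<exists>T\<in>face n h. norm T \<le> a")
    case True
    then obtain T where T: "T \<in> face n h" "norm T \<le> a" by blast
    have "T \<noteq> x" using T x by auto
    have "closed_segment y T \<union> closed_segment T z = closed_segment y z"
      using T(1) yz(1) by (intro Un_closed_segment) auto
    then consider "x \<in> closed_segment T y" | "x \<in> closed_segment T z"
      using n(2) yz(1) by (auto simp: closed_segment_commute)
    then show ?thesis
    proof cases
      case 1
      then have "y \<noteq> T" using \<open>T \<noteq> x\<close> by auto
      then show ?thesis using 1 touching_face_covered[OF n(1) T yz(1) _ ab] by blast
    next
      case 2
      then have "z \<noteq> T" using \<open>T \<noteq> x\<close> by auto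
      then show ?thesis using 2 touching_face_covered[OF n(1) T zy _ ab] by blast
    qed
  next
    case False
    then have far: "a < norm T" if "T \<in> face n h" for T using that by force
    have "norm y \<le> b" "norm z \<le> b" using yz outer_disc by (auto simp: face_def)
    then have b: "norm y = b" "norm z = b"
      using free_vertex_touches[OF n(1) yz(1) \<open>y \<noteq> z\<close> far[OF yz(2)]]
        free_vertex_touches[OF n(1) zy \<open>y \<noteq> z\<close>[symmetric] far[OF yz(3)]] False by force+
    have no: "\<not> (\<exists>T. tangent_at a T (closed_segment y z))" using False unfolding yz(1) tangent_at_def by auto
    have fr: "closed_segment y z \<subseteq> frontier K" using segment_in_face(2)[OF n(1) yz(2,3)] .
    have "closed_segment y (midpoint y z) \<in> chord_halves a b K"
      unfolding chord_halves_def
      using b no fr \<open>y \<noteq> z\<close> by (intro CollectI exI[of _ y] exI[of _ z]) simp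
    moreover have "closed_segment z (midpoint z y) \<in> chord_halves a b K"
    proof -
      have "closed_segment z y = closed_segment y z" by (rule closed_segment_commute)
      then have "\<not> (\<exists>T. tangent_at a T (closed_segment z y))" "closed_segment z y \<subseteq> frontier K"
        using no fr by (simp_all only: not_False_eq_True)
      then show ?thesis unfolding chord_halves_def
        using b \<open>y \<noteq> z\<close> by (intro CollectI exI[of _ z] exI[of _ y]) simp
    qed
    moreover have "closed_segment y (midpoint y z) \<union> closed_segment (midpoint y z) z = closed_segment y z"
      by (intro Un_closed_segment) simp
    then have "x \<in> closed_segment y (midpoint y z) \<or> x \<in> closed_segment z (midpoint z y)"
      using n(2) yz(1) closed_segment_commute midpoint_sym by (metis Un_iff)
    ultimately show ?thesis by blast
  qed
qed

lemma frontier_decomposes: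
  assumes ab: "a < b"
  shows "decomposes (contact_arcs a \<union> contact_arcs b \<union> boundary_pieces a b K) (frontier K)"
proof -
  let ?P = "contact_arcs a \<union> contact_arcs b \<union> boundary_pieces a b K"
  let ?U = "\<Union> {X \<in> ?P. infinite X}"
  have norms: "a \<le> norm z \<and> norm z \<le> b" if "z \<in> frontier K" for z
    using that frontier_eq radial_ge radial_le by (auto simp: norm_g)
  have piece_U: "z \<in> ?U" if z: "z \<in> frontier K" "a < norm z" "norm z < b" for z
  proof -
    obtain X where "X \<in> boundary_pieces a b K" "z \<in> X" using ring_point_covered[OF z] by blast
    then show ?thesis using piece_infinite[OF ab] by blast
  qed
  have arc_sphere: "X \<subseteq> frontier K \<inter> sphere 0 r" if "X \<in> contact_arcs r" for X r
    using that Union_contact_arcs[of r] by blast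
  have "frontier K = \<Union> ?P"
  proof (intro equalityI subsetI)
    fix z assume z: "z \<in> frontier K"
    then consider "norm z = a" | "norm z = b" | "a < norm z" "norm z < b" using norms by fastforce
    then show "z \<in> \<Union> ?P"
    proof cases
      case 1
      then have "z \<in> \<Union> (contact_arcs a)" unfolding Union_contact_arcs using z by simp
      then show ?thesis by blast
    next
      case 2
      then have "z \<in> \<Union> (contact_arcs b)" unfolding Union_contact_arcs using z by simp
      then show ?thesis by blast
    next
      case 3
      then show ?thesis using piece_U[OF z] by blast
    qed
  next
    fix z assume "z \<in> \<Union> ?P"
    then show "z \<in> frontier K" using arc_sphere piece_frontier[OF ab] by blast
  qed
  moreover have "pairwise (\<lambda>X Y. finite (X \<inter> Y)) ?P"
  proof (rule pairwiseI)
    fix X Y assume XY: "X \<in> ?P" "Y \<in> ?P" "X \<noteq> Y"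
    have arc_piece: "finite (X \<inter> Y)" if "X \<in> contact_arcs r" "Y \<in> boundary_pieces a b K" for X Y r
    proof -
      have "X \<inter> Y \<subseteq> Y \<inter> sphere 0 r" using arc_sphere[OF that(1)] by blast
      then show ?thesis using piece_sphere_finite[OF ab that(2)] finite_subset by blast
    qed
    have arc_arc: "finite (X \<inter> Y)" if "X \<in> contact_arcs r" "Y \<in> contact_arcs s" "X \<noteq> Y" for X Y r s
    proof (cases "r = s")
      case True
      then show ?thesis using contact_arcs_disjoint that by blast
    next
      case False
      then have "sphere 0 r \<inter> sphere 0 s = ({} :: complex set)" by auto
      then have "X \<inter> Y = {}" using arc_sphere[OF that(1)] arc_sphere[OF that(2)] by blast
      then show ?thesis by simp
    qed
    have pieces: "finite (X \<inter> Y)" if "X \<in> boundary_pieces a b K" "Y \<in> boundary_pieces a b K"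
      using pieces_meet_at_most_once[OF ab that XY(3)] .
    have "finite (X \<inter> Y)" if "X \<in> boundary_pieces a b K" "Y \<in> contact_arcs a \<union> contact_arcs b"
      using arc_piece[of Y _ X] that by (auto simp: Int_commute)
    then show "finite (X \<inter> Y)"
      using XY(1,2) arc_piece[of X _ Y] arc_arc[of X _ Y, OF _ _ XY(3)] pieces by blast
  qed
  moreover have "frontier K \<subseteq> closure ?U"
  proof
    fix z assume z: "z \<in> frontier K"
    show "z \<in> closure ?U"
    proof (cases "a < norm z \<and> norm z < b")
      case True
      then have "z \<in> ?U" by (intro piece_U z) auto
      then show ?thesis by (rule subsetD[OF closure_subset])
    next
      case False
      then have r: "norm z = a \<or> norm z = b" using norms[OF z] by auto
      show ?thesis
      proof (rule contact_point_accumulation[OF z refl r ab])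
        fix X assume "X \<in> contact_arcs (norm z)" "infinite X"
        then have "X \<in> {X \<in> ?P. infinite X}" using r by auto
        then show "X \<subseteq> ?U" by (rule Union_upper)
      qed (rule piece_U)
    qed
  qed
  ultimately show ?thesis by (simp add: decomposes_def)
qed

end

theorem theorem2p6:
  fixes a b l :: real and \<Omega> :: "complex set"
  assumes "0 < a" and "a < b" and "0 \<le> l"
    and "is_arg_min (J l) (\<lambda>K. K \<in> convex_ring_class a b) \<Omega>"
  shows "\<exists>A B S. (\<forall>X\<in>A. circular_arc a X) \<and> (\<forall>X\<in>B. circular_arc b X) \<and>
    S \<subseteq> tangent_chord_halves a b \<Omega> \<union> tangent_portions a b \<Omega> \<union> chord_halves a b \<Omega> \<and>
    decomposes (A \<union> B \<union> S) (frontier \<Omega>)"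
proof -
  interpret minimizer a b \<Omega> l
    using assms by unfold_locales (auto simp: is_arg_min_linorder)
  show ?thesis
    using contact_arcs_circular frontier_decomposes[OF assms(2)]
    by (intro exI[of _ "contact_arcs a"] exI[of _ "contact_arcs b"] exI[of _ "boundary_pieces a b \<Omega>"]) auto
qed

end
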